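(* Let $\tau$ be an increasing function with $\tau(n)=O(\log\log\log n)$. If there is a $\tau$-reduction family, then there is a uniform-$\tau'$-reduction family for some $\tau'=O(\tau)$.
   Context: For $b,\ell,\kappa\in\mathbb{N}$, a $(b,\ell,\kappa)$-reduction is a pair $(\varphi,V)$ with $\varphi:\{0,1\}^{b\cdot\ell}\to\mathbb{Z}^\ell$ and $V\subseteq\mathbb{Z}$ such that (i) for all $x,y\in\{0,1\}^{b\cdot\ell}$, $x\cdot y=0\iff\varphi(x)\cdot\varphi(y)\in V$, and (ii) $0\le\varphi(x)_i<\ell^{\kappa\cdot b}$ for all $x$ and $i\in[\ell]$. For an increasing function $\tau$, a $\tau$-reduction family is a family $\{(\varphi_{b,\ell},V_{b,\ell})\}_{b,\ell}$ such that each $(\varphi_{b,\ell},V_{b,\ell})$ is a $(b,\ell,\tau(b))$-reduction. It is a uniform-$\tau$-reduction family if moreover, for all $b$ and all $\ell\le\log\log\log b$, there is an algorithm that computes $\varphi_{b,\ell}(x)$ in $\mathrm{poly}(b)$ time given $b,\ell$ and $x\in\{0,1\}^{b\cdot\ell}$, and constructs $V_{b,\ell}$ in $O\left(\ell^{O(\tau(b)\cdot b)}\cdot\mathrm{poly}(b)\right)$ time given $b$ and $\ell$.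
   Formalization: Families range over ℓ ≥ 2 in both hypothesis and conclusion: for ℓ = 1 and b ≥ 1, condition (ii) forces φ = 0, so (i) fails and no τ-reduction family could exist as literally defined; the trivial case ℓ = 0 is dropped too. *)

theory Defs
  imports
    Complex_Main
    "HOL-Library.ListVector"
    "HOL-Library.Landau_Symbols"
    "HOL-Computational_Algebra.Polynomial"
begin

section \<open>Reductions\<close>

definition bitvecs :: "nat \<Rightarrow> int list set" where
  "bitvecs n = {x. length x = n \<and> set x \<subseteq> {0, 1}}"

definition is_reduction ::
    "nat \<Rightarrow> nat \<Rightarrow> nat \<Rightarrow> (int list \<Rightarrow> int list) \<Rightarrow> int set \<Rightarrow> bool" where
  "is_reduction b l \<kappa> \<phi> V \<longleftrightarrow>
     (\<forall>x \<in> bitvecs (b * l). length (\<phi> x) = l) \<and>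
     (\<forall>x \<in> bitvecs (b * l). \<forall>y \<in> bitvecs (b * l). \<langle>x, y\<rangle> = 0 \<longleftrightarrow> \<langle>\<phi> x, \<phi> y\<rangle> \<in> V) \<and>
     (\<forall>x \<in> bitvecs (b * l). \<forall>i < l. 0 \<le> \<phi> x ! i \<and> \<phi> x ! i < int l ^ (\<kappa> * b))"

text \<open>
  The dimension \<open>l\<close> ranges over \<open>l \<ge> 2\<close>.  For \<open>l = 1\<close> and \<open>b \<ge> 1\<close> the bound
  \<open>\<phi> x ! i < 1 ^ (\<kappa> * b)\<close> forces \<open>\<phi> x = [0]\<close> for all \<open>x\<close>, so that no reduction exists; a family
  indexed by all \<open>l\<close> would not exist for any \<open>\<tau>\<close>.  Since \<open>\<tau>\<close> is integer-valued and may grow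
  very slowly, ``increasing'' means nondecreasing.
\<close>

definition reduction_family ::
    "(nat \<Rightarrow> nat) \<Rightarrow> (nat \<Rightarrow> nat \<Rightarrow> int list \<Rightarrow> int list) \<Rightarrow> (nat \<Rightarrow> nat \<Rightarrow> int set) \<Rightarrow> bool" where
  "reduction_family \<tau> \<phi> V \<longleftrightarrow>
     mono \<tau> \<and> (\<forall>b. \<forall>l \<ge> 2. is_reduction b l (\<tau> b) (\<phi> b l) (V b l))"

section \<open>Algorithms and running time\<close>

text \<open>
  Algorithms are programs of the random access machine with integer registers, addition,
  subtraction and halving, and unit cost per instruction (structured control flow instead of
  jumps).  There is no multiplication, so \<open>t\<close> steps lengthen numbers by at most \<open>O(t)\<close> bits, and
  the machine simulates and is simulated by multitape Turing machines with polynomial overhead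
  (Papadimitriou, Computational Complexity, Section 2.6).
  Both time bounds below are insensitive to such an overhead.
\<close>

datatype com =
    Skip
  | Const nat int
  | Load nat nat
  | Store nat nat
  | Add nat nat nat
  | Sub nat nat nat
  | Half nat nat
  | Seq com com
  | Cond nat com com
  | While nat com

type_synonym memory = "nat \<Rightarrow> int"

text \<open>
  \<open>exec c s t s'\<close>: started in memory \<open>s\<close>, program \<open>c\<close> halts after \<open>t\<close> steps in memory \<open>s'\<close>.
  A negative indirect address refers to register 0.
\<close>

inductive exec :: "com \<Rightarrow> memory \<Rightarrow> nat \<Rightarrow> memory \<Rightarrow> bool" where
  Skip: "exec Skip s 1 s"
| Const: "exec (Const i n) s 1 (s(i := n))"
| Load: "exec (Load i j) s 1 (s(i := s (nat (s j))))"
| Store: "exec (Store i j) s 1 (s(nat (s i) := s j))"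
| Add: "exec (Add i j k) s 1 (s(i := s j + s k))"
| Sub: "exec (Sub i j k) s 1 (s(i := s j - s k))"
| Half: "exec (Half i j) s 1 (s(i := s j div 2))"
| Seq: "exec c s t s' \<Longrightarrow> exec d s' u s'' \<Longrightarrow> exec (Seq c d) s (t + u) s''"
| CondTrue: "s i > 0 \<Longrightarrow> exec c s t s' \<Longrightarrow> exec (Cond i c d) s (Suc t) s'"
| CondFalse: "s i \<le> 0 \<Longrightarrow> exec d s t s' \<Longrightarrow> exec (Cond i c d) s (Suc t) s'"
| WhileFalse: "s i \<le> 0 \<Longrightarrow> exec (While i c) s 1 s"
| WhileTrue: "s i > 0 \<Longrightarrow> exec c s t s' \<Longrightarrow> exec (While i c) s' u s'' \<Longrightarrow>
    exec (While i c) s (Suc (t + u)) s''"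

inductive_cases exec_SeqE: "exec (Seq c d) s t s'"
inductive_cases exec_CondE: "exec (Cond i c d) s t s'"
inductive_cases exec_WhileE: "exec (While i c) s t s'"

lemma exec_deterministic:
  assumes "exec c s t s'" and "exec c s u s''"
  shows "u = t \<and> s'' = s'"
  using assms
proof (induction arbitrary: u s'' rule: exec.induct)
  case (Seq c s t s' d u' s1)
  from Seq.prems show ?case
    by (rule exec_SeqE) (use Seq.IH in blast)
next
  case (CondTrue s i c t s' d)
  from CondTrue.prems show ?case
    by (rule exec_CondE) (use CondTrue.hyps(1) CondTrue.IH in auto)
next
  case (CondFalse s i d t s' c)
  from CondFalse.prems show ?case
    by (rule exec_CondE) (use CondFalse.hyps(1) CondFalse.IH in auto)
next
  case (WhileFalse s i c)
  from WhileFalse.prems show ?case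
    by (rule exec_WhileE) (use WhileFalse.hyps(1) in auto)
next
  case (WhileTrue s i c t s' u' s1)
  from WhileTrue.prems show ?case
  proof (rule exec_WhileE)
    assume "s i \<le> 0"
    with WhileTrue.hyps(1) show ?thesis by simp
  next
    fix t' s2 v
    assume "u = Suc (t' + v)" and "exec c s t' s2" and "exec (While i c) s2 v s''"
    with WhileTrue.IH show ?thesis by blast
  qed
qed (erule exec.cases; simp)+

definition init_mem :: "int list \<Rightarrow> memory" where
  "init_mem xs = (\<lambda>i. if i < length xs then xs ! i else 0)"

definition computes_within :: "com \<Rightarrow> int list \<Rightarrow> int list \<Rightarrow> nat \<Rightarrow> bool" where
  "computes_within c xs ys T \<longleftrightarrow>
     (\<exists>t s. exec c (init_mem xs) t s \<and> t \<le> T \<and> (\<forall>i < length ys. s i = ys ! i))"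

section \<open>Uniform reduction families\<close>

text \<open>
  \<open>admissible b l\<close> implies \<open>b \<ge> 2 ^ 16\<close>: for \<open>b < 2\<close> the iterated logarithm is \<open>0\<close> because
  \<open>log 2 0 = 0\<close>.
\<close>

definition admissible :: "nat \<Rightarrow> nat \<Rightarrow> bool" where
  "admissible b l \<longleftrightarrow> 2 \<le> l \<and> real l \<le> log 2 (log 2 (log 2 (real b)))"

text \<open>
  One program serves all admissible \<open>b\<close>, \<open>l\<close>, which are part of its input.
  The set \<open>V b l\<close> is output as the number of its elements followed by the elements.  In the
  second time bound the constant hidden in the outer \<open>O\<close> is absorbed by the polynomial \<open>q\<close>.
\<close>

definition uniform_reduction_family ::
    "(nat \<Rightarrow> nat) \<Rightarrow> (nat \<Rightarrow> nat \<Rightarrow> int list \<Rightarrow> int list) \<Rightarrow> (nat \<Rightarrow> nat \<Rightarrow> int set) \<Rightarrow> bool" where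
  "uniform_reduction_family \<tau> \<phi> V \<longleftrightarrow>
     reduction_family \<tau> \<phi> V \<and>
     (\<exists>c. \<exists>p :: nat poly. \<forall>b l. admissible b l \<longrightarrow>
        (\<forall>x \<in> bitvecs (b * l).
           computes_within c ([int b, int l] @ x) (\<phi> b l x) (poly p b))) \<and>
     (\<exists>c. \<exists>C. \<exists>q :: nat poly. \<forall>b l. admissible b l \<longrightarrow>
        (\<exists>vs. distinct vs \<and> set vs = V b l \<and>
           computes_within c [int b, int l] (int (length vs) # vs)
             (l ^ (C * (\<tau> b * b)) * poly q b)))"

end

theory Submission
  imports
    Defs
    "HOL-Number_Theory.Cong"
    "HOL-Computational_Algebra.Primes"
begin

text \<open>
  A reduction for \<open>b\<^sub>0\<close> yields one for \<open>m * b\<^sub>0\<close>: split the bits into \<open>m\<close> blocks, apply the small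
  reduction to each block, and glue the results coordinatewise by Chinese remaindering modulo \<open>m\<close>
  distinct primes that exceed all inner products of the small reduction.  The residues of an inner product
  of glued vectors are then the inner products of the blocks.  If \<open>m\<close> is at most
  exponential in the length of the entries, the primes are not much longer than the inner products and
  \<open>\<kappa>\<close> grows by a constant factor only.  For \<open>b\<^sub>0\<close> about \<open>log log b / (2 l)\<close> there are so few candidate tables
  that the entry bound of the smallest valid table, which is at most that of the given family, is found by
  exhaustive search in time polynomial in \<open>b\<close>.  The first gluing step stops when the entries
  may reach \<open>log b\<close>, the second one when they may reach \<open>b\<close>, and the third one when all \<open>b\<close> bits are covered.

  All algorithms are written as functions on natural numbers that are built from addition, bounded
  iteration and bounded search; a bit vector is packed into one number, so that the machine needs indirect
  addressing only to read its input and to write its output.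
\<close>

section \<open>Programs on scratch registers\<close>

definition runs :: "com \<Rightarrow> memory \<Rightarrow> nat \<Rightarrow> nat \<Rightarrow> nat \<Rightarrow> nat \<Rightarrow> bool" where
  "runs c s T k K v \<longleftrightarrow> (\<exists>t s'. exec c s t s' \<and> t \<le> T \<and> s' k = int v \<and>
     (\<forall>i. i < k \<or> K \<le> i \<longrightarrow> s' i = s i))"

definition holds :: "nat list \<Rightarrow> nat list \<Rightarrow> memory \<Rightarrow> bool" where
  "holds \<rho> e s \<longleftrightarrow> length e = length \<rho> \<and> (\<forall>i < length \<rho>. s (\<rho> ! i) = int (e ! i))"

text \<open>
  In \<open>ptime n D B f\<close> the \<open>n\<close> arguments reside in arbitrary registers \<open>\<rho>\<close> below the target \<open>k\<close>, and the
  registers from \<open>k\<close> up to a constant \<open>K\<close> may be overwritten.  This freedom makes programs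
  composable.  The size \<open>B e\<close> only has to bound the iteration counts; the values may have up to
  \<open>B e\<close> bits.  Since \<open>B e + 2 \<ge> 2\<close>, constant factors are absorbed by the exponent.
\<close>

definition ptime :: "nat \<Rightarrow> (nat list \<Rightarrow> bool) \<Rightarrow> (nat list \<Rightarrow> nat) \<Rightarrow> (nat list \<Rightarrow> nat) \<Rightarrow> bool" where
  "ptime n D B f \<longleftrightarrow> (\<forall>\<rho> k. length \<rho> = n \<longrightarrow> (\<forall>r \<in> set \<rho>. r < k) \<longrightarrow>
     (\<exists>c K m. k < K \<and> (\<forall>e s. D e \<longrightarrow> holds \<rho> e s \<longrightarrow> runs c s ((B e + 2) ^ m) k K (f e))))"

lemma ptimeI:
  assumes "\<And>\<rho> k. length \<rho> = n \<Longrightarrow> \<forall>r \<in> set \<rho>. r < k \<Longrightarrow>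
     \<exists>c K m. k < K \<and> (\<forall>e s. D e \<longrightarrow> holds \<rho> e s \<longrightarrow> runs c s ((B e + 2) ^ m) k K (f e))"
  shows "ptime n D B f"
  using assms unfolding ptime_def by blast

lemma ptimeE:
  assumes "ptime n D B f" and "length \<rho> = n" and "\<forall>r \<in> set \<rho>. r < k"
  obtains c K m where "k < K"
    and "\<And>e s. D e \<Longrightarrow> holds \<rho> e s \<Longrightarrow> runs c s ((B e + 2) ^ m) k K (f e)"
  using assms unfolding ptime_def by blast

lemma holds_cong:
  assumes "holds \<rho> e s" and "\<forall>r \<in> set \<rho>. r < k" and "\<And>i. i < k \<Longrightarrow> s' i = s i"
  shows "holds \<rho> e s'"
  using assms unfolding holds_def by simp

lemma holds_Cons [simp]:
  "holds (r # \<rho>) (a # e) s \<longleftrightarrow> s r = int a \<and> holds \<rho> e s"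
  unfolding holds_def by (auto simp: less_Suc_eq_0_disj)

lemma runsI:
  "exec c s t s' \<Longrightarrow> t \<le> T \<Longrightarrow> s' k = int v \<Longrightarrow> (\<And>i. i < k \<or> K \<le> i \<Longrightarrow> s' i = s i) \<Longrightarrow> runs c s T k K v"
  unfolding runs_def by blast

lemma runsE:
  assumes "runs c s T k K v"
  obtains t s' where "exec c s t s'" "t \<le> T" "s' k = int v" "\<And>i. i < k \<or> K \<le> i \<Longrightarrow> s' i = s i"
  using assms unfolding runs_def by blast

lemma runs_mono:
  assumes "runs c s T k K v" and "T \<le> T'"
  shows "runs c s T' k K v"
  using assms(1) by (rule runsE) (use assms(2) in \<open>auto intro: runsI\<close>)

lemma power_sum_le:
  fixes b :: nat
  assumes "x \<le> (b + 2) ^ m" and "y \<le> (b + 2) ^ k"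
  shows "x + y \<le> (b + 2) ^ (m + k + 1)"
proof -
  have "x \<le> (b + 2) ^ (m + k)" "y \<le> (b + 2) ^ (m + k)"
    using assms by (meson le_add1 le_add2 le_trans one_le_numeral power_increasing trans_le_add2)+
  then have "x + y \<le> 2 * (b + 2) ^ (m + k)" by simp
  also have "\<dots> \<le> (b + 2) ^ (m + k + 1)" by simp
  finally show ?thesis .
qed

lemma numeral_le_power:
  fixes b :: nat
  shows "n \<le> (b + 2) ^ n"
  by (metis less_exp less_imp_le_nat power_mono le_add2 le_trans zero_le)

lemma ptime_const: "ptime n D B (\<lambda>_. v)"
proof (rule ptimeI)
  fix \<rho> :: "nat list" and k
  have "runs (Const k (int v)) s ((B e + 2) ^ 0) k (Suc k) v" for e s
    by (rule runsI, rule Const) auto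
  then show "\<exists>c K m. k < K \<and> (\<forall>e s. D e \<longrightarrow> holds \<rho> e s \<longrightarrow> runs c s ((B e + 2) ^ m) k K v)"
    by (intro exI[of _ "Const k (int v)"] exI[of _ "Suc k"] exI[of _ 0]) simp
qed

lemma ptime_nth:
  assumes "i < n"
  shows "ptime n D B (\<lambda>e. e ! i)"
proof (rule ptimeI)
  fix \<rho> :: "nat list" and k
  assume \<rho>: "length \<rho> = n" "\<forall>r \<in> set \<rho>. r < k"
  let ?c = "Seq (Const k 0) (Add k k (\<rho> ! i))"
  have "\<rho> ! i < k" using \<rho> assms by simp
  then have "runs ?c s ((B e + 2) ^ 1) k (Suc k) (e ! i)" if "holds \<rho> e s" for e s
    using that \<rho> assms unfolding holds_def
    by (intro runsI[OF Seq[OF Const Add]]) auto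
  then show "\<exists>c K m. k < K \<and> (\<forall>e s. D e \<longrightarrow> holds \<rho> e s \<longrightarrow> runs c s ((B e + 2) ^ m) k K (e ! i))"
    by (intro exI[of _ ?c] exI[of _ "Suc k"] exI[of _ 1]) simp
qed

lemma ptime_cong:
  assumes "ptime n D B f" and "\<And>e. D e \<Longrightarrow> length e = n \<Longrightarrow> g e = f e"
  shows "ptime n D B g"
proof (rule ptimeI)
  fix \<rho> :: "nat list" and k
  assume \<rho>: "length \<rho> = n" "\<forall>r \<in> set \<rho>. r < k"
  obtain c K m where c: "k < K"
      "\<And>e s. D e \<Longrightarrow> holds \<rho> e s \<Longrightarrow> runs c s ((B e + 2) ^ m) k K (f e)"
    by (rule ptimeE[OF assms(1) \<rho>]) blast
  have "runs c s ((B e + 2) ^ m) k K (g e)" if "D e" "holds \<rho> e s" for e s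
    using c(2)[OF that] assms(2)[OF that(1)] that(2) \<rho>(1) unfolding holds_def by simp
  then show "\<exists>c K m. k < K \<and> (\<forall>e s. D e \<longrightarrow> holds \<rho> e s \<longrightarrow> runs c s ((B e + 2) ^ m) k K (g e))"
    using c(1) by blast
qed

lemma ptime_mono:
  assumes "ptime n D B f" and "\<And>e. D' e \<Longrightarrow> length e = n \<Longrightarrow> D e"
    and "\<And>e. D' e \<Longrightarrow> length e = n \<Longrightarrow> B e \<le> B' e"
  shows "ptime n D' B' f"
proof (rule ptimeI)
  fix \<rho> :: "nat list" and k
  assume \<rho>: "length \<rho> = n" "\<forall>r \<in> set \<rho>. r < k"
  obtain c K m where c: "k < K"
      "\<And>e s. D e \<Longrightarrow> holds \<rho> e s \<Longrightarrow> runs c s ((B e + 2) ^ m) k K (f e)"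
    by (rule ptimeE[OF assms(1) \<rho>]) blast
  have "runs c s ((B' e + 2) ^ m) k K (f e)" if "D' e" "holds \<rho> e s" for e s
  proof -
    have len: "length e = n" using that \<rho> unfolding holds_def by simp
    have "(B e + 2) ^ m \<le> (B' e + 2) ^ m"
      using assms(3)[OF that(1) len] by (intro power_mono) auto
    then show ?thesis
      using c(2)[OF assms(2)[OF that(1) len] that(2)] by (rule runs_mono[rotated])
  qed
  then show "\<exists>c K m. k < K \<and> (\<forall>e s. D' e \<longrightarrow> holds \<rho> e s \<longrightarrow> runs c s ((B' e + 2) ^ m) k K (f e))"
    using c(1) by blast
qed

text \<open>A loop prepends its counter to the argument list, so inside its body the outer arguments
  form a tail. The new domain \<open>D'\<close> may be narrower than \<open>D\<close> on tails,
  since the body also knows the range of the counter.\<close>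

lemma ptime_tl:
  assumes "ptime n D B f" and "\<And>e. D' e \<Longrightarrow> D (tl e)"
  shows "ptime (Suc n) D' (\<lambda>e. B (tl e)) (\<lambda>e. f (tl e))"
proof (rule ptimeI)
  fix \<rho> :: "nat list" and k
  assume \<rho>: "length \<rho> = Suc n" "\<forall>r \<in> set \<rho>. r < k"
  then have \<rho>': "length (tl \<rho>) = n" "\<forall>r \<in> set (tl \<rho>). r < k"
    by (auto dest: list.set_sel(2)[rotated])
  obtain c K m where c: "k < K"
      "\<And>e s. D e \<Longrightarrow> holds (tl \<rho>) e s \<Longrightarrow> runs c s ((B e + 2) ^ m) k K (f e)"
    by (rule ptimeE[OF assms(1) \<rho>']) blast
  have "holds (tl \<rho>) (tl e) s" if "holds \<rho> e s" for e s
    using that \<rho>(1) by (cases \<rho>; cases e) (auto simp: holds_def)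
  then show "\<exists>c K m. k < K \<and> (\<forall>e s. D' e \<longrightarrow> holds \<rho> e s \<longrightarrow> runs c s ((B (tl e) + 2) ^ m) k K (f (tl e)))"
    using c assms(2) by blast
qed

lemma ptime_hd: "ptime (Suc n) D B hd"
  by (rule ptime_cong[OF ptime_nth[of 0]]) (auto simp: length_Suc_conv)

lemma ptime_hd_tl: "ptime (Suc (Suc n)) D B (\<lambda>e. hd (tl e))"
  by (rule ptime_cong[OF ptime_nth[of 1]]) (auto simp: length_Suc_conv)

lemma ptime_tl_tl:
  assumes "ptime n D B f" and "\<And>e. D' e \<Longrightarrow> D (tl (tl e))"
  shows "ptime (Suc (Suc n)) D' (\<lambda>e. B (tl (tl e))) (\<lambda>e. f (tl (tl e)))"
  using ptime_tl[OF ptime_tl[OF assms(1), of "\<lambda>e. D (tl e)"], of D'] assms(2) by simp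

text \<open>The second operand is evaluated with target \<open>Suc k\<close>. Its program leaves
  \<open>k\<close> and everything below alone, so the first operand and the arguments survive until
  \<open>d\<close> combines the two registers.\<close>

lemma ptime_binary:
  assumes f: "ptime n D B f" and g: "ptime n D B g"
    and op: "\<And>k. \<exists>d u. \<forall>s x y. s k = int x \<longrightarrow> s (Suc k) = int y \<longrightarrow>
      (\<exists>t s'. exec d s t s' \<and> t \<le> u \<and> s' k = int (h x y) \<and> (\<forall>i. i \<noteq> k \<longrightarrow> s' i = s i))"
  shows "ptime n D B (\<lambda>e. h (f e) (g e))"
proof (rule ptimeI)
  fix \<rho> :: "nat list" and k
  assume \<rho>: "length \<rho> = n" "\<forall>r \<in> set \<rho>. r < k"
  then have \<rho>': "\<forall>r \<in> set \<rho>. r < Suc k" by auto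
  obtain c K m where c: "k < K"
      "\<And>e s. D e \<Longrightarrow> holds \<rho> e s \<Longrightarrow> runs c s ((B e + 2) ^ m) k K (f e)"
    by (rule ptimeE[OF f \<rho>]) blast
  obtain c' K' m' where c': "Suc k < K'"
      "\<And>e s. D e \<Longrightarrow> holds \<rho> e s \<Longrightarrow> runs c' s ((B e + 2) ^ m') (Suc k) K' (g e)"
    by (rule ptimeE[OF g \<rho>(1) \<rho>']) blast
  obtain d u where d: "\<And>s x y. s k = int x \<Longrightarrow> s (Suc k) = int y \<Longrightarrow>
      \<exists>t s'. exec d s t s' \<and> t \<le> u \<and> s' k = int (h x y) \<and> (\<forall>i. i \<noteq> k \<longrightarrow> s' i = s i)"
    using op[of k] by blast
  let ?m = "m + m' + 1 + u + 1"
  have "runs (Seq (Seq c c') d) s ((B e + 2) ^ ?m) k (max K K') (h (f e) (g e))"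
    if De: "D e" and h: "holds \<rho> e s" for e s
  proof -
    obtain t1 s1 where 1: "exec c s t1 s1" "t1 \<le> (B e + 2) ^ m" "s1 k = int (f e)"
        "\<And>i. i < k \<or> K \<le> i \<Longrightarrow> s1 i = s i"
      by (rule runsE[OF c(2)[OF De h]]) blast
    have "holds \<rho> e s1" using holds_cong[OF h \<rho>(2)] 1(4) by blast
    then obtain t2 s2 where 2: "exec c' s1 t2 s2" "t2 \<le> (B e + 2) ^ m'" "s2 (Suc k) = int (g e)"
        "\<And>i. i < Suc k \<or> K' \<le> i \<Longrightarrow> s2 i = s1 i"
      by (rule runsE[OF c'(2)[OF De]]) blast
    have "s2 k = int (f e)" using 1(3) 2(4) by simp
    then obtain t3 s3 where 3: "exec d s2 t3 s3" "t3 \<le> u" "s3 k = int (h (f e) (g e))"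
        "\<And>i. i \<noteq> k \<Longrightarrow> s3 i = s2 i"
      using d[of s2 "f e" "g e"] 2(3) by blast
    have "t3 \<le> (B e + 2) ^ u" using 3(2) numeral_le_power le_trans by blast
    then have "t1 + t2 + t3 \<le> (B e + 2) ^ ?m"
      using 1(2) 2(2) by (intro power_sum_le)
    moreover have "s3 i = s i" if "i < k \<or> max K K' \<le> i" for i
      using that 1(4)[of i] 2(4)[of i] 3(4)[of i] c(1) c'(1) by auto
    ultimately show ?thesis
      using 3(3) Seq[OF Seq[OF 1(1) 2(1)] 3(1)] by (intro runsI)
  qed
  then show "\<exists>c K m. k < K \<and> (\<forall>e s. D e \<longrightarrow> holds \<rho> e s \<longrightarrow>
      runs c s ((B e + 2) ^ m) k K (h (f e) (g e)))"
    using c(1) by (intro exI[of _ "Seq (Seq c c') d"] exI[of _ "max K K'"] exI[of _ ?m]) auto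
qed

lemma ptime_add:
  assumes "ptime n D B f" and "ptime n D B g"
  shows "ptime n D B (\<lambda>e. f e + g e)"
proof (rule ptime_binary[OF assms])
  fix k
  have "\<exists>t s'. exec (Add k k (Suc k)) s t s' \<and> t \<le> 1 \<and> s' k = int (x + y) \<and> (\<forall>i. i \<noteq> k \<longrightarrow> s' i = s i)"
    if "s k = int x" "s (Suc k) = int y" for s x y
    by (intro exI conjI, rule Add) (use that in auto)
  then show "\<exists>d u. \<forall>s x y. s k = int x \<longrightarrow> s (Suc k) = int y \<longrightarrow>
      (\<exists>t s'. exec d s t s' \<and> t \<le> u \<and> s' k = int (x + y) \<and> (\<forall>i. i \<noteq> k \<longrightarrow> s' i = s i))"
    by blast
qed

lemma ptime_diff:
  assumes "ptime n D B f" and "ptime n D B g"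
  shows "ptime n D B (\<lambda>e. f e - g e)"
proof (rule ptime_binary[OF assms])
  fix k
  let ?d = "Seq (Sub k k (Suc k)) (Cond k Skip (Const k 0))"
  have "\<exists>t s'. exec ?d s t s' \<and> t \<le> 3 \<and> s' k = int (x - y) \<and> (\<forall>i. i \<noteq> k \<longrightarrow> s' i = s i)"
    if *: "s k = int x" "s (Suc k) = int y" for s x y
  proof (cases "y < x")
    case True
    show ?thesis
      by (intro exI conjI, rule Seq[OF Sub CondTrue[OF _ Skip]]) (use * True in auto)
  next
    case False
    show ?thesis
      by (intro exI conjI, rule Seq[OF Sub CondFalse[OF _ Const]]) (use * False in auto)
  qed
  then show "\<exists>d u. \<forall>s x y. s k = int x \<longrightarrow> s (Suc k) = int y \<longrightarrow>
      (\<exists>t s'. exec d s t s' \<and> t \<le> u \<and> s' k = int (x - y) \<and> (\<forall>i. i \<noteq> k \<longrightarrow> s' i = s i))"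
    by blast
qed

lemma ptime_half:
  assumes "ptime n D B f"
  shows "ptime n D B (\<lambda>e. f e div 2)"
proof (rule ptime_binary[OF assms assms, of "\<lambda>x _. x div 2"])
  fix k
  have "\<exists>t s'. exec (Half k k) s t s' \<and> t \<le> 1 \<and> s' k = int (x div 2) \<and> (\<forall>i. i \<noteq> k \<longrightarrow> s' i = s i)"
    if "s k = int x" for s x
    by (intro exI conjI, rule Half) (use that in \<open>auto simp: zdiv_int\<close>)
  then show "\<exists>d u. \<forall>s x y. s k = int x \<longrightarrow> s (Suc k) = int y \<longrightarrow>
      (\<exists>t s'. exec d s t s' \<and> t \<le> u \<and> s' k = int (x div 2) \<and> (\<forall>i. i \<noteq> k \<longrightarrow> s' i = s i))"
    by blast
qed

definition pdec :: "nat \<Rightarrow> (nat list \<Rightarrow> bool) \<Rightarrow> (nat list \<Rightarrow> nat) \<Rightarrow> (nat list \<Rightarrow> bool) \<Rightarrow> bool" where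
  "pdec n D B P \<longleftrightarrow> ptime n D B (\<lambda>e. of_bool (P e))"

text \<open>Each branch is timed only on its own side of the test. Guards thus become hypotheses:
  later conjunctions and implications may assume their first part while computing the
  second.\<close>

lemma ptime_if:
  assumes P: "pdec n D B P"
    and f: "ptime n (\<lambda>e. D e \<and> P e) B f" and g: "ptime n (\<lambda>e. D e \<and> \<not> P e) B g"
  shows "ptime n D B (\<lambda>e. if P e then f e else g e)"
proof (rule ptimeI)
  fix \<rho> :: "nat list" and k
  assume \<rho>: "length \<rho> = n" "\<forall>r \<in> set \<rho>. r < k"
  obtain c0 K0 m0 where 0: "k < K0"
      "\<And>e s. D e \<Longrightarrow> holds \<rho> e s \<Longrightarrow> runs c0 s ((B e + 2) ^ m0) k K0 (of_bool (P e))"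
    by (rule ptimeE[OF P[unfolded pdec_def] \<rho>]) blast
  obtain c1 K1 m1 where 1: "k < K1"
      "\<And>e s. D e \<and> P e \<Longrightarrow> holds \<rho> e s \<Longrightarrow> runs c1 s ((B e + 2) ^ m1) k K1 (f e)"
    by (rule ptimeE[OF f \<rho>]) blast
  obtain c2 K2 m2 where 2: "k < K2"
      "\<And>e s. D e \<and> \<not> P e \<Longrightarrow> holds \<rho> e s \<Longrightarrow> runs c2 s ((B e + 2) ^ m2) k K2 (g e)"
    by (rule ptimeE[OF g \<rho>]) blast
  let ?K = "max K0 (max K1 K2)" and ?m = "m0 + (m1 + m2 + 1 + 1) + 1"
  have "runs (Seq c0 (Cond k c1 c2)) s ((B e + 2) ^ ?m) k ?K (if P e then f e else g e)"
    if De: "D e" and h: "holds \<rho> e s" for e s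
  proof -
    obtain t s1 where 3: "exec c0 s t s1" "t \<le> (B e + 2) ^ m0" "s1 k = int (of_bool (P e))"
        "\<And>i. i < k \<or> K0 \<le> i \<Longrightarrow> s1 i = s i"
      by (rule runsE[OF 0(2)[OF De h]]) blast
    have h1: "holds \<rho> e s1" using holds_cong[OF h \<rho>(2)] 3(4) by blast
    have le: "t + Suc u \<le> (B e + 2) ^ ?m" if "u \<le> (B e + 2) ^ m1 \<or> u \<le> (B e + 2) ^ m2" for u
    proof -
      have "u \<le> (B e + 2) ^ (m1 + m2)"
        using that by (meson le_add1 le_add2 le_trans one_le_numeral power_increasing trans_le_add2)
      moreover have "1 \<le> (B e + 2) ^ 1" by simp
      ultimately have "u + 1 \<le> (B e + 2) ^ (m1 + m2 + 1 + 1)" by (rule power_sum_le)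
      with 3(2) have "t + (u + 1) \<le> (B e + 2) ^ ?m" by (rule power_sum_le)
      then show ?thesis by simp
    qed
    show ?thesis
    proof (cases "P e")
      case True
      obtain u s2 where 4: "exec c1 s1 u s2" "u \<le> (B e + 2) ^ m1" "s2 k = int (f e)"
          "\<And>i. i < k \<or> K1 \<le> i \<Longrightarrow> s2 i = s1 i"
        by (rule runsE[OF 1(2)[OF conjI[OF De True] h1]]) blast
      show ?thesis
        by (rule runsI[OF Seq[OF 3(1) CondTrue[OF _ 4(1)]]]) (use True 3 4 le in auto)
    next
      case False
      obtain u s2 where 4: "exec c2 s1 u s2" "u \<le> (B e + 2) ^ m2" "s2 k = int (g e)"
          "\<And>i. i < k \<or> K2 \<le> i \<Longrightarrow> s2 i = s1 i"
        by (rule runsE[OF 2(2)[OF conjI[OF De False] h1]]) blast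
      show ?thesis
        by (rule runsI[OF Seq[OF 3(1) CondFalse[OF _ 4(1)]]]) (use False 3 4 le in auto)
    qed
  qed
  then show "\<exists>c K m. k < K \<and> (\<forall>e s. D e \<longrightarrow> holds \<rho> e s \<longrightarrow>
      runs c s ((B e + 2) ^ m) k K (if P e then f e else g e))"
    using 0(1) by (intro exI[of _ "Seq c0 (Cond k c1 c2)"] exI[of _ ?K] exI[of _ ?m]) auto
qed

section \<open>Bounded iteration and bounded search\<close>

primrec itr :: "nat \<Rightarrow> (nat \<Rightarrow> nat \<Rightarrow> nat) \<Rightarrow> nat \<Rightarrow> nat" where
  "itr 0 F z = z"
| "itr (Suc n) F z = F n (itr n F z)"

text \<open>The loop body is examined only on states that really occur: its second argument is
  assumed to be the exact iterate. Invariants of the accumulator, such as bounds on intermediate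
  values, can thereby enter its timing. Register \<open>k\<close> holds the accumulator,
  \<open>k + 1\<close> the number of rounds left, \<open>k + 2\<close> the index; the body writes
  its result to \<open>k + 3\<close>.\<close>

lemma ptime_itr:
  assumes N: "ptime n D B N" and NB: "\<And>e. D e \<Longrightarrow> length e = n \<Longrightarrow> N e \<le> B e + 2"
    and z: "ptime n D B z"
    and F: "ptime (Suc (Suc n)) (\<lambda>e. D (tl (tl e)) \<and> length e = Suc (Suc n) \<and> hd e < N (tl (tl e)) \<and>
              hd (tl e) = itr (hd e) (\<lambda>j a. F j a (tl (tl e))) (z (tl (tl e))))
            (\<lambda>e. B (tl (tl e))) (\<lambda>e. F (hd e) (hd (tl e)) (tl (tl e)))"
  shows "ptime n D B (\<lambda>e. itr (N e) (\<lambda>j a. F j a e) (z e))"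
proof (rule ptimeI)
  fix \<rho> :: "nat list" and k
  assume \<rho>: "length \<rho> = n" "\<forall>r \<in> set \<rho>. r < k"
  then have \<rho>1: "\<forall>r \<in> set \<rho>. r < Suc k" by auto
  have \<rho>2: "length ((k+2) # k # \<rho>) = Suc (Suc n)" "\<forall>r \<in> set ((k+2) # k # \<rho>). r < k + 3"
    using \<rho> by auto
  obtain c0 K0 m0 where 0: "k < K0"
      "\<And>e s. D e \<Longrightarrow> holds \<rho> e s \<Longrightarrow> runs c0 s ((B e + 2) ^ m0) k K0 (z e)"
    by (rule ptimeE[OF z \<rho>]) blast
  obtain c1 K1 m1 where 1: "Suc k < K1"
      "\<And>e s. D e \<Longrightarrow> holds \<rho> e s \<Longrightarrow> runs c1 s ((B e + 2) ^ m1) (Suc k) K1 (N e)"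
    by (rule ptimeE[OF N \<rho>(1) \<rho>1]) blast
  define it where "it e j = itr j (\<lambda>j a. F j a e) (z e)" for e j
  obtain c2 K2 m2 where 2: "k + 3 < K2"
      "\<And>e s j. D e \<Longrightarrow> holds ((k+2) # k # \<rho>) (j # it e j # e) s \<Longrightarrow> j < N e \<Longrightarrow>
        runs c2 s ((B e + 2) ^ m2) (k + 3) K2 (F j (it e j) e)"
  proof -
    obtain c K m where c: "k + 3 < K"
      "\<And>e s. D (tl (tl e)) \<and> length e = Suc (Suc n) \<and> hd e < N (tl (tl e)) \<and>
              hd (tl e) = itr (hd e) (\<lambda>j a. F j a (tl (tl e))) (z (tl (tl e)))
          \<Longrightarrow> holds ((k+2) # k # \<rho>) e s \<Longrightarrow>
         runs c s ((B (tl (tl e)) + 2) ^ m) (k + 3) K (F (hd e) (hd (tl e)) (tl (tl e)))"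
      by (rule ptimeE[OF F \<rho>2]) blast
    show ?thesis
    proof (rule that[OF c(1)])
      fix e s j
      assume a: "D e" "holds ((k+2) # k # \<rho>) (j # it e j # e) s" "j < N e"
      then have "length e = n" using \<rho>(1) by (simp add: holds_def)
      with a show "runs c s ((B e + 2) ^ m) (k + 3) K (F j (it e j) e)"
        using c(2)[of "j # it e j # e" s] by (simp add: it_def)
    qed
  qed
  \<comment> \<open>There is no move instruction: the new value is copied by adding it to a cleared
    register. Afterwards \<open>k + 3\<close> is free to hold the constant 1 for both
    counters.\<close>
  let ?upd = "Seq (Seq (Const k 0) (Add k k (k+3)))
     (Seq (Const (k+3) 1) (Seq (Add (k+2) (k+2) (k+3)) (Sub (k+1) (k+1) (k+3))))"
  let ?body = "Seq c2 ?upd"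
  let ?K = "max (k+4) (max K0 (max K1 K2))"
  have loop: "\<exists>t s'. exec (While (k+1) ?body) s t s' \<and> t \<le> r * ((B e + 2) ^ m2 + 6) + 1
       \<and> s' k = int (it e (N e)) \<and> (\<forall>i. i < k \<or> ?K \<le> i \<longrightarrow> s' i = s i)"
    if "D e" "holds \<rho> e s" "r \<le> N e" "s (k+1) = int r" "s (k+2) = int (N e - r)"
       "s k = int (it e (N e - r))" for e s r
    using that
  proof (induction r arbitrary: s)
    case 0
    show ?case by (intro exI conjI, rule WhileFalse) (use 0 in auto)
  next
    case (Suc r)
    let ?j = "N e - Suc r"
    have j: "?j < N e" "N e - r = Suc ?j" using Suc.prems(3) by auto
    have "holds ((k+2) # k # \<rho>) (?j # it e ?j # e) s" using Suc.prems by simp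
    from 2(2)[OF Suc.prems(1) this j(1)]
    obtain t1 s1 where s1: "exec c2 s t1 s1" "t1 \<le> (B e + 2) ^ m2"
        "s1 (k+3) = int (F ?j (it e ?j) e)" "\<And>i. i < k + 3 \<or> K2 \<le> i \<Longrightarrow> s1 i = s i"
      using runsE by blast
    define s2 where "s2 = s1(k := s1 (k+3), k+3 := 1, k+2 := s1 (k+2) + 1, k+1 := s1 (k+1) - 1)"
    \<comment> \<open>The execution rules yield a chain of updates in program order;
      \<open>back_subst\<close> trades it for the equal memory \<open>s2\<close>, which leaves an
      extensional equation.\<close>
    have "exec ?upd s1 ((1 + 1) + (1 + (1 + 1))) s2"
      by (rule back_subst[where P = "exec ?upd s1 ((1 + 1) + (1 + (1 + 1)))"],
          rule Seq[OF Seq[OF Const Add] Seq[OF Const Seq[OF Add Sub]]])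
        (auto simp: s2_def fun_eq_iff)
    from Seq[OF s1(1) this] have ex: "exec ?body s (t1 + 5) s2"
      by (simp add: numeral_eq_Suc)
    have "s2 i = s i" if "i < k \<or> ?K \<le> i" for i
      using that s1(4)[of i] 2(1) by (auto simp: s2_def)
    moreover have "\<exists>t s'. exec (While (k+1) ?body) s2 t s' \<and> t \<le> r * ((B e + 2) ^ m2 + 6) + 1
       \<and> s' k = int (it e (N e)) \<and> (\<forall>i. i < k \<or> ?K \<le> i \<longrightarrow> s' i = s2 i)"
    proof (rule Suc.IH)
      show "holds \<rho> e s2" using holds_cong[OF Suc.prems(2) \<rho>(2)] calculation by blast
      show "s2 (k+1) = int r" "s2 (k+2) = int (N e - r)"
        using s1(4) Suc.prems(4,5) j by (auto simp: s2_def)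
      show "s2 k = int (it e (N e - r))"
        using s1(3) unfolding j(2) by (auto simp: s2_def it_def)
    qed (use Suc.prems in auto)
    then obtain t s' where "exec (While (k+1) ?body) s2 t s'" "t \<le> r * ((B e + 2) ^ m2 + 6) + 1"
       "s' k = int (it e (N e))" "\<And>i. i < k \<or> ?K \<le> i \<Longrightarrow> s' i = s2 i" by blast
    moreover from this(1) have "exec (While (k+1) ?body) s (Suc (t1 + 5 + t)) s'"
      using ex Suc.prems(4) by (intro WhileTrue) auto
    ultimately show ?case using s1(2) by (intro exI[of _ "Suc (t1 + 5 + t)"] exI[of _ s']) auto
  qed
  let ?c = "Seq (Seq c0 c1) (Seq (Const (k+2) 0) (While (k+1) ?body))"
  let ?m = "m0 + m1 + 1 + (1 + (m2 + 6 + 1 + 1 + 1) + 1) + 1"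
  have "runs ?c s ((B e + 2) ^ ?m) k ?K (it e (N e))" if De: "D e" and h: "holds \<rho> e s" for e s
  proof -
    obtain t1 s1 where s1: "exec c0 s t1 s1" "t1 \<le> (B e + 2) ^ m0" "s1 k = int (z e)"
        "\<And>i. i < k \<or> K0 \<le> i \<Longrightarrow> s1 i = s i"
      by (rule runsE[OF 0(2)[OF De h]]) blast
    have "holds \<rho> e s1" using holds_cong[OF h \<rho>(2)] s1(4) by blast
    then obtain t2 s2 where s2: "exec c1 s1 t2 s2" "t2 \<le> (B e + 2) ^ m1" "s2 (Suc k) = int (N e)"
        "\<And>i. i < Suc k \<or> K1 \<le> i \<Longrightarrow> s2 i = s1 i"
      by (rule runsE[OF 1(2)[OF De]]) blast
    let ?s = "s2(k+2 := 0)"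
    have eq: "i < k \<or> ?K \<le> i \<Longrightarrow> ?s i = s i" for i using s1(4) s2(4) by auto
    have "\<exists>t s'. exec (While (k+1) ?body) ?s t s' \<and> t \<le> N e * ((B e + 2) ^ m2 + 6) + 1
       \<and> s' k = int (it e (N e)) \<and> (\<forall>i. i < k \<or> ?K \<le> i \<longrightarrow> s' i = ?s i)"
      by (rule loop[OF De holds_cong[OF h \<rho>(2)]])
         (use s1 s2 eq in \<open>auto simp: it_def\<close>)
    then obtain t s' where s': "exec (While (k+1) ?body) ?s t s'"
       "t \<le> N e * ((B e + 2) ^ m2 + 6) + 1" "s' k = int (it e (N e))"
       "\<And>i. i < k \<or> ?K \<le> i \<Longrightarrow> s' i = ?s i" by blast
    have "(B e + 2) ^ m2 + 6 \<le> (B e + 2) ^ (m2 + 6 + 1)"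
      by (rule power_sum_le[OF order_refl numeral_le_power])
    moreover have "N e \<le> B e + 2" using NB De h \<rho>(1) by (fastforce simp: holds_def)
    ultimately have "N e * ((B e + 2) ^ m2 + 6) \<le> (B e + 2) * (B e + 2) ^ (m2 + 6 + 1)"
      by (intro mult_le_mono)
    also have "\<dots> = (B e + 2) ^ (m2 + 6 + 1 + 1)" by (metis power_Suc Suc_eq_plus1)
    finally have "N e * ((B e + 2) ^ m2 + 6) + 1 \<le> (B e + 2) ^ (m2 + 6 + 1 + 1 + 0 + 1)"
      by (rule power_sum_le) simp
    then have "N e * ((B e + 2) ^ m2 + 6) + 1 \<le> (B e + 2) ^ (m2 + 6 + 1 + 1 + 1)"
      by simp
    then have "t \<le> (B e + 2) ^ (m2 + 6 + 1 + 1 + 1)" using s'(2) by linarith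
    then have tm: "(t1 + t2) + (1 + t) \<le> (B e + 2) ^ ?m"
      using s1(2) s2(2) by (intro power_sum_le) auto
    have "exec ?c s ((t1 + t2) + (1 + t)) s'"
      by (rule Seq[OF Seq[OF s1(1) s2(1)] Seq[OF Const s'(1)]])
    then show ?thesis by (rule runsI[where s' = s', OF _ tm]) (use s'(3,4) eq in auto)
  qed
  then show "\<exists>c K m. k < K \<and> (\<forall>e s. D e \<longrightarrow> holds \<rho> e s \<longrightarrow>
      runs c s ((B e + 2) ^ m) k K (itr (N e) (\<lambda>j a. F j a e) (z e)))"
    by (intro exI[of _ ?c] exI[of _ ?K] exI[of _ ?m]) (auto simp: it_def)
qed

text \<open>The test is run only at arguments below which it has failed, and these are at most the
  least solution. \<open>P\<close> may therefore be too expensive beyond that point, which is what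
  the later searches rely on.\<close>

lemma ptime_Least:
  assumes P: "pdec (Suc n) (\<lambda>e. D (tl e) \<and> length e = Suc n \<and> (\<forall>y < hd e. \<not> P y (tl e)) \<and>
                hd e \<le> B (tl e) + 2) (\<lambda>e. B (tl e)) (\<lambda>e. P (hd e) (tl e))"
    and ex: "\<And>e. D e \<Longrightarrow> length e = n \<Longrightarrow> \<exists>x \<le> B e + 2. P x e"
  shows "ptime n D B (\<lambda>e. LEAST x. P x e)"
proof (rule ptimeI)
  fix \<rho> :: "nat list" and k
  assume \<rho>: "length \<rho> = n" "\<forall>r \<in> set \<rho>. r < k"
  then have \<rho>1: "length (k # \<rho>) = Suc n" "\<forall>r \<in> set (k # \<rho>). r < Suc k" by auto
  define x0 where "x0 e = (LEAST x. P x e)" for e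
  have x0: "P (x0 e) e" "x0 e \<le> B e + 2" "\<And>y. y < x0 e \<Longrightarrow> \<not> P y e" if "D e" "length e = n" for e
    using ex[OF that] unfolding x0_def
    by (auto intro: LeastI dest: not_less_Least elim: order_trans[OF Least_le])
  obtain c K m where c: "Suc k < K"
      "\<And>e s x. D e \<Longrightarrow> holds (k # \<rho>) (x # e) s \<Longrightarrow> x \<le> x0 e \<Longrightarrow>
        runs c s ((B e + 2) ^ m) (Suc k) K (of_bool (x \<noteq> x0 e))"
  proof -
    have "ptime (Suc n) (\<lambda>e. D (tl e) \<and> length e = Suc n \<and> (\<forall>y < hd e. \<not> P y (tl e)) \<and>
                hd e \<le> B (tl e) + 2) (\<lambda>e. B (tl e)) (\<lambda>e. 1 - of_bool (P (hd e) (tl e)))"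
      by (rule ptime_diff[OF ptime_const P[unfolded pdec_def]])
    then obtain c K m where c: "Suc k < K"
      "\<And>e s. D (tl e) \<and> length e = Suc n \<and> (\<forall>y < hd e. \<not> P y (tl e)) \<and> hd e \<le> B (tl e) + 2
          \<Longrightarrow> holds (k # \<rho>) e s \<Longrightarrow>
         runs c s ((B (tl e) + 2) ^ m) (Suc k) K (1 - of_bool (P (hd e) (tl e)))"
      by (rule ptimeE[OF _ \<rho>1]) blast
    show ?thesis
    proof (rule that[OF c(1)])
      fix e s x
      assume a: "D e" "holds (k # \<rho>) (x # e) s" "x \<le> x0 e"
      then have len: "length e = n" using \<rho>(1) by (simp add: holds_def)
      have "P x e \<longleftrightarrow> x = x0 e" using x0[OF a(1) len] a(3) by (metis le_neq_implies_less)
      with a len show "runs c s ((B e + 2) ^ m) (Suc k) K (of_bool (x \<noteq> x0 e))"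
        using c(2)[of "x # e" s] x0[OF a(1) len] by (auto simp: of_bool_def)
    qed
  qed
  \<comment> \<open>Register \<open>Suc k\<close> serves twice: as the constant 1 that advances the
    candidate in \<open>k\<close>, and then as the loop flag, which \<open>c\<close> sets to 1
    exactly if the new candidate fails.\<close>
  let ?body = "Seq (Seq (Const (Suc k) 1) (Add k k (Suc k))) c"
  have loop: "\<exists>t s'. exec (While (Suc k) ?body) s t s' \<and> t \<le> r * ((B e + 2) ^ m + 3) + 1
       \<and> s' k = int (x0 e) \<and> (\<forall>i. i < k \<or> K \<le> i \<longrightarrow> s' i = s i)"
    if "D e" "holds \<rho> e s" "r \<le> x0 e" "s k = int (x0 e - r)" "s (Suc k) = of_bool (r \<noteq> 0)" for e s r
    using that
  proof (induction r arbitrary: s)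
    case 0
    show ?case by (intro exI conjI, rule WhileFalse) (use 0 in auto)
  next
    case (Suc r)
    let ?s = "s(Suc k := 1, k := s k + 1)"
    have k: "?s k = int (x0 e - r)" using Suc.prems(3,4) by simp
    have h: "holds \<rho> e ?s" by (rule holds_cong[OF Suc.prems(2) \<rho>(2)]) simp
    have "holds (k # \<rho>) ((x0 e - r) # e) ?s" using h k by simp
    from c(2)[OF Suc.prems(1) this]
    obtain t1 s1 where s1: "exec c ?s t1 s1" "t1 \<le> (B e + 2) ^ m"
        "s1 (Suc k) = int (of_bool (x0 e - r \<noteq> x0 e))" "\<And>i. i < Suc k \<or> K \<le> i \<Longrightarrow> s1 i = ?s i"
      by (rule runsE) auto
    have "exec (Seq (Const (Suc k) 1) (Add k k (Suc k))) s (1 + 1) ?s"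
      by (rule back_subst[where P = "exec _ s (1 + 1)"], rule Seq[OF Const Add]) (auto simp: fun_eq_iff)
    from Seq[OF this s1(1)] have ex: "exec ?body s (1 + 1 + t1) s1" .
    have same: "s1 i = s i" if "i < k \<or> K \<le> i" for i
      using that s1(4)[of i] c(1) by auto
    have "\<exists>t s'. exec (While (Suc k) ?body) s1 t s' \<and> t \<le> r * ((B e + 2) ^ m + 3) + 1
       \<and> s' k = int (x0 e) \<and> (\<forall>i. i < k \<or> K \<le> i \<longrightarrow> s' i = s1 i)"
    proof (rule Suc.IH)
      show "holds \<rho> e s1" using holds_cong[OF Suc.prems(2) \<rho>(2)] same by blast
      show "s1 k = int (x0 e - r)" using s1(4)[of k] k by simp
      show "s1 (Suc k) = of_bool (r \<noteq> 0)" using s1(3) Suc.prems(3) by auto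
    qed (use Suc.prems in auto)
    then obtain t s' where s': "exec (While (Suc k) ?body) s1 t s'" "t \<le> r * ((B e + 2) ^ m + 3) + 1"
       "s' k = int (x0 e)" "\<And>i. i < k \<or> K \<le> i \<Longrightarrow> s' i = s1 i" by blast
    have "exec (While (Suc k) ?body) s (Suc (1 + 1 + t1 + t)) s'"
      using ex s'(1) Suc.prems(5) by (intro WhileTrue) auto
    then show ?case using s1(2) s' same by (intro exI[of _ "Suc (1 + 1 + t1 + t)"] exI[of _ s']) auto
  qed
  let ?c = "Seq (Seq (Const k 0) c) (While (Suc k) ?body)"
  let ?m = "0 + m + 1 + (m + 3 + 1 + 2 + 0 + 1) + 1"
  have "runs ?c s ((B e + 2) ^ ?m) k K (x0 e)" if De: "D e" and h: "holds \<rho> e s" for e s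
  proof -
    have len: "length e = n" using h \<rho>(1) by (simp add: holds_def)
    have "holds (k # \<rho>) (0 # e) (s(k := 0))"
      using holds_cong[OF h \<rho>(2)] by simp
    from c(2)[OF De this]
    obtain t1 s1 where s1: "exec c (s(k := 0)) t1 s1" "t1 \<le> (B e + 2) ^ m"
        "s1 (Suc k) = int (of_bool (0 \<noteq> x0 e))" "\<And>i. i < Suc k \<or> K \<le> i \<Longrightarrow> s1 i = (s(k := 0)) i"
      by (rule runsE) auto
    have same: "s1 i = s i" if "i < k \<or> K \<le> i" for i
      using that s1(4)[of i] c(1) by auto
    have "\<exists>t s'. exec (While (Suc k) ?body) s1 t s' \<and> t \<le> x0 e * ((B e + 2) ^ m + 3) + 1
       \<and> s' k = int (x0 e) \<and> (\<forall>i. i < k \<or> K \<le> i \<longrightarrow> s' i = s1 i)"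
      by (rule loop[OF De holds_cong[OF h \<rho>(2)]]) (use s1 same in auto)
    then obtain t s' where s': "exec (While (Suc k) ?body) s1 t s'"
       "t \<le> x0 e * ((B e + 2) ^ m + 3) + 1" "s' k = int (x0 e)"
       "\<And>i. i < k \<or> K \<le> i \<Longrightarrow> s' i = s1 i" by blast
    have "(B e + 2) ^ m + 3 \<le> (B e + 2) ^ (m + 3 + 1)"
      by (rule power_sum_le[OF order_refl numeral_le_power])
    moreover have "x0 e \<le> (B e + 2) ^ 2"
      using x0(2)[OF De len] by (simp add: power2_eq_square)
    ultimately have "x0 e * ((B e + 2) ^ m + 3) \<le> (B e + 2) ^ 2 * (B e + 2) ^ (m + 3 + 1)"
      by (intro mult_le_mono)
    also have "\<dots> = (B e + 2) ^ (m + 3 + 1 + 2)" by (simp add: power_add)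
    finally have "x0 e * ((B e + 2) ^ m + 3) + 1 \<le> (B e + 2) ^ (m + 3 + 1 + 2 + 0 + 1)"
      by (rule power_sum_le) simp
    then have "t \<le> (B e + 2) ^ (m + 3 + 1 + 2 + 0 + 1)" using s'(2) by linarith
    moreover have "1 + t1 \<le> (B e + 2) ^ (0 + m + 1)"
      by (rule power_sum_le) (use s1(2) in auto)
    ultimately have tm: "(1 + t1) + t \<le> (B e + 2) ^ ?m"
      by (rule power_sum_le[rotated])
    have "exec ?c s ((1 + t1) + t) s'"
      by (rule Seq[OF Seq[OF Const s1(1)] s'(1)])
    then show ?thesis by (rule runsI[where s' = s', OF _ tm]) (use s'(3,4) same in auto)
  qed
  then show "\<exists>c K m. k < K \<and> (\<forall>e s. D e \<longrightarrow> holds \<rho> e s \<longrightarrow>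
      runs c s ((B e + 2) ^ m) k K (LEAST x. P x e))"
    using c(1) by (intro exI[of _ ?c] exI[of _ K] exI[of _ ?m]) (auto simp: x0_def)
qed

section \<open>Arithmetic\<close>

lemma pdec_not: "pdec n D B P \<Longrightarrow> pdec n D B (\<lambda>e. \<not> P e)"
  unfolding pdec_def by (rule ptime_cong[OF ptime_diff[OF ptime_const[where v = 1]]]) auto

lemma pdec_conj:
  assumes "pdec n D B P" and "pdec n (\<lambda>e. D e \<and> P e) B Q"
  shows "pdec n D B (\<lambda>e. P e \<and> Q e)"
  unfolding pdec_def
  by (rule ptime_cong[OF ptime_if[OF assms(1) assms(2)[unfolded pdec_def] ptime_const[where v = 0]]]) auto

lemma pdec_imp:
  assumes "pdec n D B P" and "pdec n (\<lambda>e. D e \<and> P e) B Q"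
  shows "pdec n D B (\<lambda>e. P e \<longrightarrow> Q e)"
  unfolding pdec_def
  by (rule ptime_cong[OF ptime_if[OF assms(1) assms(2)[unfolded pdec_def] ptime_const[where v = 1]]]) auto

text \<open>With truncated subtraction, \<open>1 - (f e - g e)\<close> is already the truth
  value.\<close>

lemma pdec_le:
  assumes "ptime n D B f" and "ptime n D B g"
  shows "pdec n D B (\<lambda>e. f e \<le> g e)"
  unfolding pdec_def
  by (rule ptime_cong[OF ptime_diff[OF ptime_const[where v = 1] ptime_diff[OF assms]]]) auto

lemma pdec_less:
  assumes "ptime n D B f" and "ptime n D B g"
  shows "pdec n D B (\<lambda>e. f e < g e)"
  using pdec_not[OF pdec_le[OF assms(2,1)]] by (simp add: not_le)

lemma pdec_eq:
  assumes "ptime n D B f" and "ptime n D B g"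
  shows "pdec n D B (\<lambda>e. f e = g e)"
  unfolding pdec_def
  by (rule ptime_cong[OF ptime_diff[OF ptime_const[where v = 1] ptime_add[OF ptime_diff[OF assms] ptime_diff[OF assms(2,1)]]]])
    auto

text \<open>In the body of \<open>ptime_itr\<close> the accumulator stands between the counter and
  the outer arguments. A summand or factor that ignores it is lifted by deleting this second
  argument.\<close>

lemma ptime_drop:
  assumes "ptime (Suc n) D B f" and "\<And>e. D' e \<Longrightarrow> length e = Suc (Suc n) \<Longrightarrow> D (hd e # tl (tl e))"
  shows "ptime (Suc (Suc n)) D' (\<lambda>e. B (hd e # tl (tl e))) (\<lambda>e. f (hd e # tl (tl e)))"
proof (rule ptimeI)
  fix \<rho> :: "nat list" and k
  assume "length \<rho> = Suc (Suc n)" "\<forall>r \<in> set \<rho>. r < k"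
  then obtain a b \<rho>0 where \<rho>: "\<rho> = a # b # \<rho>0" "length (a # \<rho>0) = Suc n" "\<forall>r \<in> set (a # \<rho>0). r < k"
    by (auto simp: length_Suc_conv)
  obtain c K m where c: "k < K"
      "\<And>e s. D e \<Longrightarrow> holds (a # \<rho>0) e s \<Longrightarrow> runs c s ((B e + 2) ^ m) k K (f e)"
    by (rule ptimeE[OF assms(1) \<rho>(2,3)]) blast
  have "runs c s ((B (hd e # tl (tl e)) + 2) ^ m) k K (f (hd e # tl (tl e)))"
    if "D' e" "holds \<rho> e s" for e s
  proof -
    have len: "length e = Suc (Suc n)" using that(2) \<rho>(1,2) by (simp add: holds_def)
    then have "holds (a # \<rho>0) (hd e # tl (tl e)) s"
      using that(2) \<rho>(1) by (auto simp: length_Suc_conv)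
    then show ?thesis using c(2) assms(2)[OF that(1) len] by blast
  qed
  then show "\<exists>c K m. k < K \<and> (\<forall>e s. D' e \<longrightarrow> holds \<rho> e s \<longrightarrow>
      runs c s ((B (hd e # tl (tl e)) + 2) ^ m) k K (f (hd e # tl (tl e))))"
    using c(1) by blast
qed

lemma ptime_sum:
  assumes N: "ptime n D B N" and NB: "\<And>e. D e \<Longrightarrow> length e = n \<Longrightarrow> N e \<le> B e + 2"
    and F: "ptime (Suc n) (\<lambda>e. D (tl e) \<and> length e = Suc n \<and> hd e < N (tl e)) (\<lambda>e. B (tl e))
              (\<lambda>e. F (hd e) (tl e))"
  shows "ptime n D B (\<lambda>e. \<Sum>i<N e. F i e)"
proof -
  have "ptime n D B (\<lambda>e. itr (N e) (\<lambda>i a. a + F i e) 0)"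
    by (rule ptime_itr[OF N NB ptime_const], assumption, assumption,
        rule ptime_add[OF ptime_hd_tl ptime_drop[OF F, simplified]]) auto
  moreover have "itr N (\<lambda>i a. a + F i e) 0 = (\<Sum>i<N. F i e)" for N e
    by (induction N) auto
  ultimately show ?thesis by simp
qed

text \<open>Counting the failures with a bounded sum reduces the quantifier to a comparison with
  0.\<close>

lemma pdec_all:
  assumes N: "ptime n D B N" and NB: "\<And>e. D e \<Longrightarrow> length e = n \<Longrightarrow> N e \<le> B e + 2"
    and P: "pdec (Suc n) (\<lambda>e. D (tl e) \<and> length e = Suc n \<and> hd e < N (tl e)) (\<lambda>e. B (tl e))
              (\<lambda>e. P (hd e) (tl e))"
  shows "pdec n D B (\<lambda>e. \<forall>i<N e. P i e)"
proof -
  have "pdec n D B (\<lambda>e. (\<Sum>i<N e. of_bool (\<not> P i e)) = (0::nat))"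
    by (rule pdec_eq[OF ptime_sum[OF N NB] ptime_const], assumption, assumption,
        rule pdec_not[OF P, unfolded pdec_def])
  moreover have "(\<Sum>i<N. of_bool (\<not> P i e)) = (0::nat) \<longleftrightarrow> (\<forall>i<N. P i e)" for N e
    by (subst sum_eq_0_iff) auto
  ultimately show ?thesis by (simp only:)
qed

lemma pdec_ex:
  assumes N: "ptime n D B N" and NB: "\<And>e. D e \<Longrightarrow> length e = n \<Longrightarrow> N e \<le> B e + 2"
    and P: "pdec (Suc n) (\<lambda>e. D (tl e) \<and> length e = Suc n \<and> hd e < N (tl e)) (\<lambda>e. B (tl e))
              (\<lambda>e. P (hd e) (tl e))"
  shows "pdec n D B (\<lambda>e. \<exists>i<N e. P i e)"
  using pdec_not[OF pdec_all[OF N NB pdec_not[OF P]]] by simp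

text \<open>Multiplication is repeated addition. The second factor counts rounds and must be at most
  \<open>B e + 2\<close>, whereas the first may be exponentially large; products below are ordered
  accordingly.\<close>

lemma ptime_mult:
  assumes f: "ptime n D B f" and g: "ptime n D B g" and "\<And>e. D e \<Longrightarrow> length e = n \<Longrightarrow> g e \<le> B e + 2"
  shows "ptime n D B (\<lambda>e. f e * g e)"
proof -
  have "ptime n D B (\<lambda>e. \<Sum>i<g e. f e)"
    by (rule ptime_sum[OF g assms(3)], assumption, assumption, rule ptime_tl[OF f]) auto
  then show ?thesis by (simp add: mult.commute)
qed

lemma ptime_prod:
  assumes N: "ptime n D B N" and NB: "\<And>e. D e \<Longrightarrow> length e = n \<Longrightarrow> N e \<le> B e + 2"
    and F: "ptime (Suc n) (\<lambda>e. D (tl e) \<and> length e = Suc n \<and> hd e < N (tl e)) (\<lambda>e. B (tl e))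
              (\<lambda>e. F (hd e) (tl e))"
    and FB: "\<And>e i. D e \<Longrightarrow> length e = n \<Longrightarrow> i < N e \<Longrightarrow> F i e \<le> B e + 2"
  shows "ptime n D B (\<lambda>e. \<Prod>i<N e. F i e)"
proof -
  have "ptime n D B (\<lambda>e. itr (N e) (\<lambda>i a. a * F i e) 1)"
    by (rule ptime_itr[OF N NB ptime_const], assumption, assumption,
        rule ptime_mult[OF ptime_hd_tl ptime_drop[OF F, simplified]]) (use FB in force)+
  moreover have "itr N (\<lambda>i a. a * F i e) 1 = (\<Prod>i<N. F i e)" for N e
    by (induction N) auto
  ultimately show ?thesis by simp
qed

lemma ptime_power:
  assumes f: "ptime n D B f" and g: "ptime n D B g"
    and fB: "\<And>e. D e \<Longrightarrow> length e = n \<Longrightarrow> f e \<le> B e + 2"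
    and gB: "\<And>e. D e \<Longrightarrow> length e = n \<Longrightarrow> g e \<le> B e + 2"
  shows "ptime n D B (\<lambda>e. f e ^ g e)"
proof -
  have "ptime n D B (\<lambda>e. \<Prod>i<g e. f e)"
    by (rule ptime_prod[OF g gB], assumption, assumption, rule ptime_tl[OF f]) (use fB in force)+
  then show ?thesis by simp
qed

lemma ptime_shift:
  assumes f: "ptime n D B f" and g: "ptime n D B g" and "\<And>e. D e \<Longrightarrow> length e = n \<Longrightarrow> g e \<le> B e + 2"
  shows "ptime n D B (\<lambda>e. f e * 2 ^ g e)"
proof -
  have "ptime n D B (\<lambda>e. itr (g e) (\<lambda>i a. a + a) (f e))"
    by (rule ptime_itr[OF g assms(3) f], assumption, assumption, rule ptime_add[OF ptime_hd_tl ptime_hd_tl])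
  moreover have "itr N (\<lambda>i a. a + a) x = x * 2 ^ N" for N x
    by (induction N) auto
  ultimately show ?thesis by simp
qed

lemma ptime_unshift:
  assumes f: "ptime n D B f" and g: "ptime n D B g" and "\<And>e. D e \<Longrightarrow> length e = n \<Longrightarrow> g e \<le> B e + 2"
  shows "ptime n D B (\<lambda>e. f e div 2 ^ g e)"
proof -
  have "ptime n D B (\<lambda>e. itr (g e) (\<lambda>i a. a div 2) (f e))"
    by (rule ptime_itr[OF g assms(3) f], assumption, assumption, rule ptime_half[OF ptime_hd_tl])
  moreover have "itr N (\<lambda>i a. a div 2) x = x div 2 ^ N" for N x
    by (induction N) (auto simp: div_mult2_eq[symmetric] mult.commute)
  ultimately show ?thesis by simp
qed

text \<open>The quotient is found by trying all candidates, hence the bound on the quotient rather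
  than on the dividend.\<close>

lemma ptime_div:
  assumes f: "ptime n D B f" and g: "ptime n D B g" and pos: "\<And>e. D e \<Longrightarrow> length e = n \<Longrightarrow> 0 < g e"
    and le: "\<And>e. D e \<Longrightarrow> length e = n \<Longrightarrow> f e div g e \<le> B e"
  shows "ptime n D B (\<lambda>e. f e div g e)"
proof (rule ptime_cong)
  show "ptime n D B (\<lambda>e. LEAST t. f e < g e * (t + 1))"
  proof (rule ptime_Least)
    show "pdec (Suc n) (\<lambda>e. D (tl e) \<and> length e = Suc n \<and> (\<forall>y<hd e. \<not> f (tl e) < g (tl e) * (y + 1)) \<and>
         hd e \<le> B (tl e) + 2) (\<lambda>e. B (tl e)) (\<lambda>e. f (tl e) < g (tl e) * (hd e + 1))"
    proof (intro pdec_less ptime_mult ptime_add ptime_hd ptime_const ptime_tl[OF f] ptime_tl[OF g])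
      fix e assume *: "D (tl e) \<and> length e = Suc n \<and> (\<forall>y<hd e. \<not> f (tl e) < g (tl e) * (y + 1)) \<and>
         hd e \<le> B (tl e) + 2"
      have "hd e \<le> f (tl e) div g (tl e)"
      proof (rule ccontr)
        assume "\<not> ?thesis"
        with * have "\<not> f (tl e) < g (tl e) * (f (tl e) div g (tl e) + 1)" by simp
        then show False
          using pos[of "tl e"] * by (simp add: dividend_less_times_div)
      qed
      with le[of "tl e"] * show "hd e + 1 \<le> B (tl e) + 2" by simp
    qed auto
  next
    fix e assume "D e" "length e = n"
    with pos[of e] le[of e] show "\<exists>x\<le>B e + 2. f e < g e * (x + 1)"
      by (intro exI[of _ "f e div g e"]) (simp add: dividend_less_times_div)
  qed
next
  fix e assume "D e" "length e = n"
  then have g: "0 < g e" by (rule pos)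
  show "f e div g e = (LEAST t. f e < g e * (t + 1))"
  proof (rule Least_equality[symmetric])
    show "f e < g e * (f e div g e + 1)" using g by (simp add: dividend_less_times_div)
    fix t assume "f e < g e * (t + 1)"
    then have "f e div g e < t + 1" using g by (simp add: div_less_iff_less_mult mult.commute)
    then show "f e div g e \<le> t" by simp
  qed
qed

text \<open>Schoolbook division: the multiples \<open>y * 2 ^ i\<close> are subtracted in decreasing order of \<open>i\<close>.\<close>

lemma itr_mod:
  fixes y :: nat
  assumes "x < y * 2 ^ k"
  shows "itr k (\<lambda>j r. if y * 2 ^ (k - 1 - j) \<le> r then r - y * 2 ^ (k - 1 - j) else r) x = x mod y"
proof -
  define F where "F = (\<lambda>j r. if y * 2 ^ (k - 1 - j) \<le> r then r - y * 2 ^ (k - 1 - j) else r)"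
  have F: "F i r = (if y * 2 ^ (k - Suc i) \<le> r then r - y * 2 ^ (k - Suc i) else r)" for i r
    by (simp add: F_def)
  have sub_mod: "(a - y * m) mod y = a mod y" if "y * m \<le> a" for a m
    using that by (metis mod_mult_self2 add.commute le_add_diff_inverse2)
  have "i \<le> k \<Longrightarrow> itr i F x < y * 2 ^ (k - i) \<and> itr i F x mod y = x mod y" for i
  proof (induction i)
    case 0
    then show ?case using assms by simp
  next
    case (Suc i)
    then have "itr i F x < 2 * (y * 2 ^ (k - Suc i))" "itr i F x mod y = x mod y"
      by (auto simp: Suc_diff_Suc[symmetric])
    moreover have "F i r < y * 2 ^ (k - Suc i) \<and> F i r mod y = r mod y"
      if "r < 2 * (y * 2 ^ (k - Suc i))" for r
      using that by (auto simp: F sub_mod)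
    ultimately show ?case by simp
  qed
  from this[of k] have "itr k F x < y" "itr k F x mod y = x mod y" by simp_all
  then have "itr k F x = x mod y" by simp
  then show ?thesis by (simp only: F_def)
qed

text \<open>In contrast to \<open>ptime_div\<close>, the quotient may be exponentially large here: a
  dividend of \<open>B e\<close> bits needs at most \<open>B e\<close> rounds of shifted
  subtraction. Chinese remaindering needs this for its partial results.\<close>

lemma ptime_mod:
  assumes f: "ptime n D B f" and g: "ptime n D B g" and pos: "\<And>e. D e \<Longrightarrow> length e = n \<Longrightarrow> 0 < g e"
    and less: "\<And>e. D e \<Longrightarrow> length e = n \<Longrightarrow> f e < 2 ^ B e"
  shows "ptime n D B (\<lambda>e. f e mod g e)"
proof (rule ptime_cong)
  define k where "k e = (LEAST k. f e < g e * 2 ^ k)" for e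
  have ex: "f e < g e * 2 ^ B e" if "D e" "length e = n" for e
    using less[OF that] pos[OF that] by (metis le_square less_le_trans mult_le_mono1 nat_mult_1 Suc_leI One_nat_def)
  have k: "f e < g e * 2 ^ k e" "k e \<le> B e" if "D e" "length e = n" for e
    using LeastI[of "\<lambda>k. f e < g e * 2 ^ k", OF ex[OF that]] Least_le[of "\<lambda>k. f e < g e * 2 ^ k", OF ex[OF that]]
    by (auto simp: k_def)
  have pck: "ptime n D B k"
    unfolding k_def
  proof (rule ptime_Least)
    show "pdec (Suc n) (\<lambda>e. D (tl e) \<and> length e = Suc n \<and> (\<forall>y<hd e. \<not> f (tl e) < g (tl e) * 2 ^ y) \<and>
         hd e \<le> B (tl e) + 2) (\<lambda>e. B (tl e)) (\<lambda>e. f (tl e) < g (tl e) * 2 ^ hd e)"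
      by (intro pdec_less ptime_shift ptime_hd ptime_tl[OF f] ptime_tl[OF g]) auto
    show "\<exists>x\<le>B e + 2. f e < g e * 2 ^ x" if "D e" "length e = n" for e
      using ex[OF that] by (meson le_add1)
  qed
  show "ptime n D B (\<lambda>e. itr (k e) (\<lambda>j r. if g e * 2 ^ (k e - 1 - j) \<le> r then r - g e * 2 ^ (k e - 1 - j) else r) (f e))"
    by (rule ptime_itr[OF pck _ f];
        (intro ptime_if pdec_le ptime_diff ptime_shift ptime_hd ptime_hd_tl ptime_const ptime_tl_tl[OF g] ptime_tl_tl[OF pck])?)
      (use k in \<open>fastforce simp: trans_le_add1 le_diff_conv\<close>)+
  show "f e mod g e = itr (k e) (\<lambda>j r. if g e * 2 ^ (k e - 1 - j) \<le> r then r - g e * 2 ^ (k e - 1 - j) else r) (f e)"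
    if "D e" "length e = n" for e
    by (rule itr_mod[symmetric, OF k(1)[OF that]])
qed

section \<open>Input and output\<close>

lemma holds_Nil [simp]: "holds [] e s \<longleftrightarrow> e = []"
  by (simp add: holds_def)

text \<open>An unrolled copy loop: register 0 is the source pointer, register 1 holds 1, and the
  targets are hard-wired. Unrolling is possible because the number of cells to restore is a constant
  of the program.\<close>

primrec restore :: "nat \<Rightarrow> com" where
  "restore 0 = Skip"
| "restore (Suc j) = Seq (restore j) (Seq (Load (j + 2) 0) (Add 0 0 1))"

text \<open>The condition \<open>j + 2 \<le> A\<close> separates the source cells from the targets,
  so nothing is overwritten before it is read.\<close>

lemma exec_restore:
  assumes "s 0 = int A" and "s 1 = 1" and "j + 2 \<le> A"
  shows "\<exists>t s'. exec (restore j) s t s' \<and> t = 2 * j + 1 \<and> s' 0 = int (A + j) \<and> s' 1 = 1 \<and>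
    (\<forall>i<j. s' (i + 2) = s (A + i)) \<and> (\<forall>i\<ge>j + 2. s' i = s i)"
  using assms(3)
proof (induction j)
  case 0
  show ?case using assms(1,2) exec.Skip[of s] by (intro exI[of _ 1] exI[of _ s]) auto
next
  case (Suc j)
  then obtain t s1 where s1: "exec (restore j) s t s1" "t = 2 * j + 1" "s1 0 = int (A + j)" "s1 1 = 1"
    "\<And>i. i < j \<Longrightarrow> s1 (i + 2) = s (A + i)" "\<And>i. j + 2 \<le> i \<Longrightarrow> s1 i = s i" by auto
  have "exec (restore (Suc j)) s (t + (1 + 1)) (s1(j + 2 := s1 (A + j), 0 := int (A + Suc j)))"
    by (rule back_subst[where P = "exec _ s (t + (1 + 1))"],
        unfold restore.simps, rule Seq[OF s1(1) Seq[OF Load Add]])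
      (use s1(3,4) in \<open>auto simp: fun_eq_iff nat_add_distrib\<close>)
  then show ?case
    by (intro exI conjI, assumption) (use s1 Suc.prems in \<open>auto simp: less_Suc_eq\<close>)
qed

text \<open>
  The first cells of the output are working registers as long as the program runs.  An element
  with index \<open>i < K\<close> is therefore kept at address \<open>N + K + i\<close> and copied to its place at the very end,
  when registers 0 and 1 suffice to control the computation.
\<close>

lemma output_list:
  assumes N: "ptime n D B N" and NB: "\<And>e. D e \<Longrightarrow> length e = n \<Longrightarrow> N e \<le> B e + 2"
    and g: "ptime (Suc n) (\<lambda>e. D (tl e) \<and> length e = Suc n \<and> hd e < N (tl e)) (\<lambda>e. B (tl e))
              (\<lambda>e. g (hd e) (tl e))"
    and \<rho>: "length \<rho> = n"
  shows "\<exists>c m. \<forall>e s. D e \<longrightarrow> holds \<rho> e s \<longrightarrow>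
    (\<exists>t s'. exec c s t s' \<and> t \<le> (B e + 2) ^ m \<and> (\<forall>i<N e. s' i = int (g i e)))"
proof -
  \<comment> \<open>Register plan: \<open>k\<close> holds the constant \<open>K\<close>,
    \<open>k + 1\<close> the number of elements left, \<open>k + 2\<close> the index,
    \<open>k + 3\<close> the length, \<open>k + 4\<close> the target address and then the constant
    1, \<open>k + 5\<close> the element. The bound \<open>2 \<le> k\<close> keeps all of these apart
    from registers 0 and 1.\<close>
  define k where "k = Suc (Suc (Max (insert 0 (set \<rho>))))"
  have k: "\<forall>r \<in> set \<rho>. r < k" "2 \<le> k"
    unfolding k_def by (auto simp: less_Suc_eq_le le_SucI)
  have \<rho>N: "\<forall>r \<in> set \<rho>. r < k + 1"
    and \<rho>g: "length ((k+2) # \<rho>) = Suc n" "\<forall>r \<in> set ((k+2) # \<rho>). r < k + 5"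
    and \<rho>a: "length [k+2, k, k+3] = 3" "\<forall>r \<in> set [k+2, k, k+3]. r < k + 4"
    using k \<rho> by auto
  obtain cN KN mN where cN: "k + 1 < KN"
      "\<And>e s. D e \<Longrightarrow> holds \<rho> e s \<Longrightarrow> runs cN s ((B e + 2) ^ mN) (k + 1) KN (N e)"
    by (rule ptimeE[OF N \<rho> \<rho>N]) blast
  obtain cg Kg mg where cg: "k + 5 < Kg"
      "\<And>e s i. D e \<Longrightarrow> holds \<rho> e s \<Longrightarrow> i < N e \<Longrightarrow> s (k + 2) = int i \<Longrightarrow>
         runs cg s ((B e + 2) ^ mg) (k + 5) Kg (g i e)"
  proof -
    obtain c K m where c: "k + 5 < K"
      "\<And>e s. D (tl e) \<and> length e = Suc n \<and> hd e < N (tl e) \<Longrightarrow> holds ((k+2) # \<rho>) e s \<Longrightarrow>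
         runs c s ((B (tl e) + 2) ^ m) (k + 5) K (g (hd e) (tl e))"
      by (rule ptimeE[OF g \<rho>g]) blast
    have "runs c s ((B e + 2) ^ m) (k + 5) K (g i e)"
      if "D e" "holds \<rho> e s" "i < N e" "s (k + 2) = int i" for e s i
    proof -
      have "length e = n" using that \<rho> by (simp add: holds_def)
      then show ?thesis using c(2)[of "i # e" s] that by simp
    qed
    with c(1) that show ?thesis by blast
  qed
  \<comment> \<open>Parked elements lie at \<open>N + K\<close> or above, the others below
    \<open>N\<close>, hence no two elements collide.\<close>
  define a where "a K N i = (if i < K then N + K + i else i)" for K N i :: nat
  have "ptime 3 (\<lambda>_. True) (\<lambda>_. 0) (\<lambda>e. a (e ! 1) (e ! 2) (e ! 0))"
    unfolding a_def by (intro ptime_if pdec_less ptime_add ptime_nth) auto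
  then obtain ca Ka ma where ca: "k + 4 < Ka"
      "\<And>K N i s. s (k + 2) = int i \<Longrightarrow> s k = int K \<Longrightarrow> s (k + 3) = int N \<Longrightarrow>
         runs ca s (2 ^ ma) (k + 4) Ka (a K N i)"
  proof -
    assume *: "\<And>Ka ca ma. \<lbrakk>k + 4 < Ka; \<And>K N i s. \<lbrakk>s (k + 2) = int i; s k = int K; s (k + 3) = int N\<rbrakk>
         \<Longrightarrow> runs ca s (2 ^ ma) (k + 4) Ka (a K N i)\<rbrakk> \<Longrightarrow> thesis"
    assume "ptime 3 (\<lambda>_. True) (\<lambda>_. 0) (\<lambda>e. a (e ! 1) (e ! 2) (e ! 0))"
    then obtain c K' m where c: "k + 4 < K'"
      "\<And>e s. True \<Longrightarrow> holds [k+2, k, k+3] e s \<Longrightarrow>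
         runs c s ((0 + 2) ^ m) (k + 4) K' (a (e ! 1) (e ! 2) (e ! 0))"
      by (rule ptimeE[OF _ \<rho>a]) blast
    have "runs c s (2 ^ m) (k + 4) K' (a K N i)"
      if "s (k + 2) = int i" "s k = int K" "s (k + 3) = int N" for K N i s
      using c(2)[of "[i, K, N]" s] that by (simp add: numeral_2_eq_2)
    then show thesis by (rule *[OF c(1)])
  qed
  define K where "K = max KN (max Kg Ka)"
  have K: "KN \<le> K" "Kg \<le> K" "Ka \<le> K" unfolding K_def by auto
  have kK: "k + 5 < K" using cg(1) K by simp
  have aK: "K \<le> a K N i" for N i unfolding a_def by auto
  have a_inj: "i = j" if "a K N i = a K N j" "i < N" "j < N" for N i j
    using that unfolding a_def by (auto split: if_splits)
  let ?step = "Seq (Store (k+4) (k+5)) (Seq (Const (k+4) 1) (Seq (Add (k+2) (k+2) (k+4)) (Sub (k+1) (k+1) (k+4))))"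
  let ?body = "Seq (Seq ca cg) ?step"
  have loop: "\<exists>t s'. exec (While (k+1) ?body) s t s' \<and> t \<le> r * (2 ^ ma + (B e + 2) ^ mg + 5) + 1 \<and>
      s' k = int K \<and> s' (k+3) = int (N e) \<and> (\<forall>i<N e. s' (a K (N e) i) = int (g i e))"
    if "D e" "holds \<rho> e s" "r \<le> N e" "s k = int K" "s (k+1) = int r" "s (k+2) = int (N e - r)"
       "s (k+3) = int (N e)" "\<forall>i<N e - r. s (a K (N e) i) = int (g i e)" for e s r
    using that
  proof (induction r arbitrary: s)
    case 0
    show ?case by (intro exI conjI, rule WhileFalse) (use 0 in auto)
  next
    case (Suc r)
    let ?j = "N e - Suc r"
    have j: "?j < N e" "N e - r = Suc ?j" using Suc.prems(3) by auto
    from ca(2)[OF Suc.prems(6,4,7)] obtain t1 s1 where s1: "exec ca s t1 s1" "t1 \<le> 2 ^ ma"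
        "s1 (k+4) = int (a K (N e) ?j)" "\<And>i. i < k+4 \<or> Ka \<le> i \<Longrightarrow> s1 i = s i"
      by (rule runsE) blast
    have "holds \<rho> e s1" by (rule holds_cong[OF Suc.prems(2) k(1)]) (use s1(4) in simp)
    moreover have "s1 (k + 2) = int ?j" using s1(4) Suc.prems(6) by simp
    ultimately obtain t2 s2 where s2: "exec cg s1 t2 s2" "t2 \<le> (B e + 2) ^ mg"
        "s2 (k+5) = int (g ?j e)" "\<And>i. i < k+5 \<or> Kg \<le> i \<Longrightarrow> s2 i = s1 i"
      using runsE[OF cg(2)[OF Suc.prems(1) _ j(1)]] by metis
    define s3 where "s3 = s2(a K (N e) ?j := s2 (k+5), k+4 := 1, k+2 := int (Suc ?j), k+1 := int r)"
    have regs: "s2 i = s i" if "i < k + 4 \<or> K \<le> i" for i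
      using that s1(4)[of i] s2(4)[of i] K by auto
    have s24: "s2 (k + 4) = int (a K (N e) ?j)" using s1(3) s2(4) by simp
    have "exec ?step s2 (1 + (1 + (1 + 1))) s3"
      by (rule back_subst[where P = "exec ?step s2 (1 + (1 + (1 + 1)))"],
          rule Seq[OF Store Seq[OF Const Seq[OF Add Sub]]])
        (use aK[of "N e" ?j] kK regs[of "k+1"] regs[of "k+2"] Suc.prems(5,6) s24 in \<open>auto simp: s3_def fun_eq_iff\<close>)
    then have ex: "exec ?body s (t1 + t2 + (1 + (1 + (1 + 1)))) s3"
      using s1(1) s2(1) Seq by blast
    have same: "s3 i = s i" if "i < k + 1 \<or> i = k + 3 \<or> K \<le> i \<and> i \<noteq> a K (N e) ?j" for i
      using that regs[of i] kK aK[of "N e" ?j] by (auto simp: s3_def)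
    have "\<exists>t s'. exec (While (k+1) ?body) s3 t s' \<and> t \<le> r * (2 ^ ma + (B e + 2) ^ mg + 5) + 1 \<and>
      s' k = int K \<and> s' (k+3) = int (N e) \<and> (\<forall>i<N e. s' (a K (N e) i) = int (g i e))"
    proof (rule Suc.IH)
      show "holds \<rho> e s3" by (rule holds_cong[OF Suc.prems(2) k(1)]) (simp add: same)
      show "s3 k = int K" "s3 (k+3) = int (N e)" using same Suc.prems by auto
      show "s3 (k+1) = int r" "s3 (k+2) = int (N e - r)" using j by (auto simp: s3_def)
      show "\<forall>i<N e - r. s3 (a K (N e) i) = int (g i e)"
      proof (intro allI impI)
        fix i assume "i < N e - r"
        then have i: "i < N e" "i < ?j \<or> i = ?j" using j by auto
        show "s3 (a K (N e) i) = int (g i e)"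
        proof (cases "i = ?j")
          case True
          then show ?thesis using aK[of "N e" ?j] kK s2(3) by (auto simp: s3_def)
        next
          case False
          then have "a K (N e) i \<noteq> a K (N e) ?j" using a_inj i(1) j(1) by blast
          then show ?thesis using same[of "a K (N e) i"] aK i(2) False Suc.prems(8) by auto
        qed
      qed
    qed (use Suc.prems in auto)
    then obtain t s' where s': "exec (While (k+1) ?body) s3 t s'"
      "t \<le> r * (2 ^ ma + (B e + 2) ^ mg + 5) + 1" "s' k = int K" "s' (k+3) = int (N e)"
      "\<forall>i<N e. s' (a K (N e) i) = int (g i e)" by blast
    have "exec (While (k+1) ?body) s (Suc (t1 + t2 + (1 + (1 + (1 + 1))) + t)) s'"
      by (rule WhileTrue[OF _ ex s'(1)]) (use Suc.prems(5) in simp)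
    then show ?case by (intro exI conjI, assumption) (use s1(2) s2(2) s' in auto)
  qed
  let ?init = "Seq cN (Seq (Const k (int K)) (Seq (Const (k+2) 0) (Seq (Const (k+3) 0) (Add (k+3) (k+3) (k+1)))))"
  let ?fin1 = "Seq (Add 0 k (k+3)) (Seq (Const 1 2) (Seq (Add 0 0 1) (Const 1 1)))"
  \<comment> \<open>After \<open>restore (K - 2)\<close> the pointer in register 0 is
    \<open>N + 2 * K\<close>. Subtracting \<open>K\<close> leads back to the parked element 0, and
    element 1 sits one cell further. Each of the two registers is then its own pointer for the last
    two loads.\<close>
  let ?fin2 = "Seq (Const 1 (int K)) (Seq (Sub 0 0 1) (Seq (Const 1 1) (Seq (Add 1 0 1) (Seq (Load 1 1) (Load 0 0)))))"
  let ?c = "Seq (Seq ?init (While (k+1) ?body)) (Seq ?fin1 (Seq (restore (K - 2)) ?fin2))"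
  let ?m = "mN + (ma + mg + 1 + 5 + 1 + 1 + 0 + 1) + 1 + (2 * K + 20) + 1"
  have "\<exists>t s'. exec ?c s t s' \<and> t \<le> (B e + 2) ^ ?m \<and> (\<forall>i<N e. s' i = int (g i e))"
    if De: "D e" and h: "holds \<rho> e s" for e s
  proof -
    obtain t1 s1 where s1: "exec cN s t1 s1" "t1 \<le> (B e + 2) ^ mN" "s1 (k+1) = int (N e)"
        "\<And>i. i < k+1 \<or> KN \<le> i \<Longrightarrow> s1 i = s i"
      by (rule runsE[OF cN(2)[OF De h]]) blast
    define s2 where "s2 = s1(k := int K, k+2 := 0, k+3 := int (N e))"
    have init: "exec ?init s (t1 + (1 + (1 + (1 + 1)))) s2"
      by (rule back_subst[where P = "exec ?init s (t1 + (1 + (1 + (1 + 1))))"],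
          rule Seq[OF s1(1) Seq[OF Const Seq[OF Const Seq[OF Const Add]]]])
        (use s1(3) in \<open>auto simp: s2_def fun_eq_iff\<close>)
    have "holds \<rho> e s2"
      by (rule holds_cong[OF h k(1)]) (use s1(4) in \<open>simp add: s2_def\<close>)
    then have "\<exists>t s'. exec (While (k+1) ?body) s2 t s' \<and> t \<le> N e * (2 ^ ma + (B e + 2) ^ mg + 5) + 1 \<and>
      s' k = int K \<and> s' (k+3) = int (N e) \<and> (\<forall>i<N e. s' (a K (N e) i) = int (g i e))"
      by (intro loop De) (use s1(3) in \<open>auto simp: s2_def\<close>)
    then obtain t2 s3 where s3: "exec (While (k+1) ?body) s2 t2 s3"
      "t2 \<le> N e * (2 ^ ma + (B e + 2) ^ mg + 5) + 1" "s3 k = int K" "s3 (k+3) = int (N e)"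
      "\<And>i. i<N e \<Longrightarrow> s3 (a K (N e) i) = int (g i e)" by blast
    define s4 where "s4 = s3(0 := int (N e + K + 2), 1 := 1)"
    have fin1: "exec ?fin1 s3 (1 + (1 + (1 + 1))) s4"
      by (rule back_subst[where P = "exec ?fin1 s3 (1 + (1 + (1 + 1)))"],
          rule Seq[OF Add Seq[OF Const Seq[OF Add Const]]])
        (use k(2) s3(3,4) in \<open>auto simp: s4_def fun_eq_iff\<close>)
    have "s4 0 = int (N e + K + 2)" "s4 1 = 1" "K - 2 + 2 \<le> N e + K + 2"
      using kK by (auto simp: s4_def)
    from exec_restore[OF this] obtain t3 s5 where s5: "exec (restore (K - 2)) s4 t3 s5" "t3 = 2 * (K - 2) + 1"
      "s5 0 = int (N e + K + 2 + (K - 2))" "s5 1 = 1"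
      "\<And>i. i < K - 2 \<Longrightarrow> s5 (i + 2) = s4 (N e + K + 2 + i)" "\<And>i. K - 2 + 2 \<le> i \<Longrightarrow> s5 i = s4 i"
      by blast
    define s6 where "s6 = s5(1 := s5 (N e + K + 1), 0 := s5 (N e + K))"
    have fin2: "exec ?fin2 s5 (1 + (1 + (1 + (1 + (1 + 1))))) s6"
      by (rule back_subst[where P = "exec ?fin2 s5 (1 + (1 + (1 + (1 + (1 + 1)))))"],
          rule Seq[OF Const Seq[OF Sub Seq[OF Const Seq[OF Add Seq[OF Load Load]]]]])
        (use kK s5(3) in \<open>auto simp: s6_def fun_eq_iff nat_add_distrib add.commute\<close>)
    have out: "s6 i = int (g i e)" if i: "i < N e" for i
    proof (cases "i < K")
      case False
      then have "s6 i = s3 i" using kK s5(6)[of i] by (auto simp: s6_def s4_def)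
      then show ?thesis using s3(5)[OF i] False by (simp add: a_def)
    next
      case True
      have "s6 i = s4 (N e + K + i)"
      proof (cases "i < 2")
        case True
        then have "i = 0 \<or> i = 1" by auto
        then show ?thesis using kK s5(6)[of "N e + K + i"] by (auto simp: s6_def)
      next
        case False
        then obtain j where "i = j + 2" by (metis le_add_diff_inverse2 not_less)
        then show ?thesis using True s5(5)[of j] by (simp add: s6_def add_ac)
      qed
      then show ?thesis using s3(5)[OF i] True kK by (simp add: a_def s4_def)
    qed
    let ?t = "(t1 + (1 + (1 + (1 + 1)))) + t2 + ((1 + (1 + (1 + 1))) + (t3 + (1 + (1 + (1 + (1 + (1 + 1)))))))"
    have "2 ^ ma \<le> (B e + 2) ^ ma" by (rule power_mono) auto
    then have "2 ^ ma + (B e + 2) ^ mg \<le> (B e + 2) ^ (ma + mg + 1)"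
      by (rule power_sum_le) simp
    then have "2 ^ ma + (B e + 2) ^ mg + 5 \<le> (B e + 2) ^ (ma + mg + 1 + 5 + 1)"
      by (rule power_sum_le) (rule numeral_le_power)
    moreover have "N e \<le> B e + 2" using NB[OF De] h \<rho> by (simp add: holds_def)
    ultimately have "N e * (2 ^ ma + (B e + 2) ^ mg + 5) \<le> (B e + 2) * (B e + 2) ^ (ma + mg + 1 + 5 + 1)"
      by (intro mult_le_mono)
    also have "\<dots> = (B e + 2) ^ (ma + mg + 1 + 5 + 1 + 1)" by (metis power_Suc Suc_eq_plus1)
    finally have "N e * (2 ^ ma + (B e + 2) ^ mg + 5) + 1 \<le> (B e + 2) ^ (ma + mg + 1 + 5 + 1 + 1 + 0 + 1)"
      by (rule power_sum_le) simp
    then have "t2 \<le> (B e + 2) ^ (ma + mg + 1 + 5 + 1 + 1 + 0 + 1)" using s3(2) by linarith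
    with s1(2) have "t1 + t2 \<le> (B e + 2) ^ (mN + (ma + mg + 1 + 5 + 1 + 1 + 0 + 1) + 1)"
      by (rule power_sum_le)
    then have "t1 + t2 + (2 * K + 20) \<le> (B e + 2) ^ ?m"
      by (rule power_sum_le) (rule numeral_le_power)
    moreover have "?t \<le> t1 + t2 + (2 * K + 20)" using s5(2) by simp
    ultimately have "?t \<le> (B e + 2) ^ ?m" by (rule order_trans[rotated])
    moreover have "exec ?c s ?t s6"
      by (rule Seq[OF Seq[OF init s3(1)] Seq[OF fin1 Seq[OF s5(1) fin2]]])
    ultimately show ?thesis using out by blast
  qed
  then show ?thesis by blast
qed

section \<open>Reading the input bits into one number\<close>

definition pack :: "int list \<Rightarrow> nat" where
  "pack xs = foldl (\<lambda>X d. 2 * X + nat d) 0 xs"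

lemma pack_snoc: "pack (xs @ [d]) = 2 * pack xs + nat d"
  by (simp add: pack_def)

text \<open>The bits start in register 2, but scratch registers are needed. Straight-line code first
  absorbs five bits into register 2, which frees registers 3 to 6 and explains the condition
  \<open>5 \<le> b * l\<close>; loops then compute \<open>b * l\<close> and read the remaining bits
  through a pointer.\<close>

lemma exec_pack:
  "\<exists>c. \<forall>b l x. x \<in> bitvecs (b * l) \<longrightarrow> 5 \<le> b * l \<longrightarrow>
     (\<exists>t s. exec c (init_mem ([int b, int l] @ x)) t s \<and> t \<le> 10 * (b * l + l + 5) \<and>
        holds [0, 1, 2] [b, l, pack x] s)"
proof -
  let ?first = "Seq (Add 2 2 2) (Seq (Add 2 2 3) (Seq (Add 2 2 2) (Seq (Add 2 2 4)
     (Seq (Add 2 2 2) (Seq (Add 2 2 5) (Seq (Add 2 2 2) (Seq (Add 2 2 6)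
     (Seq (Const 3 0) (Seq (Add 3 3 1) (Seq (Const 4 2) (Const 5 1)))))))))))"
  let ?body1 = "Seq (Add 4 4 0) (Sub 3 3 5)"
  \<comment> \<open>Register 4 started at 2 and now holds \<open>2 + b * l\<close>. The sixth bit is
    in register 7, so subtracting 7 leaves the number of unread bits.\<close>
  let ?mid = "Seq (Const 3 7) (Sub 4 4 3)"
  let ?body2 = "Seq (Add 2 2 2) (Seq (Load 6 3) (Seq (Add 2 2 6) (Seq (Add 3 3 5) (Sub 4 4 5))))"
  let ?c = "Seq ?first (Seq (While 3 ?body1) (Seq ?mid (While 4 ?body2)))"
  have loop1: "exec (While 3 ?body1) s (3 * r + 1) (s(3 := 0, 4 := s 4 + int r * s 0))"
    if "s 3 = int r" "s 5 = 1" for s r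
    using that
  proof (induction r arbitrary: s)
    case 0
    then have eq: "s(3 := 0, 4 := s 4 + int 0 * s 0) = s" by auto
    show ?case unfolding eq using WhileFalse[of s 3 ?body1] 0 by simp
  next
    case (Suc r)
    let ?s = "s(4 := s 4 + s 0, 3 := int r)"
    have "exec ?body1 s (1 + 1) ?s"
      by (rule back_subst[where P = "exec ?body1 s (1 + 1)"], rule Seq[OF Add Sub])
        (use Suc.prems in \<open>auto simp: fun_eq_iff\<close>)
    moreover have "exec (While 3 ?body1) ?s (3 * r + 1) (?s(3 := 0, 4 := ?s 4 + int r * ?s 0))"
      by (rule Suc.IH) (use Suc.prems in auto)
    ultimately have "exec (While 3 ?body1) s (Suc (1 + 1 + (3 * r + 1))) (?s(3 := 0, 4 := ?s 4 + int r * ?s 0))"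
      using Suc.prems by (intro WhileTrue) auto
    moreover have "?s(3 := 0, 4 := ?s 4 + int r * ?s 0) = s(3 := 0, 4 := s 4 + int (Suc r) * s 0)"
      by (auto simp: fun_eq_iff algebra_simps)
    moreover have "Suc (1 + 1 + (3 * r + 1)) = 3 * Suc r + 1" by simp
    ultimately show ?case by (simp only:)
  qed
  have loop2: "\<exists>s'. exec (While 4 ?body2) s (6 * r + 1) s' \<and> s' 0 = s 0 \<and> s' 1 = s 1 \<and> s' 2 = int (pack x)"
    if "s 4 = int r" "s 5 = 1" "s 3 = int (2 + n - r)" "s 2 = int (pack (take (n - r) x))"
      "\<And>i. 7 \<le> i \<Longrightarrow> i < 2 + n \<Longrightarrow> s i = x ! (i - 2)" "r + 5 \<le> n" "x \<in> bitvecs n" for s r n x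
    using that
  proof (induction r arbitrary: s)
    case 0
    then have "length x = n" by (simp add: bitvecs_def)
    with 0 show ?case using WhileFalse[of s 4 ?body2] by (intro exI[of _ s]) auto
  next
    case (Suc r)
    let ?i = "n - Suc r"
    have len: "length x = n" using Suc.prems(7) by (simp add: bitvecs_def)
    have i: "?i < n" "5 \<le> ?i" "n - r = Suc ?i" "2 + n - Suc r = 2 + ?i" using Suc.prems(6) by auto
    have "x ! ?i \<in> {0, 1}" using Suc.prems(7) i(1) len nth_mem[of ?i x] unfolding bitvecs_def by blast
    then have xi: "0 \<le> x ! ?i" by auto
    have "s (2 + ?i) = x ! ?i" using Suc.prems(5)[of "2 + ?i"] i by simp
    moreover have "nat (s 3) = 2 + ?i" using Suc.prems(3) i by simp
    ultimately have ld: "s (nat (s 3)) = x ! ?i" "2 < nat (s 3)" using i by auto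
    let ?s = "s(2 := 2 * s 2 + x ! ?i, 6 := x ! ?i, 3 := s 3 + 1, 4 := int r)"
    have "exec ?body2 s (1 + (1 + (1 + (1 + 1)))) ?s"
      by (rule back_subst[where P = "exec ?body2 s (1 + (1 + (1 + (1 + 1))))"],
          rule Seq[OF Add Seq[OF Load Seq[OF Add Seq[OF Add Sub]]]])
        (use Suc.prems(1,2) ld in \<open>auto simp: fun_eq_iff\<close>)
    moreover have "\<exists>s'. exec (While 4 ?body2) ?s (6 * r + 1) s' \<and> s' 0 = ?s 0 \<and> s' 1 = ?s 1 \<and> s' 2 = int (pack x)"
    proof (rule Suc.IH)
      show "?s 2 = int (pack (take (n - r) x))"
        using i len xi Suc.prems(4) by (simp add: take_Suc_conv_app_nth pack_snoc)
    qed (use Suc.prems i in auto)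
    ultimately obtain s' where "exec ?body2 s (1 + (1 + (1 + (1 + 1)))) ?s"
      "exec (While 4 ?body2) ?s (6 * r + 1) s'" "s' 0 = s 0" "s' 1 = s 1" "s' 2 = int (pack x)" by auto
    moreover from this(1,2) have "exec (While 4 ?body2) s (Suc (1 + (1 + (1 + (1 + 1))) + (6 * r + 1))) s'"
      using Suc.prems by (intro WhileTrue) auto
    moreover have "Suc (1 + (1 + (1 + (1 + 1))) + (6 * r + 1)) = 6 * Suc r + 1" by simp
    ultimately show ?case by (intro exI[of _ s']) (simp only:)
  qed
  have "\<exists>t s. exec ?c (init_mem ([int b, int l] @ x)) t s \<and> t \<le> 10 * (b * l + l + 5) \<and>
        holds [0, 1, 2] [b, l, pack x] s"
    if x: "x \<in> bitvecs (b * l)" and n: "5 \<le> b * l" for b l x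
  proof -
    let ?n = "b * l"
    define s0 where "s0 = init_mem ([int b, int l] @ x)"
    have len: "length x = b * l" using x by (simp add: bitvecs_def)
    then have "Suc (Suc (Suc (Suc (Suc 0)))) \<le> length x" using n by simp
    then obtain x0 x1 x2 x3 x4 xs where xs: "x = x0 # x1 # x2 # x3 # x4 # xs"
      by (auto simp: Suc_le_length_iff)
    have pos: "0 \<le> x0" "0 \<le> x1" "0 \<le> x2" "0 \<le> x3" "0 \<le> x4" using x xs by (auto simp: bitvecs_def)
    have s0: "s0 0 = int b" "s0 (Suc 0) = int l" "s0 2 = x0" "s0 3 = x1" "s0 4 = x2" "s0 5 = x3" "s0 6 = x4"
      by (simp_all add: s0_def init_mem_def xs)
    define s1 where "s1 = s0(2 := 2 * (2 * (2 * (2 * x0 + x1) + x2) + x3) + x4, 3 := int l, 4 := 2, 5 := 1)"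
    have first: "exec ?first s0 (1+(1+(1+(1+(1+(1+(1+(1+(1+(1+(1+1))))))))))) s1"
      by (rule back_subst[where P = "exec ?first s0 (1+(1+(1+(1+(1+(1+(1+(1+(1+(1+(1+1)))))))))))"],
          rule Seq[OF Add Seq[OF Add Seq[OF Add Seq[OF Add Seq[OF Add Seq[OF Add Seq[OF Add Seq[OF Add
            Seq[OF Const Seq[OF Add Seq[OF Const Const]]]]]]]]]]])
        (simp add: s1_def fun_eq_iff s0)
    define s2 where "s2 = s1(3 := 0, 4 := s1 4 + int l * s1 0)"
    have while1: "exec (While 3 ?body1) s1 (3 * l + 1) s2"
      unfolding s2_def by (rule loop1) (auto simp: s1_def)
    have s10: "s1 0 = int b" by (simp add: s1_def s0)
    define s3 where "s3 = s2(3 := 7, 4 := int (?n - 5))"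
    have mid: "exec ?mid s2 (1 + 1) s3"
      by (rule back_subst[where P = "exec ?mid s2 (1 + 1)"], rule Seq[OF Const Sub])
        (use n s10 in \<open>auto simp: s3_def s2_def s1_def fun_eq_iff of_nat_diff algebra_simps\<close>)
    have "\<exists>s'. exec (While 4 ?body2) s3 (6 * (?n - 5) + 1) s' \<and> s' 0 = s3 0 \<and> s' 1 = s3 1 \<and> s' 2 = int (pack x)"
    proof (rule loop2[OF _ _ _ _ _ _ x])
      show "s3 2 = int (pack (take (?n - (?n - 5)) x))"
        using n pos by (simp add: s3_def s2_def s1_def xs pack_def)
      show "s3 i = x ! (i - 2)" if "7 \<le> i" "i < 2 + ?n" for i
        using that len by (simp add: s3_def s2_def s1_def s0_def init_mem_def nth_Cons' numeral_2_eq_2)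
    qed (use n in \<open>auto simp: s3_def s2_def s1_def\<close>)
    then obtain s4 where s4: "exec (While 4 ?body2) s3 (6 * (?n - 5) + 1) s4" "s4 0 = s3 0" "s4 1 = s3 1"
      "s4 2 = int (pack x)" by blast
    have h: "holds [0, 1, 2] [b, l, pack x] s4"
      using s4 by (simp add: s3_def s2_def s1_def s0)
    show ?thesis
      unfolding s0_def[symmetric]
      by (intro exI conjI, rule Seq[OF first Seq[OF while1 Seq[OF mid s4(1)]]])
        (use h in \<open>auto simp: algebra_simps\<close>)
  qed
  then show ?thesis by blast
qed

section \<open>Primes and Chinese remainders\<close>

lemma Lcm_div_binomial_Ints:
  assumes "1 \<le> k" "k \<le> n"
  shows "real (Lcm {1..n}) / real (k * (n choose k)) \<in> \<int>"
  using assms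
proof (induction n arbitrary: k)
  case 0
  then show ?case by simp
next
  case (Suc n)
  define L where "L = Lcm {1..Suc n}"
  have "Lcm {1..n} dvd L" unfolding L_def by (rule Lcm_subset) auto
  then obtain q where q: "L = Lcm {1..n} * q" by (auto simp: dvd_def)
  have low: "real L / real (j * (n choose j)) \<in> \<int>" if "1 \<le> j" "j \<le> n" for j
  proof -
    have "real L / real (j * (n choose j)) = real (Lcm {1..n}) / real (j * (n choose j)) * real q"
      by (simp add: q)
    then show ?thesis using Suc.IH[OF that] by (metis Ints_mult Ints_of_nat)
  qed
  have "real L / real (k * (Suc n choose k)) \<in> \<int>" if "1 \<le> k" "k \<le> Suc n" for k
    using that
  proof (induction k rule: dec_induct)
    case base
    have "Suc n dvd L" unfolding L_def by (rule dvd_Lcm) auto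
    then obtain r where "L = Suc n * r" by (auto simp: dvd_def)
    then have "real L / real (1 * (Suc n choose 1)) = real r"
      by (simp only: binomial_1 of_nat_mult nat_mult_1) simp
    then show ?case by (metis Ints_of_nat)
  next
    case (step k)
    \<comment> \<open>Leibniz's harmonic triangle: with \<open>a n k = 1 / (k * (n choose k))\<close> one has
      \<open>a (n + 1) (k + 1) = a n k - a (n + 1) k\<close>.\<close>
    have pos: "0 < (n choose k)" "0 < (Suc n choose k)" "0 < (Suc n choose Suc k)" using step by auto
    have 1: "Suc k * (Suc n choose Suc k) = Suc n * (n choose k)"
      using Suc_times_binomial_eq[of n k] by (simp only: mult.commute)
    have 2: "(Suc n - k) * (Suc n choose k) = Suc n * (n choose k)"
      using binomial_absorb_comp[of "Suc n" k] by simp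
    have "real L / real (Suc k * (Suc n choose Suc k)) =
        real L / real (k * (n choose k)) - real L / real (k * (Suc n choose k))"
    proof -
      have k: "real k \<noteq> 0" using step by simp
      have r2: "(real (Suc n) - real k) * real (Suc n choose k) = real (Suc n) * real (n choose k)"
        using arg_cong[OF 2, of real] step by (simp add: of_nat_diff del: of_nat_Suc mult_Suc)
      have "real L / real (k * (n choose k)) - real L / real (k * (Suc n choose k)) =
         real L / real k * (1 / real (n choose k) - 1 / real (Suc n choose k))"
        by (simp add: right_diff_distrib)
      also have "1 / real (n choose k) - 1 / real (Suc n choose k) = real k / (real (Suc n) * real (n choose k))"
        using pos r2 by (simp add: divide_simps del: of_nat_Suc) (simp add: algebra_simps del: of_nat_Suc)
      also have "real L / real k * (real k / (real (Suc n) * real (n choose k))) = real L / real (Suc n * (n choose k))"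
        using k by (simp del: of_nat_Suc mult_Suc)
      finally show ?thesis by (simp only: 1)
    qed
    then show ?case using low[of k] step by (metis Ints_diff Suc_le_lessD less_Suc_eq_le Suc_leD)
  qed
  then show ?case using Suc.prems unfolding L_def by blast
qed

text \<open>The multiplicity of \<open>p\<close> in an lcm is the largest one among the arguments,
  so a prime power dividing the lcm already divides a single number up to \<open>n\<close>.\<close>

lemma prime_power_dvd_Lcm:
  assumes "prime p" "p ^ a dvd Lcm {1..n}" "1 \<le> (n::nat)"
  shows "p ^ a \<le> n"
  using assms(2,3)
proof (induction n)
  case 0
  then show ?case by simp
next
  case (Suc n)
  have "{1..Suc n} = insert (Suc n) {1..n}" by auto
  then have L: "Lcm {1..Suc n} = lcm (Suc n) (Lcm {1..n})" by (simp add: Lcm_insert)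
  have nz: "Lcm {1..n} \<noteq> 0" by (simp add: Lcm_0_iff)
  have iff: "p ^ a dvd x \<longleftrightarrow> a \<le> multiplicity p x" if "x \<noteq> 0" for x :: nat
    using that not_prime_unit[of p] assms(1) by (intro power_dvd_iff_le_multiplicity) auto
  have "a \<le> multiplicity p (lcm (Suc n) (Lcm {1..n}))"
    using Suc.prems(1) nz iff[of "lcm (Suc n) (Lcm {1..n})"] by (simp only: L) (simp add: lcm_eq_0_iff)
  also have "\<dots> = max (multiplicity p (Suc n)) (multiplicity p (Lcm {1..n}))"
    using nz assms(1) by (intro multiplicity_lcm) auto
  finally have "p ^ a dvd Suc n \<or> p ^ a dvd Lcm {1..n}"
    using iff[of "Suc n"] iff[OF nz] by (auto simp: le_max_iff_disj)
  then show ?case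
  proof
    assume "p ^ a dvd Suc n"
    then show ?thesis by (rule dvd_imp_le) simp
  next
    assume *: "p ^ a dvd Lcm {1..n}"
    show ?thesis
    proof (cases "n = 0")
      case True
      with * show ?thesis by auto
    next
      case False
      with Suc.IH[OF *] show ?thesis by simp
    qed
  qed
qed

lemma Lcm_le_power_card:
  assumes "1 \<le> (n::nat)"
  shows "Lcm {1..n} \<le> n ^ card {p. prime p \<and> p \<le> n}"
proof -
  let ?L = "Lcm {1..n}" and ?P = "{p. prime p \<and> p \<le> n}"
  have nz: "?L > 0" by (simp add: Lcm_0_iff neq0_conv[symmetric] del: neq0_conv)
  have fin: "finite ?P" by (rule finite_subset[of _ "{..n}"]) auto
  have le: "p ^ multiplicity p ?L \<le> n" if "p \<in> prime_factors ?L" for p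
    using that assms multiplicity_dvd[of p ?L] by (intro prime_power_dvd_Lcm) auto
  have sub: "prime_factors ?L \<subseteq> ?P"
  proof
    fix p assume p: "p \<in> prime_factors ?L"
    then have "p ^ 1 dvd ?L" "prime p" by auto
    from prime_power_dvd_Lcm[OF this(2,1) assms] this(2) show "p \<in> ?P" by simp
  qed
  have "?L = (\<Prod>p \<in> prime_factors ?L. p ^ multiplicity p ?L)"
    by (rule prime_factorization_nat[OF nz])
  also have "\<dots> \<le> (\<Prod>p \<in> prime_factors ?L. n)" by (intro prod_mono) (use le in auto)
  also have "\<dots> = n ^ card (prime_factors ?L)" by simp
  also have "\<dots> \<le> n ^ card ?P" using assms card_mono[OF fin sub] by (intro power_increasing) auto
  finally show ?thesis .
qed

text \<open>\<open>n * (2 * n choose n)\<close> divides the lcm, and the central binomial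
  coefficient is at least 4^n / (2 n); this leaves 4^n / 2.\<close>

lemma two_power_le_Lcm:
  assumes "1 \<le> n"
  shows "2 ^ n \<le> Lcm {1..2 * n}"
proof -
  have L: "real (Lcm {1..2 * n}) / real (n * (2 * n choose n)) \<in> \<int>"
    by (rule Lcm_div_binomial_Ints) (use assms in auto)
  have pos: "0 < n * (2 * n choose n)" "0 < Lcm {1..2 * n}"
    using assms by (auto simp: Lcm_0_iff neq0_conv[symmetric] simp del: neq0_conv)
  then have "0 < real (Lcm {1..2 * n}) / real (n * (2 * n choose n))" by simp
  with L have "1 \<le> real (Lcm {1..2 * n}) / real (n * (2 * n choose n))"
    by (metis Ints_cases of_int_0_less_iff of_int_1_le_iff int_one_le_iff_zero_less)
  then have 1: "real (n * (2 * n choose n)) \<le> real (Lcm {1..2 * n})"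
    using pos by (simp add: field_simps)
  have "real (2 ^ n) \<le> 4 ^ n / 2"
  proof -
    have "(2::real) ^ 1 \<le> 2 ^ n" using assms by (intro power_increasing) auto
    then have "2 ^ n * 2 \<le> (2::real) ^ n * 2 ^ n" by (intro mult_left_mono) auto
    also have "\<dots> = 4 ^ n" by (simp add: power_mult_distrib[symmetric])
    finally show ?thesis by simp
  qed
  also have "\<dots> = real n * (4 ^ n / (2 * real n))" using assms by simp
  also have "\<dots> \<le> real n * real (2 * n choose n)"
    using central_binomial_lower_bound[of n] assms by (intro mult_left_mono) auto
  also have "\<dots> \<le> real (Lcm {1..2 * n})" using 1 by simp
  finally show ?thesis by (simp only: of_nat_le_iff)
qed

text \<open>With fewer than \<open>k\<close> primes up to 16 k^2, the lcm of the numbers up to there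
  would be at most (16 k^2)^k, which is below the lower bound 2^(8 k^2). A polynomial bound on the
  \<open>k\<close>-th prime suffices where only lengths up to constant factors matter.\<close>

lemma card_primes_ge:
  assumes "1 \<le> k"
  shows "k \<le> card {p::nat. prime p \<and> p \<le> 16 * k\<^sup>2}"
proof (rule ccontr)
  let ?\<pi> = "card {p::nat. prime p \<and> p \<le> 16 * k\<^sup>2}"
  assume "\<not> k \<le> ?\<pi>"
  have k2: "1 \<le> k\<^sup>2" using assms by simp
  have "2 ^ (8 * k\<^sup>2) \<le> Lcm {1..2 * (8 * k\<^sup>2)}" by (rule two_power_le_Lcm) (use k2 in simp)
  also have "\<dots> = Lcm {1..16 * k\<^sup>2}" by simp
  also have "\<dots> \<le> (16 * k\<^sup>2) ^ ?\<pi>" by (rule Lcm_le_power_card) (use k2 in simp)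
  also have "\<dots> \<le> (16 * k\<^sup>2) ^ k" using \<open>\<not> k \<le> ?\<pi>\<close> k2 by (intro power_increasing) auto
  also have "\<dots> \<le> (2 ^ 4 * (2 ^ k)\<^sup>2) ^ k"
    by (intro power_mono mult_mono) (auto simp: less_exp less_imp_le)
  also have "2 ^ 4 * (2 ^ k)\<^sup>2 = (2::nat) ^ (4 + 2 * k)"
    by (simp only: power_add power_mult mult.commute[of 2 k])
  also have "\<dots> ^ k = 2 ^ ((4 + 2 * k) * k)" by (rule power_mult[symmetric])
  finally have "8 * k\<^sup>2 \<le> (4 + 2 * k) * k" by (simp add: power_increasing_iff)
  moreover have "k \<le> k\<^sup>2" by (simp add: power2_eq_square)
  ultimately show False using k2 by (simp add: power2_eq_square algebra_simps)
qed

section \<open>The primes from a threshold on\<close>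

definition next_prime :: "nat \<Rightarrow> nat" where
  "next_prime x = (LEAST p. prime p \<and> x \<le> p)"

primrec nprime :: "nat \<Rightarrow> nat \<Rightarrow> nat" where
  "nprime Q 0 = next_prime Q"
| "nprime Q (Suc j) = next_prime (Suc (nprime Q j))"

lemma next_prime: "prime (next_prime x)" "x \<le> next_prime x" "prime p \<Longrightarrow> x \<le> p \<Longrightarrow> next_prime x \<le> p"
proof -
  obtain p where "prime p" "x < p" using bigger_prime by blast
  then have "prime p \<and> x \<le> p" by simp
  from LeastI[of "\<lambda>p. prime p \<and> x \<le> p", OF this]
  show "prime (next_prime x)" "x \<le> next_prime x" unfolding next_prime_def by auto
  show "prime p \<Longrightarrow> x \<le> p \<Longrightarrow> next_prime x \<le> p" for p unfolding next_prime_def by (auto intro: Least_le)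
qed

lemma prime_nprime: "prime (nprime Q j)"
  by (cases j) (auto intro: next_prime)

lemma nprime_strict_mono: "i < j \<Longrightarrow> nprime Q i < nprime Q j"
proof (induction j)
  case (Suc j)
  have "nprime Q j < nprime Q (Suc j)" using next_prime(2)[of "Suc (nprime Q j)"] by simp
  with Suc show ?case by (auto simp: less_Suc_eq)
qed simp

lemma nprime_ge: "Q \<le> nprime Q j"
  using next_prime(2)[of Q] nprime_strict_mono[of 0 j Q] by (cases "j = 0") auto

lemma nprime_cover:
  assumes "prime p" "Q \<le> p" "p < nprime Q j"
  shows "\<exists>i<j. p = nprime Q i"
  using assms(3)
proof (induction j)
  case 0
  then show ?case using next_prime(3)[OF assms(1,2)] by simp
next
  case (Suc j)
  then show ?case
    using next_prime(3)[OF assms(1), of "Suc (nprime Q j)"] by (cases p "nprime Q j" rule: linorder_cases) (auto simp: less_Suc_eq)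
qed

text \<open>Of the primes below \<open>nprime Q j\<close>, at most \<open>Q\<close> are below
  \<open>Q\<close> and \<open>j\<close> are enumerated before it, so \<open>card_primes_ge\<close>
  for \<open>Q + j + 1\<close> forces the bound.\<close>

lemma nprime_le: "nprime Q j \<le> 16 * (Q + j + 1)\<^sup>2"
proof (rule ccontr)
  let ?N = "16 * (Q + j + 1)\<^sup>2"
  assume "\<not> nprime Q j \<le> ?N"
  have "{p. prime p \<and> p \<le> ?N} \<subseteq> {..<Q} \<union> nprime Q ` {..<j}"
  proof
    fix p assume p: "p \<in> {p. prime p \<and> p \<le> ?N}"
    then have "p < nprime Q j" using \<open>\<not> nprime Q j \<le> ?N\<close> by simp
    then show "p \<in> {..<Q} \<union> nprime Q ` {..<j}"
      using p nprime_cover[of p Q j] by (cases "p < Q") auto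
  qed
  then have "card {p. prime p \<and> p \<le> ?N} \<le> card ({..<Q} \<union> nprime Q ` {..<j})"
    by (rule card_mono[rotated]) simp
  also have "\<dots> \<le> card {..<Q} + card (nprime Q ` {..<j})" by (rule card_Un_le)
  also have "\<dots> \<le> Q + j" using card_image_le[of "{..<j}" "nprime Q"] by simp
  finally show False using card_primes_ge[of "Q + j + 1"] by simp
qed

lemma coprime_nprime: "i \<noteq> j \<Longrightarrow> coprime (nprime Q i) (nprime Q j)"
  using prime_nprime nprime_strict_mono by (intro primes_coprime) (metis linorder_neqE_nat less_irrefl)+

section \<open>Chinese remaindering modulo successive primes\<close>

definition nprod :: "(nat \<Rightarrow> nat) \<Rightarrow> nat \<Rightarrow> nat" where
  "nprod p m = (\<Prod>j<m. p j)"

text \<open>Garner's mixed-radix scheme: stage \<open>j\<close> adds a multiple of the product of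
  the earlier moduli and so keeps the earlier residues. The multiplier is searched for rather than
  obtained from a modular inverse; it is below the prime, and bounded search is available on the
  machine.\<close>

definition crt :: "(nat \<Rightarrow> nat) \<Rightarrow> nat \<Rightarrow> (nat \<Rightarrow> nat) \<Rightarrow> nat" where
  "crt p m a = itr m (\<lambda>j v. v + nprod p j * (LEAST t. (v + nprod p j * t) mod p j = a j)) 0"

lemma crt_step:
  fixes v P p a :: nat
  assumes "coprime P p" "a < p"
  shows "\<exists>t<p. (v + P * t) mod p = a"
proof -
  obtain x where x: "[P * x = Suc 0] (mod p)" using cong_solve_coprime_nat[OF assms(1)] by blast
  \<comment> \<open>This is x * (a - v) for the inverse \<open>x\<close> of \<open>P\<close>, with
    \<open>(p - 1) * v\<close> in place of \<open>- v\<close> to stay within the naturals.\<close>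
  let ?t = "x * (a + (p - 1) * v)"
  have "[v + P * ?t = v + Suc 0 * (a + (p - 1) * v)] (mod p)"
    using cong_add[OF cong_refl cong_mult[OF x cong_refl]] by (simp add: mult.assoc)
  also have "v + Suc 0 * (a + (p - 1) * v) = a + p * v"
    using assms(2) by (cases p) auto
  also have "[a + p * v = a] (mod p)" by (simp add: cong_def)
  finally have "(v + P * ?t) mod p = a" using assms(2) by (simp add: cong_def)
  moreover have "(v + P * (?t mod p)) mod p = (v + P * ?t) mod p"
    by (metis mod_add_right_eq mod_mult_right_eq)
  ultimately show ?thesis using assms(2) by (intro exI[of _ "?t mod p"]) auto
qed

lemma coprime_nprod_nprime: "coprime (nprod (nprime Q) j) (nprime Q j)"
  unfolding nprod_def by (rule prod_coprime_left) (use coprime_nprime in force)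

lemma nprod_Suc: "nprod p (Suc j) = nprod p j * p j"
  by (simp add: nprod_def)

lemma nprod_pos: "0 < nprod (nprime Q) m"
  unfolding nprod_def using prime_nprime prime_gt_0_nat by (intro prod_pos) blast

text \<open>Stated for every stage \<open>j\<close>, not just the last one, because the timing of
  the loop needs the size of the intermediate values.\<close>

lemma crt_invariant:
  assumes "\<And>i. i < m \<Longrightarrow> a i < nprime Q i" "j \<le> m"
  defines "v \<equiv> \<lambda>j. itr j (\<lambda>j v. v + nprod (nprime Q) j * (LEAST t. (v + nprod (nprime Q) j * t) mod nprime Q j = a j)) 0"
  shows "v j < nprod (nprime Q) j \<and> (\<forall>i<j. v j mod nprime Q i = a i)"
  using assms(2)
proof (induction j)
  case 0
  then show ?case by (simp add: v_def nprod_def)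
next
  case (Suc j)
  let ?P = "nprod (nprime Q) j" and ?p = "nprime Q j"
  define t where "t = (LEAST t. (v j + ?P * t) mod ?p = a j)"
  have vS: "v (Suc j) = v j + ?P * t" by (simp add: v_def t_def)
  obtain t' where t': "t' < ?p" "(v j + ?P * t') mod ?p = a j"
    using crt_step[OF coprime_nprod_nprime assms(1)] Suc.prems by (metis Suc_le_lessD)
  have "t \<le> t'" unfolding t_def by (rule Least_le[of "\<lambda>t. (v j + ?P * t) mod ?p = a j"], rule t'(2))
  then have "t + 1 \<le> ?p" using t'(1) by simp
  then have "?P * (t + 1) \<le> ?P * ?p" by (rule mult_le_mono2)
  then have less: "v (Suc j) < nprod (nprime Q) (Suc j)" using Suc by (simp add: vS nprod_Suc algebra_simps)
  have "(v j + ?P * t) mod ?p = a j"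
    unfolding t_def by (rule LeastI[of "\<lambda>t. (v j + ?P * t) mod ?p = a j"], rule t'(2))
  moreover have "(v j + ?P * t) mod nprime Q i = a i" if "i < j" for i
  proof -
    have "nprime Q i dvd ?P" unfolding nprod_def using that by (intro dvd_prodI) auto
    then have "(v j + ?P * t) mod nprime Q i = v j mod nprime Q i" by (auto simp: dvd_def mult.assoc)
    then show ?thesis using Suc that by simp
  qed
  ultimately show ?case using less by (auto simp: vS less_Suc_eq)
qed

lemma crt_less: "(\<And>i. i < m \<Longrightarrow> a i < nprime Q i) \<Longrightarrow> crt (nprime Q) m a < nprod (nprime Q) m"
  using crt_invariant[of m a Q m] by (simp add: crt_def)

lemma crt_mod: "(\<And>i. i < m \<Longrightarrow> a i < nprime Q i) \<Longrightarrow> i < m \<Longrightarrow> crt (nprime Q) m a mod nprime Q i = a i"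
  using crt_invariant[of m a Q m] by (simp add: crt_def)

section \<open>Tables for small reductions\<close>

text \<open>The binary logarithm rounded down, with value 0 at 0. As a least solution it can be
  computed by \<open>ptime_Least\<close>.\<close>

definition flog :: "nat \<Rightarrow> nat" where
  "flog n = (LEAST k. n < 2 ^ (k + 1))"

text \<open>A table is a single number \<open>c\<close> in base \<open>E\<close>: coordinate
  \<open>i\<close> of the image of the word \<open>u\<close> is digit \<open>u * l + i\<close>.
  Searching for a table is then searching for a number.\<close>

definition digit :: "nat \<Rightarrow> nat \<Rightarrow> nat \<Rightarrow> nat" where
  "digit E c i = c div E ^ i mod E"

definition tdot :: "nat \<Rightarrow> nat \<Rightarrow> nat \<Rightarrow> nat \<Rightarrow> nat \<Rightarrow> nat" where
  "tdot l E c u v = (\<Sum>i<l. digit E c (u * l + i) * digit E c (v * l + i))"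

definition bitdisj :: "nat \<Rightarrow> nat \<Rightarrow> nat \<Rightarrow> bool" where
  "bitdisj w u v \<longleftrightarrow> (\<forall>i<w. \<not> (odd (u div 2 ^ i) \<and> odd (v div 2 ^ i)))"

text \<open>The smallest set of accepted values compatible with a table, namely the inner products
  that orthogonal pairs attain. With this choice the table determines the accepted set, and only
  tables have to be searched.\<close>

definition in_V0 :: "nat \<Rightarrow> nat \<Rightarrow> nat \<Rightarrow> nat \<Rightarrow> nat \<Rightarrow> bool" where
  "in_V0 l w E c z \<longleftrightarrow> (\<exists>u<2 ^ w. \<exists>v<2 ^ w. bitdisj w u v \<and> tdot l E c u v = z)"

definition valid :: "nat \<Rightarrow> nat \<Rightarrow> nat \<Rightarrow> nat \<Rightarrow> bool" where
  "valid l w E c \<longleftrightarrow> (\<forall>u<2 ^ w. \<forall>v<2 ^ w. \<not> bitdisj w u v \<longrightarrow> \<not> in_V0 l w E c (tdot l E c u v))"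

text \<open>The base is minimised over all tables instead of being computed from
  \<open>\<tau>\<close>; any reduction at this block size bounds it from above.\<close>

definition min_base :: "nat \<Rightarrow> nat \<Rightarrow> nat" where
  "min_base l w = (LEAST E. \<exists>c<E ^ (2 ^ w * l). valid l w E c)"

definition min_table :: "nat \<Rightarrow> nat \<Rightarrow> nat" where
  "min_table l w = (LEAST c. valid l w (min_base l w) c)"

lemma flog: "n < 2 ^ (flog n + 1)" "0 < n \<Longrightarrow> 2 ^ flog n \<le> n"
proof -
  have ex: "n < 2 ^ (n + 1)" by (rule less_trans[OF less_exp]) simp
  show "n < 2 ^ (flog n + 1)"
    unfolding flog_def by (rule LeastI[of "\<lambda>k. n < 2 ^ (k + 1)", OF ex])
  assume "0 < n"
  show "2 ^ flog n \<le> n"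
  proof (cases "flog n")
    case 0
    with \<open>0 < n\<close> show ?thesis by simp
  next
    case (Suc k)
    then have "\<not> n < 2 ^ (k + 1)"
      unfolding flog_def by (intro not_less_Least) simp
    with Suc show ?thesis by simp
  qed
qed

lemma flog_less: "flog n \<le> n"
  unfolding flog_def by (rule Least_le) (rule less_trans[OF less_exp], simp)

lemma digit_less: "0 < E \<Longrightarrow> digit E c i < E"
  by (simp add: digit_def)

lemma ex_digits:
  assumes "\<And>n. n < N \<Longrightarrow> t n < E"
  shows "\<exists>c<E ^ N. \<forall>n<N. digit E c n = t n"
  using assms
proof (induction N)
  case 0
  then show ?case by simp
next
  case (Suc N)
  then obtain c where c: "c < E ^ N" "\<And>n. n < N \<Longrightarrow> digit E c n = t n" by (metis less_SucI)
  let ?c = "c + t N * E ^ N"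
  have tN: "t N < E" using Suc.prems by simp
  then have E: "0 < E" by simp
  have "?c < E ^ N + t N * E ^ N" using c(1) by simp
  also have "\<dots> = (t N + 1) * E ^ N" by simp
  also have "\<dots> \<le> E * E ^ N" using tN by (intro mult_le_mono1) simp
  finally have "?c < E ^ Suc N" by simp
  moreover have "digit E ?c N = t N" using c(1) tN E by (simp add: digit_def)
  moreover have "digit E ?c n = t n" if "n < N" for n
  proof -
    have "E ^ N = E ^ n * (E * E ^ (N - Suc n))"
      using that by (simp add: power_add[symmetric] flip: power_Suc)
    then have eq: "?c = c + E ^ n * (E * (t N * E ^ (N - Suc n)))" by simp
    have "?c div E ^ n = E * (t N * E ^ (N - Suc n)) + c div E ^ n"
      unfolding eq by (rule div_mult_self2) (use E in simp)
    then show ?thesis using c(2)[OF that] by (simp only: digit_def mod_mult_self4)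
  qed
  ultimately show ?case by (metis less_SucE)
qed

section \<open>Bit vectors packed into numbers\<close>

lemma bitvecs_snocE:
  assumes "x \<in> bitvecs (Suc n)"
  obtains y d where "x = y @ [d]" "y \<in> bitvecs n" "d = 0 \<or> d = 1"
proof -
  have "x \<noteq> []" using assms by (auto simp: bitvecs_def)
  then obtain y d where "x = y @ [d]" by (metis rev_exhaust)
  with assms show thesis by (intro that) (auto simp: bitvecs_def)
qed

lemma pack_less: "x \<in> bitvecs n \<Longrightarrow> pack x < 2 ^ n"
proof (induction n arbitrary: x)
  case 0
  then show ?case by (simp add: bitvecs_def pack_def)
next
  case (Suc n)
  then obtain y d where "x = y @ [d]" "y \<in> bitvecs n" "d = 0 \<or> d = 1" by (elim bitvecs_snocE)
  then show ?case using Suc.IH[of y] by (auto simp: pack_snoc)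
qed

lemma pack_surj: "u < 2 ^ n \<Longrightarrow> \<exists>x \<in> bitvecs n. pack x = u"
proof (induction n arbitrary: u)
  case 0
  then show ?case by (simp add: bitvecs_def pack_def)
next
  case (Suc n)
  then have "u div 2 < 2 ^ n" by (simp add: div_less_iff_less_mult mult.commute)
  from Suc.IH[OF this] obtain x where x: "x \<in> bitvecs n" "pack x = u div 2" by blast
  then have "x @ [int (u mod 2)] \<in> bitvecs (Suc n)"
    by (auto simp: bitvecs_def)
  then show ?case using x(2) by (intro bexI[of _ "x @ [int (u mod 2)]"]) (simp_all add: pack_snoc)
qed

lemma iprod_snoc:
  "length x = length y \<Longrightarrow> \<langle>x @ [a], y @ [b]\<rangle> = \<langle>x, y\<rangle> + (a * b :: int)"
  by (simp add: iprod_def)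

lemma bitdisj_Suc: "bitdisj (Suc w) u v \<longleftrightarrow> \<not> (odd u \<and> odd v) \<and> bitdisj w (u div 2) (v div 2)"
proof -
  have "bitdisj (Suc w) u v \<longleftrightarrow> (\<forall>i\<in>{..<Suc w}. \<not> (odd (u div 2 ^ i) \<and> odd (v div 2 ^ i)))"
    by (auto simp: bitdisj_def)
  also have "\<dots> \<longleftrightarrow> \<not> (odd u \<and> odd v) \<and> (\<forall>i<w. \<not> (odd (u div 2 ^ Suc i) \<and> odd (v div 2 ^ Suc i)))"
    unfolding lessThan_Suc_eq_insert_0 by auto
  also have "\<dots> \<longleftrightarrow> \<not> (odd u \<and> odd v) \<and> bitdisj w (u div 2) (v div 2)"
    by (simp add: bitdisj_def div_mult2_eq[symmetric])
  finally show ?thesis .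
qed

lemma iprod_nonneg: "x \<in> bitvecs n \<Longrightarrow> y \<in> bitvecs n \<Longrightarrow> 0 \<le> \<langle>x, y\<rangle>"
proof (induction n arbitrary: x y)
  case 0
  then show ?case by (simp add: bitvecs_def)
next
  case (Suc n)
  obtain x' a where "x = x' @ [a]" "x' \<in> bitvecs n" "a = 0 \<or> a = 1"
    using Suc.prems(1) by (elim bitvecs_snocE)
  moreover obtain y' b where "y = y' @ [b]" "y' \<in> bitvecs n" "b = 0 \<or> b = 1"
    using Suc.prems(2) by (elim bitvecs_snocE)
  ultimately show ?case using Suc.IH[of x' y'] by (auto simp: iprod_snoc bitvecs_def)
qed

lemma bitdisj_pack:
  "x \<in> bitvecs n \<Longrightarrow> y \<in> bitvecs n \<Longrightarrow> bitdisj n (pack x) (pack y) \<longleftrightarrow> \<langle>x, y\<rangle> = 0"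
proof (induction n arbitrary: x y)
  case 0
  then show ?case by (simp add: bitvecs_def bitdisj_def)
next
  case (Suc n)
  obtain x' a where x: "x = x' @ [a]" "x' \<in> bitvecs n" "a = 0 \<or> a = 1"
    using Suc.prems(1) by (elim bitvecs_snocE)
  obtain y' b where y: "y = y' @ [b]" "y' \<in> bitvecs n" "b = 0 \<or> b = 1"
    using Suc.prems(2) by (elim bitvecs_snocE)
  have "length x' = length y'" using x y by (simp add: bitvecs_def)
  then show ?case
    using Suc.IH[OF x(2) y(2)] iprod_nonneg[OF x(2) y(2)] x(1,3) y(1,3)
    by (auto simp: iprod_snoc bitdisj_Suc pack_snoc)
qed

text \<open>The values of \<open>\<phi>\<close> on all words are written down as digits. Inner
  products of images lie in \<open>V\<close> for orthogonal pairs and outside \<open>V\<close> for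
  all others, so the two kinds of pairs never share a value.\<close>

lemma ex_valid:
  assumes red: "is_reduction a l \<kappa> \<phi> V" and l: "0 < l"
  shows "\<exists>c<(l ^ (\<kappa> * a)) ^ (2 ^ (a * l) * l). valid l (a * l) (l ^ (\<kappa> * a)) c"
proof -
  let ?w = "a * l" and ?E = "l ^ (\<kappa> * a)"
  define bits where "bits u = (SOME x. x \<in> bitvecs ?w \<and> pack x = u)" for u
  have bits: "bits u \<in> bitvecs ?w" "pack (bits u) = u" if "u < 2 ^ ?w" for u
  proof -
    have "\<exists>x. x \<in> bitvecs ?w \<and> pack x = u" using pack_surj[OF that] by blast
    from someI_ex[OF this] show "bits u \<in> bitvecs ?w" "pack (bits u) = u"
      unfolding bits_def by auto
  qed
  define t where "t n = nat (\<phi> (bits (n div l)) ! (n mod l))" for n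
  have rng: "0 \<le> \<phi> x ! i \<and> \<phi> x ! i < int ?E" if "x \<in> bitvecs ?w" "i < l" for x i
    using red that unfolding is_reduction_def by auto
  have len: "length (\<phi> x) = l" if "x \<in> bitvecs ?w" for x
    using red that unfolding is_reduction_def by blast
  have "t n < ?E" if "n < 2 ^ ?w * l" for n
  proof -
    have "n div l < 2 ^ ?w" using that l by (simp add: div_less_iff_less_mult)
    then show ?thesis using rng[OF bits(1), of "n div l" "n mod l"] l by (simp add: t_def nat_less_iff)
  qed
  then obtain c where c: "c < ?E ^ (2 ^ ?w * l)" "\<And>n. n < 2 ^ ?w * l \<Longrightarrow> digit ?E c n = t n"
    using ex_digits[of "2 ^ ?w * l" t ?E] by blast
  have digit: "int (digit ?E c (u * l + i)) = \<phi> (bits u) ! i" if "u < 2 ^ ?w" "i < l" for u i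
  proof -
    have "u * l + i < (u + 1) * l" using that(2) by simp
    also have "\<dots> \<le> 2 ^ ?w * l" using that(1) by (intro mult_le_mono1) simp
    finally show ?thesis using c(2)[of "u * l + i"] rng[OF bits(1)[OF that(1)] that(2)] that(2)
      by (simp add: t_def)
  qed
  have iprod: "\<langle>xs, ys\<rangle> = (\<Sum>i<m. xs ! i * ys ! i)" if "length xs = m" "length ys = m" for xs ys :: "int list" and m
    using that by (simp add: iprod_def sum_list_sum_nth atLeast0LessThan)
  have tdot: "int (tdot l ?E c u v) = \<langle>\<phi> (bits u), \<phi> (bits v)\<rangle>" if "u < 2 ^ ?w" "v < 2 ^ ?w" for u v
    unfolding tdot_def using that by (simp add: digit iprod[OF len len] bits)
  have bitdisj: "bitdisj ?w u v \<longleftrightarrow> int (tdot l ?E c u v) \<in> V" if "u < 2 ^ ?w" "v < 2 ^ ?w" for u v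
  proof -
    have "bitdisj ?w u v \<longleftrightarrow> \<langle>bits u, bits v\<rangle> = 0"
      using bitdisj_pack[OF bits(1)[OF that(1)] bits(1)[OF that(2)]] bits(2) that by simp
    also have "\<dots> \<longleftrightarrow> \<langle>\<phi> (bits u), \<phi> (bits v)\<rangle> \<in> V"
      using red bits(1) that unfolding is_reduction_def by blast
    finally show ?thesis using tdot[OF that] by simp
  qed
  have "valid l ?w ?E c"
    unfolding valid_def in_V0_def
  proof (intro allI impI notI, elim exE conjE)
    fix u v u' v'
    assume "u < 2 ^ ?w" "v < 2 ^ ?w" "\<not> bitdisj ?w u v" "u' < 2 ^ ?w" "v' < 2 ^ ?w" "bitdisj ?w u' v'"
      "tdot l ?E c u' v' = tdot l ?E c u v"
    then show False using bitdisj[of u v] bitdisj[of u' v'] by simp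
  qed
  with c(1) show ?thesis by blast
qed

lemma min_base:
  assumes "is_reduction a l \<kappa> \<phi> V" "0 < l"
  shows "min_base l (a * l) \<le> l ^ (\<kappa> * a)"
    and "\<exists>c<min_base l (a * l) ^ (2 ^ (a * l) * l). valid l (a * l) (min_base l (a * l)) c"
proof -
  define P where "P E \<longleftrightarrow> (\<exists>c<E ^ (2 ^ (a * l) * l). valid l (a * l) E c)" for E
  have P: "P (l ^ (\<kappa> * a))" using ex_valid[OF assms] by (simp only: P_def)
  have opt: "min_base l (a * l) = (LEAST E. P E)" by (simp only: min_base_def P_def)
  show "min_base l (a * l) \<le> l ^ (\<kappa> * a)" unfolding opt by (rule Least_le) (rule P)
  have "P (min_base l (a * l))" unfolding opt by (rule LeastI) (rule P)
  then show "\<exists>c<min_base l (a * l) ^ (2 ^ (a * l) * l). valid l (a * l) (min_base l (a * l)) c"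
    by (simp only: P_def)
qed

lemma min_table:
  assumes "is_reduction a l \<kappa> \<phi> V" "0 < l"
  shows "min_table l (a * l) < min_base l (a * l) ^ (2 ^ (a * l) * l)"
    and "valid l (a * l) (min_base l (a * l)) (min_table l (a * l))"
proof -
  obtain c where c: "c < min_base l (a * l) ^ (2 ^ (a * l) * l)" "valid l (a * l) (min_base l (a * l)) c"
    using min_base(2)[OF assms] by blast
  show "valid l (a * l) (min_base l (a * l)) (min_table l (a * l))"
    unfolding min_table_def by (rule LeastI, rule c(2))
  have "min_table l (a * l) \<le> c" unfolding min_table_def by (rule Least_le, rule c(2))
  with c(1) show "min_table l (a * l) < min_base l (a * l) ^ (2 ^ (a * l) * l)" by simp
qed

lemma min_base_pos:
  assumes "is_reduction a l \<kappa> \<phi> V" "0 < l"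
  shows "0 < min_base l (a * l)"
  using min_base(2)[OF assms] assms(2) by (cases "min_base l (a * l) = 0") (auto simp: zero_power)

lemma in_V0_iff_bitdisj:
  assumes "valid l w E c" "u < 2 ^ w" "v < 2 ^ w"
  shows "in_V0 l w E c (tdot l E c u v) \<longleftrightarrow> bitdisj w u v"
  using assms unfolding valid_def in_V0_def by blast

text \<open>Modulo the \<open>j\<close>-th prime the glued entries become those of block
  \<open>j\<close>. The inner product of that block is below \<open>l * E\<^sup>2\<close> and hence
  below the prime, so the residue is the integer itself.\<close>

lemma crt_tdot_mod:
  assumes "\<And>j i. j < m \<Longrightarrow> i < l \<Longrightarrow> f j i < E" "\<And>j i. j < m \<Longrightarrow> i < l \<Longrightarrow> g j i < E"
    and "l * E\<^sup>2 \<le> Q" "j < m"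
  shows "(\<Sum>i<l. crt (nprime Q) m (\<lambda>j. f j i) * crt (nprime Q) m (\<lambda>j. g j i)) mod nprime Q j = (\<Sum>i<l. f j i * g j i)"
proof (cases "l = 0")
  case False
  have "E \<le> E\<^sup>2" by (simp add: power2_eq_square)
  also have "\<dots> \<le> l * E\<^sup>2" using False by simp
  finally have EQ: "E \<le> nprime Q j" for j using assms(3) nprime_ge[of Q j] by (meson le_trans)
  have f: "crt (nprime Q) m (\<lambda>j. f j i) mod nprime Q j = f j i" if "i < l" for i
    by (rule crt_mod) (use assms that EQ less_le_trans in blast)+
  have g: "crt (nprime Q) m (\<lambda>j. g j i) mod nprime Q j = g j i" if "i < l" for i
    by (rule crt_mod) (use assms that EQ less_le_trans in blast)+
  have "(\<Sum>i<l. crt (nprime Q) m (\<lambda>j. f j i) * crt (nprime Q) m (\<lambda>j. g j i)) mod nprime Q j =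
      (\<Sum>i<l. crt (nprime Q) m (\<lambda>j. f j i) * crt (nprime Q) m (\<lambda>j. g j i) mod nprime Q j) mod nprime Q j"
    by (rule mod_sum_eq[symmetric])
  also have "(\<Sum>i<l. crt (nprime Q) m (\<lambda>j. f j i) * crt (nprime Q) m (\<lambda>j. g j i) mod nprime Q j) = (\<Sum>i<l. (f j i * g j i) mod nprime Q j)"
    by (rule sum.cong) (auto simp: f g mod_mult_eq[symmetric, of "crt _ _ _" "crt _ _ _"])
  also have "\<dots> mod nprime Q j = (\<Sum>i<l. f j i * g j i) mod nprime Q j"
    by (rule mod_sum_eq)
  also have "\<dots> = (\<Sum>i<l. f j i * g j i)"
  proof (rule mod_less)
    have "(\<Sum>i<l. f j i * g j i) < (\<Sum>i<l. E * E)"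
      using False assms by (intro sum_strict_mono mult_strict_mono') auto
    also have "\<dots> \<le> nprime Q j" using assms(3) nprime_ge[of Q j] by (simp add: power2_eq_square)
    finally show "(\<Sum>i<l. f j i * g j i) < nprime Q j" .
  qed
  finally show ?thesis .
qed (use prime_nprime prime_gt_0_nat in simp)

section \<open>Cutting a long bit vector into blocks\<close>

definition chunk :: "nat \<Rightarrow> nat \<Rightarrow> nat \<Rightarrow> nat" where
  "chunk w X c = X div 2 ^ (c * w) mod 2 ^ w"

lemma odd_chunk: "i < w \<Longrightarrow> odd (chunk w X c div 2 ^ i) \<longleftrightarrow> odd (X div 2 ^ (c * w + i))"
proof -
  assume i: "i < w"
  have "bit (take_bit w (drop_bit (c * w) X)) i \<longleftrightarrow> bit X (c * w + i)"
    using i by (simp add: bit_simps)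
  then show ?thesis by (simp add: chunk_def bit_iff_odd take_bit_eq_mod drop_bit_eq_div)
qed

lemma chunk_less: "chunk w X c < 2 ^ w"
  by (simp add: chunk_def)

text \<open>The blocks may reach beyond position \<open>n\<close>. The surplus bits of
  \<open>X\<close> and \<open>Y\<close> are zero and cannot destroy disjointness.\<close>

lemma bitdisj_chunks:
  assumes "X < 2 ^ n" "Y < 2 ^ n" "n \<le> M * w"
  shows "bitdisj n X Y \<longleftrightarrow> (\<forall>c<M. bitdisj w (chunk w X c) (chunk w Y c))"
proof
  assume *: "bitdisj n X Y"
  have big: "\<not> odd (X div 2 ^ i)" if "n \<le> i" for i
  proof -
    have "X < 2 ^ i" using assms(1) that by (meson less_le_trans one_le_numeral power_increasing)
    then show ?thesis by simp
  qed
  show "\<forall>c<M. bitdisj w (chunk w X c) (chunk w Y c)"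
    using * big by (auto simp: bitdisj_def odd_chunk) (meson not_le)
next
  assume *: "\<forall>c<M. bitdisj w (chunk w X c) (chunk w Y c)"
  show "bitdisj n X Y"
    unfolding bitdisj_def
  proof (intro allI impI)
    fix i assume "i < n"
    then have i: "i < M * w" using assms(3) by simp
    then have "0 < w" by (cases w) auto
    then have "i div w < M" "i mod w < w" using i by (auto simp: div_less_iff_less_mult)
    then show "\<not> (odd (X div 2 ^ i) \<and> odd (Y div 2 ^ i))"
      using * odd_chunk[of "i mod w" w _ "i div w"] unfolding bitdisj_def by auto
  qed
qed

section \<open>Three levels of Chinese remaindering\<close>

text \<open>
  Level \<open>i\<close> maps blocks of bits to vectors with entries below \<open>e\<^sub>i\<close>, whose inner products are below
  \<open>q\<^sub>i\<close>.  Level \<open>i + 1\<close> combines \<open>m\<^sub>i\<^sub>+\<^sub>1\<close> such blocks modulo primes that are at least \<open>q\<^sub>i\<close>.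
  As \<open>e\<^sub>1 \<ge> log b\<close> and \<open>e\<^sub>2 \<ge> b\<close>, the primes of levels 2 and 3 are bounded by a polynomial in \<open>q\<^sub>i\<close>,
  so the bit length of \<open>e\<^sub>i\<close> stays proportional to the block length.
\<close>

definition nprimes :: "nat \<Rightarrow> nat \<Rightarrow> nat" where
  "nprimes Q T = (LEAST m. T \<le> nprod (nprime Q) m)"

text \<open>With \<open>n = flog (flog b)\<close>, a block of \<open>bwidth b l\<close> bits has
  about \<open>n / 2\<close> bits, so a table has roughly 2^(n/2) rows, the square root of log b.
  This leaves room for the polynomial factors of the search. The successor keeps blocks
  nonempty.\<close>

definition bsize :: "nat \<Rightarrow> nat \<Rightarrow> nat" where
  "bsize b l = Suc (flog (flog b) div (2 * l))"

definition bwidth :: "nat \<Rightarrow> nat \<Rightarrow> nat" where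
  "bwidth b l = bsize b l * l"

definition e0 :: "nat \<Rightarrow> nat \<Rightarrow> nat" where
  "e0 b l = min_base l (bwidth b l)"

definition c0 :: "nat \<Rightarrow> nat \<Rightarrow> nat" where
  "c0 b l = min_table l (bwidth b l)"

definition q0 :: "nat \<Rightarrow> nat \<Rightarrow> nat" where
  "q0 b l = l * (e0 b l)\<^sup>2"

definition m1 :: "nat \<Rightarrow> nat \<Rightarrow> nat" where
  "m1 b l = nprimes (q0 b l) (flog b)"

definition e1 :: "nat \<Rightarrow> nat \<Rightarrow> nat" where
  "e1 b l = nprod (nprime (q0 b l)) (m1 b l)"

definition q1 :: "nat \<Rightarrow> nat \<Rightarrow> nat" where
  "q1 b l = l * (e1 b l)\<^sup>2"

definition m2 :: "nat \<Rightarrow> nat \<Rightarrow> nat" where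
  "m2 b l = nprimes (q1 b l) b"

definition e2 :: "nat \<Rightarrow> nat \<Rightarrow> nat" where
  "e2 b l = nprod (nprime (q1 b l)) (m2 b l)"

definition q2 :: "nat \<Rightarrow> nat \<Rightarrow> nat" where
  "q2 b l = l * (e2 b l)\<^sup>2"

definition m3 :: "nat \<Rightarrow> nat \<Rightarrow> nat" where
  "m3 b l = (LEAST m. b \<le> bsize b l * m1 b l * m2 b l * m)"

definition e3 :: "nat \<Rightarrow> nat \<Rightarrow> nat" where
  "e3 b l = nprod (nprime (q2 b l)) (m3 b l)"

definition phi1 :: "nat \<Rightarrow> nat \<Rightarrow> nat \<Rightarrow> nat \<Rightarrow> nat \<Rightarrow> nat" where
  "phi1 b l X g i = crt (nprime (q0 b l)) (m1 b l)
     (\<lambda>k. digit (e0 b l) (c0 b l) (chunk (bwidth b l) X (g * m1 b l + k) * l + i))"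

definition phi2 :: "nat \<Rightarrow> nat \<Rightarrow> nat \<Rightarrow> nat \<Rightarrow> nat \<Rightarrow> nat" where
  "phi2 b l X g i = crt (nprime (q1 b l)) (m2 b l) (\<lambda>j. phi1 b l X (g * m2 b l + j) i)"

definition phi3 :: "nat \<Rightarrow> nat \<Rightarrow> nat \<Rightarrow> nat \<Rightarrow> nat" where
  "phi3 b l X i = crt (nprime (q2 b l)) (m3 b l) (\<lambda>h. phi2 b l X h i)"

text \<open>Acceptance is tested on the nested residues of a value, without reference to the vectors
  that produce it, and may hold for values that no pair attains. The cut-off at the trivial bound on
  inner products makes the set finite, so that it can be listed.\<close>

definition in_V :: "nat \<Rightarrow> nat \<Rightarrow> nat \<Rightarrow> bool" where
  "in_V b l v \<longleftrightarrow> v < l * (e3 b l)\<^sup>2 \<and> (\<forall>h<m3 b l. \<forall>j<m2 b l. \<forall>k<m1 b l.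
     in_V0 l (bwidth b l) (e0 b l) (c0 b l) (v mod nprime (q2 b l) h mod nprime (q1 b l) j mod nprime (q0 b l) k))"

lemma nprod_ge_two_power: "2 ^ m \<le> nprod (nprime Q) m"
proof -
  have "(\<Prod>j<m. 2) \<le> nprod (nprime Q) m"
    unfolding nprod_def using prime_nprime prime_ge_2_nat by (intro prod_mono) auto
  then show ?thesis by simp
qed

lemma nprimes: "T \<le> nprod (nprime Q) (nprimes Q T)" "T \<le> 2 ^ n \<Longrightarrow> nprimes Q T \<le> n" "1 < T \<Longrightarrow> 0 < nprimes Q T"
  "m < nprimes Q T \<Longrightarrow> nprod (nprime Q) m < T"
proof -
  have ex: "T \<le> nprod (nprime Q) n" if "T \<le> 2 ^ n" for n
    using that nprod_ge_two_power le_trans by blast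
  have "T \<le> 2 ^ T" by (simp add: less_imp_le less_exp)
  then show 1: "T \<le> nprod (nprime Q) (nprimes Q T)"
    unfolding nprimes_def by (intro LeastI[of "\<lambda>m. T \<le> nprod (nprime Q) m"] ex)
  show "T \<le> 2 ^ n \<Longrightarrow> nprimes Q T \<le> n"
    unfolding nprimes_def by (intro Least_le ex)
  show "1 < T \<Longrightarrow> 0 < nprimes Q T"
    using 1 by (intro gr0I) (simp add: nprod_def)
  show "m < nprimes Q T \<Longrightarrow> nprod (nprime Q) m < T"
    unfolding nprimes_def using not_less_Least by fastforce
qed

text \<open>\<open>\<kappa>\<close>, \<open>\<phi>\<close> and \<open>V\<close> witness that a valid
  table with small entries exists. The maps \<open>phi1\<close>, \<open>phi2\<close>,
  \<open>phi3\<close> and the predicate \<open>in_V\<close> depend on \<open>b\<close> and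
  \<open>l\<close> alone, which makes them computable from the input.\<close>

locale params =
  fixes b l \<kappa> :: nat and \<phi> :: "int list \<Rightarrow> int list" and V :: "int set"
  assumes red: "is_reduction (bsize b l) l \<kappa> \<phi> V" and l: "2 \<le> l" and b: "4 \<le> b"
begin

lemma m1_pos: "0 < m1 b l"
proof -
  have "1 < flog b"
  proof (rule ccontr)
    assume "\<not> 1 < flog b"
    then have "flog b + 1 \<le> 2" by simp
    then have "2 ^ (flog b + 1) \<le> (2 ^ 2 :: nat)" by (intro power_increasing) auto
    then show False using flog(1)[of b] b by simp
  qed
  then show ?thesis unfolding m1_def by (rule nprimes(3))
qed

lemma m2_pos: "0 < m2 b l"
  unfolding m2_def by (rule nprimes(3)) (use b in simp)

text \<open>By minimality, all groups but the last cover fewer than \<open>b\<close> bits per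
  coordinate, which later limits the waste to one group.\<close>

lemma m3: "b \<le> bsize b l * m1 b l * m2 b l * m3 b l" "bsize b l * m1 b l * m2 b l * (m3 b l - 1) < b"
  "0 < m3 b l" "m3 b l \<le> b"
proof -
  let ?M = "bsize b l * m1 b l * m2 b l"
  have M: "0 < ?M" using m1_pos m2_pos by (simp add: bsize_def)
  then have ex: "b \<le> ?M * b" by simp
  show 1: "b \<le> ?M * m3 b l" unfolding m3_def by (rule LeastI[of "\<lambda>m. b \<le> ?M * m", OF ex])
  show "m3 b l \<le> b" unfolding m3_def by (rule Least_le[of "\<lambda>m. b \<le> ?M * m", OF ex])
  show 2: "0 < m3 b l" using 1 b by (cases "m3 b l") auto
  then have "\<not> b \<le> ?M * (m3 b l - 1)" unfolding m3_def by (intro not_less_Least) simp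
  then show "?M * (m3 b l - 1) < b" by simp
qed

lemma e0_pos: "0 < e0 b l"
  unfolding e0_def bwidth_def by (rule min_base_pos[OF red]) (use l in simp)

lemma valid0: "valid l (bwidth b l) (e0 b l) (c0 b l)"
  unfolding e0_def c0_def bwidth_def by (rule min_table(2)[OF red]) (use l in simp)

text \<open>Entries below \<open>E\<close> are thus proper residues for the primes of the next
  level.\<close>

lemma nprime_q_ge: "E \<le> nprime (l * E\<^sup>2) j"
proof -
  have "E \<le> E\<^sup>2" by (simp add: power2_eq_square)
  also have "\<dots> \<le> l * E\<^sup>2" using l by simp
  also have "\<dots> \<le> nprime (l * E\<^sup>2) j" by (rule nprime_ge)
  finally show ?thesis .
qed

lemma phi1_less: "phi1 b l X g i < e1 b l"
  unfolding phi1_def e1_def q0_def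
  by (rule crt_less) (rule less_le_trans[OF digit_less[OF e0_pos] nprime_q_ge])

lemma phi2_less: "phi2 b l X g i < e2 b l"
  unfolding phi2_def e2_def q1_def
  by (rule crt_less) (rule less_le_trans[OF phi1_less nprime_q_ge])

lemma phi3_less: "phi3 b l X i < e3 b l"
  unfolding phi3_def e3_def q2_def
  by (rule crt_less) (rule less_le_trans[OF phi2_less nprime_q_ge])

lemma phi1_tdot:
  assumes "k < m1 b l"
  shows "(\<Sum>i<l. phi1 b l X g i * phi1 b l Y g i) mod nprime (q0 b l) k =
    tdot l (e0 b l) (c0 b l) (chunk (bwidth b l) X (g * m1 b l + k)) (chunk (bwidth b l) Y (g * m1 b l + k))"
  unfolding phi1_def tdot_def
  by (rule crt_tdot_mod[where E = "e0 b l", OF _ _ _ assms]) (auto simp: q0_def digit_less e0_pos)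

lemma phi2_tdot:
  assumes "j < m2 b l"
  shows "(\<Sum>i<l. phi2 b l X g i * phi2 b l Y g i) mod nprime (q1 b l) j =
    (\<Sum>i<l. phi1 b l X (g * m2 b l + j) i * phi1 b l Y (g * m2 b l + j) i)"
  unfolding phi2_def
  by (rule crt_tdot_mod[where E = "e1 b l", OF _ _ _ assms]) (auto simp: q1_def phi1_less)

lemma phi3_tdot:
  assumes "h < m3 b l"
  shows "(\<Sum>i<l. phi3 b l X i * phi3 b l Y i) mod nprime (q2 b l) h =
    (\<Sum>i<l. phi2 b l X h i * phi2 b l Y h i)"
  unfolding phi3_def
  by (rule crt_tdot_mod[where E = "e2 b l", OF _ _ _ assms]) (auto simp: q2_def phi2_less)

lemma all_less_mult:
  "(\<forall>c<M * m. P c) \<longleftrightarrow> (\<forall>g<M. \<forall>k<m. P (g * m + k))" for M m :: nat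
proof
  assume *: "\<forall>c<M * m. P c"
  show "\<forall>g<M. \<forall>k<m. P (g * m + k)"
  proof (intro allI impI)
    fix g k assume "g < M" "k < m"
    then have "g * m + k < (g + 1) * m" by simp
    also have "\<dots> \<le> M * m" using \<open>g < M\<close> by (intro mult_le_mono1) simp
    finally show "P (g * m + k)" using * by blast
  qed
next
  assume *: "\<forall>g<M. \<forall>k<m. P (g * m + k)"
  show "\<forall>c<M * m. P c"
  proof (intro allI impI)
    fix c assume c: "c < M * m"
    then have "0 < m" by (cases m) auto
    then have "c div m < M" "c mod m < m" using c by (auto simp: div_less_iff_less_mult)
    then have "P (c div m * m + c mod m)" using * by blast
    then show "P c" by simp
  qed
qed

lemma in_V_iff:
  assumes "X < 2 ^ (b * l)" "Y < 2 ^ (b * l)"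
  shows "in_V b l (\<Sum>i<l. phi3 b l X i * phi3 b l Y i) \<longleftrightarrow> bitdisj (b * l) X Y"
proof -
  let ?D = "\<Sum>i<l. phi3 b l X i * phi3 b l Y i"
  let ?w = "bwidth b l"
  have "?D < (\<Sum>i<l. e3 b l * e3 b l)"
    using phi3_less l by (intro sum_strict_mono mult_strict_mono') (auto simp: lessThan_empty_iff)
  then have less: "?D < l * (e3 b l)\<^sup>2" by (simp add: power2_eq_square)
  let ?bitdisj = "\<lambda>c. bitdisj ?w (chunk ?w X c) (chunk ?w Y c)"
  \<comment> \<open>Three residues undo the three levels;
    \<open>(h * m2 b l + j) * m1 b l + k\<close> is the mixed-radix number of the block that is
    reached.\<close>
  have "in_V0 l ?w (e0 b l) (c0 b l) (?D mod nprime (q2 b l) h mod nprime (q1 b l) j mod nprime (q0 b l) k)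
      \<longleftrightarrow> ?bitdisj ((h * m2 b l + j) * m1 b l + k)"
    if "h < m3 b l" "j < m2 b l" "k < m1 b l" for h j k
    unfolding phi3_tdot[OF that(1)] phi2_tdot[OF that(2)] phi1_tdot[OF that(3)]
    by (rule in_V0_iff_bitdisj[OF valid0 chunk_less chunk_less])
  then have "in_V b l ?D \<longleftrightarrow> (\<forall>h<m3 b l. \<forall>j<m2 b l. \<forall>k<m1 b l. ?bitdisj ((h * m2 b l + j) * m1 b l + k))"
    using less by (auto simp: in_V_def)
  also have "\<dots> \<longleftrightarrow> (\<forall>c<m3 b l * m2 b l * m1 b l. ?bitdisj c)"
    by (simp only: all_less_mult)
  also have "\<dots> \<longleftrightarrow> bitdisj (b * l) X Y"
  proof (rule bitdisj_chunks[symmetric, OF assms])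
    have "b * l \<le> bsize b l * m1 b l * m2 b l * m3 b l * l" by (rule mult_le_mono1[OF m3(1)])
    then show "b * l \<le> m3 b l * m2 b l * m1 b l * ?w" by (simp add: bwidth_def mult_ac)
  qed
  finally show ?thesis .
qed

lemma is_reduction_phi3:
  assumes "e3 b l \<le> l ^ (\<kappa>' * b)"
  shows "is_reduction b l \<kappa>' (\<lambda>x. map (\<lambda>i. int (phi3 b l (pack x) i)) [0..<l]) (int ` {v. in_V b l v})"
  unfolding is_reduction_def
proof (intro conjI ballI allI impI)
  fix x y assume x: "x \<in> bitvecs (b * l)" and y: "y \<in> bitvecs (b * l)"
  have "\<langle>map (\<lambda>i. int (phi3 b l (pack x) i)) [0..<l], map (\<lambda>i. int (phi3 b l (pack y) i)) [0..<l]\<rangle> =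
      int (\<Sum>i<l. phi3 b l (pack x) i * phi3 b l (pack y) i)"
    by (simp add: iprod_def sum_list_sum_nth atLeast0LessThan)
  then show "\<langle>x, y\<rangle> = 0 \<longleftrightarrow> \<langle>map (\<lambda>i. int (phi3 b l (pack x) i)) [0..<l],
      map (\<lambda>i. int (phi3 b l (pack y) i)) [0..<l]\<rangle> \<in> int ` {v. in_V b l v}"
    using in_V_iff[OF pack_less[OF x] pack_less[OF y]] bitdisj_pack[OF x y]
    by (simp add: inj_image_mem_iff del: of_nat_sum of_nat_mult)
next
  fix x i assume "i < l"
  have "phi3 b l (pack x) i < l ^ (\<kappa>' * b)" using phi3_less assms less_le_trans by blast
  then show "map (\<lambda>i. int (phi3 b l (pack x) i)) [0..<l] ! i < int l ^ (\<kappa>' * b)"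
    using \<open>i < l\<close> by (simp flip: of_nat_power)
qed simp_all

text \<open>Bookkeeping in exponents of \<open>l\<close>, which is at least 2:
  \<open>l * E\<^sup>2\<close> has exponent at most \<open>3 * T\<close>, the sum in
  \<open>nprime_le\<close> at most \<open>3 * T + 2\<close>, its square twice that, and the factor
  16 adds 4. The total \<open>6 * T + 8\<close> is at most \<open>14 * T\<close>, so each level
  costs a factor 14.\<close>

lemma nprime_q_le:
  assumes "E \<le> l ^ T" "1 \<le> T" "j \<le> l ^ (3 * T)"
  shows "nprime (l * E\<^sup>2) j \<le> l ^ (14 * T)"
proof -
  have l1: "1 \<le> l" using l by simp
  have mono: "l ^ x \<le> l ^ y" if "x \<le> y" for x y using that l1 by (rule power_increasing)
  have "l * E\<^sup>2 \<le> l * (l ^ T)\<^sup>2" using assms(1) by (intro mult_le_mono2 power_mono) auto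
  also have "\<dots> = l ^ (2 * T + 1)" by (simp add: power_mult[symmetric] mult.commute)
  also have "\<dots> \<le> l ^ (3 * T)" using assms(2) by (intro mono) simp
  finally have "l * E\<^sup>2 + j + 1 \<le> 4 * l ^ (3 * T)" using assms(3) l1 one_le_power[OF l1, of "3 * T"] by linarith
  also have "\<dots> \<le> l ^ 2 * l ^ (3 * T)"
    using power_mono[OF l, of 2] by (intro mult_le_mono1) simp
  finally have "(l * E\<^sup>2 + j + 1)\<^sup>2 \<le> (l ^ 2 * l ^ (3 * T))\<^sup>2" by (intro power_mono) auto
  moreover have "16 \<le> l ^ 4" using power_mono[OF l, of 4] by simp
  ultimately have "16 * (l * E\<^sup>2 + j + 1)\<^sup>2 \<le> l ^ 4 * (l ^ 2 * l ^ (3 * T))\<^sup>2" by (rule mult_le_mono[rotated])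
  also have "\<dots> = l ^ (4 + (2 + 3 * T) * 2)"
    by (simp only: power_add[symmetric] power_mult[symmetric])
  also have "\<dots> \<le> l ^ (14 * T)" using assms(2) by (intro mono) simp
  finally show ?thesis using nprime_le[of "l * E\<^sup>2" j] by (meson le_trans)
qed

lemma nprod_le:
  assumes "\<And>j. j < m \<Longrightarrow> nprime Q j \<le> x"
  shows "nprod (nprime Q) m \<le> x ^ m"
proof -
  have "nprod (nprime Q) m \<le> (\<Prod>j<m. x)" unfolding nprod_def using assms by (intro prod_mono) auto
  then show ?thesis by simp
qed

text \<open>By minimality of \<open>nprimes\<close>, the product without its last prime is still
  below \<open>T\<close>.\<close>

lemma nprod_nprimes_le:
  assumes "\<And>j. j < nprimes Q T \<Longrightarrow> nprime Q j \<le> x" and "1 \<le> T" "1 \<le> x"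
  shows "nprod (nprime Q) (nprimes Q T) \<le> T * x"
proof (cases "nprimes Q T")
  case 0
  then show ?thesis using assms(2,3) by (simp add: nprod_def)
next
  case (Suc m)
  have "nprod (nprime Q) (Suc m) \<le> T * x"
    unfolding nprod_Suc using nprimes(4)[of m Q T] assms(1)[of m] Suc by (intro mult_le_mono) auto
  then show ?thesis by (simp only: Suc)
qed

lemma e0_le: "e0 b l \<le> l ^ (\<kappa> * bsize b l)"
  unfolding e0_def bwidth_def by (rule min_base(1)[OF red]) (use l in simp)

lemma m2_le: "m2 b l \<le> flog b + 1"
  unfolding m2_def by (rule nprimes(2)) (use flog(1)[of b] in simp)

lemma m1_le: "m1 b l \<le> flog (flog b) + 1"
  unfolding m1_def by (rule nprimes(2)) (use flog(1)[of "flog b"] in simp)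

lemma one_le_l: "1 \<le> l"
  using l by simp

context
  assumes \<kappa>: "1 \<le> \<kappa>" and m1_small: "m1 b l \<le> l ^ bsize b l"
begin

lemma t_ge_1: "1 \<le> \<kappa> * bsize b l" "1 \<le> 14 * (\<kappa> * bsize b l) * m1 b l"
  "1 \<le> 14 * (14 * (\<kappa> * bsize b l) * m1 b l) * m2 b l"
  using \<kappa> m1_pos m2_pos by (auto simp: bsize_def)

text \<open>On the higher levels the entries of the level below bound the number of primes; at the
  bottom the assumption \<open>m1_small\<close> takes over this role.\<close>

lemma nprime_q0_le:
  assumes "j \<le> m1 b l"
  shows "nprime (q0 b l) j \<le> l ^ (14 * (\<kappa> * bsize b l))"
  unfolding q0_def
proof (rule nprime_q_le[OF e0_le t_ge_1(1)])
  have "bsize b l \<le> 3 * (\<kappa> * bsize b l)" using \<kappa> by simp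
  then have "l ^ bsize b l \<le> l ^ (3 * (\<kappa> * bsize b l))" using one_le_l by (rule power_increasing)
  then show "j \<le> l ^ (3 * (\<kappa> * bsize b l))" using assms m1_small by linarith
qed

lemma e1_le: "e1 b l \<le> l ^ (14 * (\<kappa> * bsize b l) * m1 b l)"
proof -
  have "nprod (nprime (q0 b l)) (m1 b l) \<le> (l ^ (14 * (\<kappa> * bsize b l))) ^ m1 b l"
    by (rule nprod_le) (rule nprime_q0_le, simp)
  then show ?thesis by (simp only: e1_def power_mult)
qed

text \<open>The stopping rule of the first level gives \<open>flog b \<le> e1 b l\<close>, and
  \<open>m2 b l\<close> is at most \<open>flog b + 1\<close>, so the entries bound the number of
  primes. One level up, \<open>b \<le> e2 b l\<close> and \<open>m3 b l \<le> b\<close> play the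
  same parts.\<close>

lemma nprime_q1_le:
  assumes "j \<le> m2 b l"
  shows "nprime (q1 b l) j \<le> l ^ (14 * (14 * (\<kappa> * bsize b l) * m1 b l))"
  unfolding q1_def
proof (rule nprime_q_le[OF e1_le t_ge_1(2)])
  let ?T = "14 * (\<kappa> * bsize b l) * m1 b l"
  have "flog b \<le> e1 b l" unfolding e1_def m1_def by (rule nprimes(1))
  then have "j \<le> l ^ ?T + 1" using assms m2_le e1_le by linarith
  also have "\<dots> \<le> 2 * l ^ ?T" using one_le_power[OF one_le_l, of ?T] by linarith
  also have "\<dots> \<le> l ^ Suc ?T" using l by simp
  also have "\<dots> \<le> l ^ (3 * ?T)" using t_ge_1(2) by (intro power_increasing one_le_l) linarith
  finally show "j \<le> l ^ (3 * ?T)" .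
qed

lemma e2_le: "e2 b l \<le> l ^ (14 * (14 * (\<kappa> * bsize b l) * m1 b l) * m2 b l)"
proof -
  have "nprod (nprime (q1 b l)) (m2 b l) \<le> (l ^ (14 * (14 * (\<kappa> * bsize b l) * m1 b l))) ^ m2 b l"
    by (rule nprod_le) (rule nprime_q1_le, simp)
  then show ?thesis by (simp only: e2_def power_mult)
qed

lemma nprime_q2_le:
  assumes "j \<le> m3 b l"
  shows "nprime (q2 b l) j \<le> l ^ (14 * (14 * (14 * (\<kappa> * bsize b l) * m1 b l) * m2 b l))"
  unfolding q2_def
proof (rule nprime_q_le[OF e2_le t_ge_1(3)])
  let ?T = "14 * (14 * (\<kappa> * bsize b l) * m1 b l) * m2 b l"
  have "b \<le> e2 b l" unfolding e2_def m2_def by (rule nprimes(1))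
  then have "j \<le> l ^ ?T" using assms m3(4) e2_le by linarith
  also have "\<dots> \<le> l ^ (3 * ?T)" by (intro power_increasing one_le_l) simp
  finally show "j \<le> l ^ (3 * ?T)" .
qed

text \<open>5488 is 2 * 14^3: a factor 14 for each level, and a factor 2 because the last group may
  overshoot \<open>b\<close>, though never up to \<open>2 * b\<close>.\<close>

lemma e3_le:
  assumes "bsize b l * m1 b l * m2 b l \<le> b"
  shows "e3 b l \<le> l ^ (5488 * \<kappa> * b)"
proof -
  let ?M = "bsize b l * m1 b l * m2 b l"
  have "nprod (nprime (q2 b l)) (m3 b l) \<le> (l ^ (14 * (14 * (14 * (\<kappa> * bsize b l) * m1 b l) * m2 b l))) ^ m3 b l"
    by (rule nprod_le) (rule nprime_q2_le, simp)
  then have "e3 b l \<le> l ^ (14 * (14 * (14 * (\<kappa> * bsize b l) * m1 b l) * m2 b l) * m3 b l)"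
    by (simp only: e3_def power_mult)
  also have "14 * (14 * (14 * (\<kappa> * bsize b l) * m1 b l) * m2 b l) * m3 b l = 2744 * \<kappa> * (?M * m3 b l)"
    by (simp add: algebra_simps)
  also have "?M * m3 b l = ?M * (m3 b l - 1) + ?M"
    using m3(3) by (cases "m3 b l") (auto simp: algebra_simps)
  also have "l ^ (2744 * \<kappa> * (?M * (m3 b l - 1) + ?M)) \<le> l ^ (5488 * \<kappa> * b)"
  proof (rule power_increasing[OF _ one_le_l])
    have "2744 * \<kappa> * (?M * (m3 b l - 1) + ?M) \<le> 2744 * \<kappa> * (2 * b)"
      using m3(2) assms by (intro mult_le_mono2) linarith
    then show "2744 * \<kappa> * (?M * (m3 b l - 1) + ?M) \<le> 5488 * \<kappa> * b" by simp
  qed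
  finally show ?thesis .
qed

end

end

section \<open>Size of the parameters\<close>

text \<open>A single bound for everything that governs running times. Counts, primes and the number
  of tables are bounded by \<open>B\<close> itself, whereas \<open>e3\<close> may have up to
  \<open>B\<close> bits. The ranges include the index after the last prime used, so that
  \<open>le_nprime\<close> turns the bound on that prime into one on the number of primes.\<close>

definition fits :: "nat \<Rightarrow> nat \<Rightarrow> nat \<Rightarrow> bool" where
  "fits b l B \<longleftrightarrow> b * l \<le> B \<and> 2 ^ bwidth b l * l \<le> B \<and> e0 b l ^ (2 ^ bwidth b l * l) \<le> B \<and>
     (\<forall>j\<le>m1 b l. nprime (q0 b l) j \<le> B) \<and> (\<forall>j\<le>m2 b l. nprime (q1 b l) j \<le> B) \<and>
     (\<forall>j\<le>m3 b l. nprime (q2 b l) j \<le> B) \<and> l * (e3 b l)\<^sup>2 < 2 ^ B \<and>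
     m1 b l * m2 b l * m3 b l * bwidth b l \<le> B"

lemma fits_mono: "fits b l B \<Longrightarrow> B \<le> B' \<Longrightarrow> fits b l B'"
proof -
  assume "fits b l B" "B \<le> B'"
  moreover from this(2) have "(2::nat) ^ B \<le> 2 ^ B'" by (intro power_increasing) auto
  ultimately show "fits b l B'" unfolding fits_def by (auto intro: order_trans less_le_trans)
qed

text \<open>A crude sum of all quantities; it serves the finitely many small \<open>b\<close> at
  which the asymptotic estimates say nothing.\<close>

lemma fits_ex: "\<exists>B. fits b l B"
proof -
  let ?s0 = "\<Sum>j\<le>m1 b l. nprime (q0 b l) j" and ?s1 = "\<Sum>j\<le>m2 b l. nprime (q1 b l) j"
    and ?s2 = "\<Sum>j\<le>m3 b l. nprime (q2 b l) j"
  define B where "B = b * l + 2 ^ bwidth b l * l + e0 b l ^ (2 ^ bwidth b l * l) + ?s0 + ?s1 + ?s2 +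
    l * (e3 b l)\<^sup>2 + m1 b l * m2 b l * m3 b l * bwidth b l"
  have B: "b * l \<le> B" "2 ^ bwidth b l * l \<le> B" "e0 b l ^ (2 ^ bwidth b l * l) \<le> B" "?s0 \<le> B" "?s1 \<le> B"
    "?s2 \<le> B" "l * (e3 b l)\<^sup>2 \<le> B" "m1 b l * m2 b l * m3 b l * bwidth b l \<le> B"
    unfolding B_def by linarith+
  have "nprime (q0 b l) j \<le> ?s0" if "j \<le> m1 b l" for j using that by (intro member_le_sum) auto
  then have p0: "\<forall>j\<le>m1 b l. nprime (q0 b l) j \<le> B" using B(4) le_trans by blast
  have "nprime (q1 b l) j \<le> ?s1" if "j \<le> m2 b l" for j using that by (intro member_le_sum) auto
  then have p1: "\<forall>j\<le>m2 b l. nprime (q1 b l) j \<le> B" using B(5) le_trans by blast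
  have "nprime (q2 b l) j \<le> ?s2" if "j \<le> m3 b l" for j using that by (intro member_le_sum) auto
  then have p2: "\<forall>j\<le>m3 b l. nprime (q2 b l) j \<le> B" using B(6) le_trans by blast
  have "l * (e3 b l)\<^sup>2 < 2 ^ B" using B(7) less_exp[of B] by linarith
  then have "fits b l B" unfolding fits_def using B(1,2,3,8) p0 p1 p2 by (intro conjI)
  then show ?thesis by blast
qed

text \<open>With \<open>?k = n div 12\<close>, the five factors \<open>n + 2\<close> and the
  constant together are at most \<open>(?k + 1) ^ 6\<close> once \<open>?k\<close> has reached
  \<open>K * 13 ^ 5\<close>. Then \<open>?k + 1 \<le> 2 ^ ?k\<close> bounds this by
  \<open>2 ^ (6 * ?k)\<close>, which fits into the half of the exponent that is left.\<close>

lemma ex_exp_dominates: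
  "\<exists>n0. \<forall>n\<ge>n0. K * (n + 2) ^ 5 * 2 ^ (n div 2) \<le> 2 ^ n"
proof (intro exI allI impI)
  fix n assume n: "12 * (K * 13 ^ 5) \<le> n"
  let ?k = "n div 12"
  have "n + 2 \<le> 13 * (k + 1)" if "12 * k + r = n" "r < 12" for k r :: nat using that by presburger
  from this[OF mult_div_mod_eq] have "n + 2 \<le> 13 * (?k + 1)" by simp
  then have "K * (n + 2) ^ 5 \<le> K * (13 * (?k + 1)) ^ 5" by (intro mult_le_mono2 power_mono) auto
  also have "\<dots> = K * 13 ^ 5 * (?k + 1) ^ 5" by (simp only: power_mult_distrib mult.assoc)
  also have "\<dots> \<le> (?k + 1) * (?k + 1) ^ 5" using n by (intro mult_le_mono1) linarith
  also have "\<dots> = (?k + 1) ^ Suc 5" by (rule power_Suc[symmetric])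
  also have "\<dots> \<le> (2 ^ ?k) ^ Suc 5"
    using less_exp[of ?k] by (intro power_mono) (auto simp: Suc_le_eq)
  also have "\<dots> = 2 ^ (6 * ?k)" by (simp only: power_mult[symmetric]) (simp add: mult.commute)
  finally have "K * (n + 2) ^ 5 * 2 ^ (n div 2) \<le> 2 ^ (6 * ?k) * 2 ^ (n div 2)" by (rule mult_le_mono1)
  also have "\<dots> = 2 ^ (6 * ?k + n div 2)" by (simp add: power_add)
  also have "\<dots> \<le> 2 ^ n" by (intro power_increasing) auto
  finally show "K * (n + 2) ^ 5 * 2 ^ (n div 2) \<le> 2 ^ n" .
qed

lemma square_le_exp: "7 \<le> n \<Longrightarrow> 2 * n * n + 1 \<le> (2::nat) ^ n"
proof (induction n rule: dec_induct)
  case (step n)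
  have "7 * n \<le> n * n" using step(1) by (rule mult_le_mono1)
  then have "4 * n + 3 \<le> 2 * (n * n) + 2" using step(1) by linarith
  then have "2 * Suc n * Suc n + 1 \<le> 2 * (2 * n * n + 1)" by simp
  also have "\<dots> \<le> 2 * 2 ^ n" by (intro mult_le_mono2 step.IH)
  finally show ?case by simp
qed simp

lemma cube_le_exp: "11 \<le> n \<Longrightarrow> (n + 1) ^ 3 \<le> (2::nat) ^ n"
proof (induction n rule: dec_induct)
  case (step n)
  have 1: "11 * n \<le> n * n" using step(1) by (rule mult_le_mono1)
  have 2: "11 * (n * n) \<le> n * (n * n)" using step(1) by (rule mult_le_mono1)
  have 3: "6 + 6 * n \<le> n * (n * n)" using 1 2 step(1) by linarith
  have "(Suc n + 1) ^ 3 = n * n * n + 6 * (n * n) + 12 * n + 8"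
    by (simp add: power3_eq_cube algebra_simps)
  also have "\<dots> \<le> 2 * (n * n * n + 3 * (n * n) + 3 * n + 1)"
    using 3 by (simp add: mult.assoc)
  also have "\<dots> = 2 * (n + 1) ^ 3" by (simp add: power3_eq_cube algebra_simps)
  also have "\<dots> \<le> 2 * 2 ^ n" by (intro mult_le_mono2 step.IH)
  finally show ?case by simp
qed simp

lemma flog_ge: "2 ^ k \<le> n \<Longrightarrow> k \<le> flog n"
proof (rule ccontr)
  assume "2 ^ k \<le> n" "\<not> k \<le> flog n"
  then have "(2::nat) ^ (flog n + 1) \<le> 2 ^ k" by (intro power_increasing) auto
  then show False using flog(1)[of n] \<open>2 ^ k \<le> n\<close> by simp
qed

text \<open>Sizes are compared through exponents of 2: \<open>2 ^ x\<close> is at most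
  \<open>b\<close> for \<open>x\<close> up to \<open>196 * A * (n + 2) ^ 5 * 2 ^ (n div 2)\<close>,
  because \<open>2 ^ n \<le> flog b\<close>. The critical quantity is the number of tables, with
  \<open>n * (\<kappa> * bsize b l)\<close> bits per entry. The factor 196 = 14^2 comes from the
  primes of the second level.\<close>

lemma (in params) large_b_bounds:
  fixes A :: nat
  defines "n \<equiv> flog (flog b)"
  assumes \<kappa>: "1 \<le> \<kappa>" "\<kappa> \<le> A * (bsize b l + 1)" and ln: "2 ^ l \<le> n" and n: "127 \<le> n"
    and big: "196 * A * (n + 2) ^ 5 * 2 ^ (n div 2) \<le> 2 ^ n"
  shows "m1 b l \<le> l ^ bsize b l" and "bsize b l * m1 b l * m2 b l \<le> b" and "fits b l (b ^ 11)"
proof -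
  define F where "F = flog b"
  have "0 < F" using n by (intro gr0I) (auto simp: n_def F_def flog_def)
  then have nF: "2 ^ n \<le> F" unfolding n_def F_def by (rule flog(2))
  have Fb: "2 ^ F \<le> b" unfolding F_def by (rule flog(2)) (use b in simp)
  have "n < F" using less_exp[of n] nF by (rule less_le_trans)
  then have F: "11 \<le> F" "n + 1 \<le> F" using n by auto
  have F3b: "(F + 1) ^ 3 \<le> b" using cube_le_exp[OF F(1)] Fb by (rule le_trans)
  have "F + 1 \<le> (F + 1) ^ 3" by (rule self_le_power) auto
  then have F1b: "F + 1 \<le> b" using F3b by linarith
  have lln: "l \<le> n" using less_exp[of l] ln by linarith
  have bsn: "bsize b l \<le> n + 1" by (simp add: bsize_def n_def)
  have A: "1 \<le> A" using \<kappa> by (cases A) auto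
  let ?T = "\<kappa> * bsize b l" and ?N = "2 ^ bwidth b l * l"
  have "A * (bsize b l + 1) \<le> A * (n + 2)" using bsn by (intro mult_le_mono2) simp
  then have "?T \<le> (A * (n + 2)) * (n + 2)"
    using \<kappa>(2) bsn by (intro mult_le_mono) auto
  then have T: "?T \<le> A * (n + 2) ^ 2" by (simp add: power2_eq_square algebra_simps)
  have lpow: "l ^ x \<le> 2 ^ (n * x)" for x
  proof -
    have "l \<le> 2 ^ n" using less_exp[of n] lln by linarith
    then have "l ^ x \<le> (2 ^ n) ^ x" by (rule power_mono) simp
    then show ?thesis by (simp add: power_mult)
  qed
  have big_b: "2 ^ x \<le> b" if "x \<le> 196 * A * (n + 2) ^ 5 * 2 ^ (n div 2)" for x
  proof -
    have "x \<le> F" using that big nF by linarith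
    then have "(2::nat) ^ x \<le> 2 ^ F" by (intro power_increasing) auto
    then show ?thesis using Fb by linarith
  qed
  have mono5: "c * A * (n + 2) ^ k * y \<le> 196 * A * (n + 2) ^ 5 * 2 ^ (n div 2)"
    if "c \<le> 196" "k \<le> 5" "y \<le> 2 ^ (n div 2)" for c k y
    using that by (intro mult_le_mono power_increasing) auto
  show m1: "m1 b l \<le> l ^ bsize b l"
  proof -
    \<comment> \<open>\<open>m1 b l\<close> is at most \<open>n + 1\<close>, a number of
      \<open>\<nu> + 1\<close> bits. As \<open>2 ^ l \<le> n\<close> forces
      \<open>l \<le> \<nu>\<close>, and \<open>2 * \<nu> * \<nu> \<le> n\<close>, the block size
      exceeds \<open>\<nu>\<close>. The hypothesis \<open>127 \<le> n\<close> gives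
      \<open>7 \<le> \<nu>\<close>, where \<open>square_le_exp\<close> starts.\<close>
    define \<nu> where "\<nu> = flog (n + 1)"
    have \<nu>1: "n + 1 < 2 ^ (\<nu> + 1)" "2 ^ \<nu> \<le> n + 1" unfolding \<nu>_def using flog by auto
    have "l \<le> \<nu>" unfolding \<nu>_def by (rule flog_ge) (use ln in simp)
    have "7 \<le> \<nu>" unfolding \<nu>_def by (rule flog_ge) (use n in simp)
    then have "2 * \<nu> * \<nu> + 1 \<le> n + 1" using square_le_exp[of \<nu>] \<nu>1(2) by linarith
    then have "\<nu> * (2 * \<nu>) \<le> n" by simp
    then have "\<nu> \<le> n div (2 * \<nu>)" using \<open>7 \<le> \<nu>\<close> by (subst less_eq_div_iff_mult_less_eq) auto
    also have "\<dots> \<le> n div (2 * l)" using \<open>l \<le> \<nu>\<close> l by (intro div_le_mono2) auto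
    finally have "\<nu> + 1 \<le> bsize b l" by (simp add: bsize_def n_def)
    then have "l ^ (\<nu> + 1) \<le> l ^ bsize b l" by (intro power_increasing one_le_l)
    moreover have "2 ^ (\<nu> + 1) \<le> l ^ (\<nu> + 1)" using l by (intro power_mono) auto
    ultimately show ?thesis using m1_le \<nu>1(1) unfolding n_def by linarith
  qed
  have m1F: "m1 b l \<le> F" using m1_le F(2) unfolding n_def by linarith
  have m2F: "m2 b l \<le> F + 1" using m2_le unfolding F_def .
  have "bsize b l * m1 b l * m2 b l \<le> (F + 1) * (F + 1) * (F + 1)"
    using bsn m1F m2F F(2) by (intro mult_le_mono) auto
  also have "\<dots> = (F + 1) ^ 3" by (simp only: power3_eq_cube)
  finally show "bsize b l * m1 b l * m2 b l \<le> b" using F3b by linarith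
  have "bwidth b l = l + n div (2 * l) * l" by (simp add: bwidth_def bsize_def n_def)
  also have "n div (2 * l) * l \<le> n div 2"
    by (simp add: div_mult2_eq div_times_less_eq_dividend)
  finally have "bwidth b l \<le> l + n div 2" by simp
  then have "(2::nat) ^ bwidth b l \<le> 2 ^ (l + n div 2)" by (intro power_increasing) auto
  also have "\<dots> \<le> n * 2 ^ (n div 2)" using ln by (simp add: power_add)
  finally have "?N \<le> n * 2 ^ (n div 2) * n" using lln by (intro mult_le_mono)
  also have "\<dots> \<le> (n + 2) ^ 2 * 2 ^ (n div 2)" by (simp add: power2_eq_square algebra_simps)
  finally have N: "?N \<le> (n + 2) ^ 2 * 2 ^ (n div 2)" .
  have Nb: "?N \<le> b"
  proof -
    have "1 * (n + 2) ^ 2 * 2 ^ (n div 2) \<le> 1 * A * (n + 2) ^ 2 * 2 ^ (n div 2)" using A by simp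
    then have "?N \<le> 1 * A * (n + 2) ^ 2 * 2 ^ (n div 2)" using N by linarith
    then have "2 ^ ?N \<le> b" using mono5[of 1 2 "2 ^ (n div 2)"] by (intro big_b) linarith
    then show ?thesis using less_exp[of ?N] by linarith
  qed
  have poly: "z * (A * z ^ 2) * (z ^ 2 * y) = 1 * A * z ^ 5 * y"
    "z * (14 * (A * z ^ 2)) = 14 * A * z ^ 3 * 1"
    "z * (14 * (14 * (A * z ^ 2) * z)) = 196 * A * z ^ 4 * 1" for y z :: nat
    by (simp_all add: power_numeral_reduce mult_ac)
  have e0b: "e0 b l ^ ?N \<le> b"
  proof -
    have "e0 b l \<le> 2 ^ (n * ?T)" using e0_le lpow le_trans by blast
    then have "e0 b l ^ ?N \<le> (2 ^ (n * ?T)) ^ ?N" by (rule power_mono) simp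
    also have "\<dots> = 2 ^ (n * ?T * ?N)" by (simp only: power_mult)
    also have "\<dots> \<le> b"
    proof (rule big_b)
      have "n * ?T * ?N \<le> (n + 2) * (A * (n + 2) ^ 2) * ((n + 2) ^ 2 * 2 ^ (n div 2))"
        by (rule mult_le_mono[OF mult_le_mono[OF le_add1 T] N])
      also have "\<dots> = 1 * A * (n + 2) ^ 5 * 2 ^ (n div 2)" by (rule poly(1))
      finally show "n * ?T * ?N \<le> 196 * A * (n + 2) ^ 5 * 2 ^ (n div 2)"
        by (rule le_trans) (rule mono5, simp_all)
    qed
    finally show ?thesis .
  qed
  have p0: "nprime (q0 b l) j \<le> b" if "j \<le> m1 b l" for j
  proof -
    have "nprime (q0 b l) j \<le> 2 ^ (n * (14 * ?T))"
      using nprime_q0_le[OF \<kappa>(1) m1 that] lpow le_trans by blast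
    also have "\<dots> \<le> b"
    proof (rule big_b)
      have "n * (14 * ?T) \<le> (n + 2) * (14 * (A * (n + 2) ^ 2))"
        by (rule mult_le_mono[OF le_add1 mult_le_mono2[OF T]])
      also have "\<dots> = 14 * A * (n + 2) ^ 3 * 1" by (rule poly(2))
      finally show "n * (14 * ?T) \<le> 196 * A * (n + 2) ^ 5 * 2 ^ (n div 2)"
        by (rule le_trans) (rule mono5, simp_all)
    qed
    finally show ?thesis .
  qed
  have p1: "nprime (q1 b l) j \<le> b" if "j \<le> m2 b l" for j
  proof -
    have "nprime (q1 b l) j \<le> 2 ^ (n * (14 * (14 * ?T * m1 b l)))"
      using nprime_q1_le[OF \<kappa>(1) m1 that] lpow le_trans by blast
    also have "\<dots> \<le> b"
    proof (rule big_b)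
      have m: "m1 b l \<le> n + 2" using m1_le unfolding n_def by linarith
      have "n * (14 * (14 * ?T * m1 b l)) \<le> (n + 2) * (14 * (14 * (A * (n + 2) ^ 2) * (n + 2)))"
        by (rule mult_le_mono[OF le_add1 mult_le_mono2[OF mult_le_mono[OF mult_le_mono2[OF T] m]]])
      also have "\<dots> = 196 * A * (n + 2) ^ 4 * 1" by (rule poly(3))
      finally show "n * (14 * (14 * ?T * m1 b l)) \<le> 196 * A * (n + 2) ^ 5 * 2 ^ (n div 2)"
        by (rule le_trans) (rule mono5, simp_all)
    qed
    finally show ?thesis .
  qed
  \<comment> \<open>144 is 16 * 3^2: the constant of \<open>nprime_le\<close> times the square of
    the 3 in \<open>q2 b l + j + 1 \<le> 3 * b ^ 5\<close>.\<close>
  have b144: "144 \<le> b"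
  proof -
    have "(2::nat) ^ 11 \<le> 2 ^ F" by (rule power_increasing[OF F(1)]) simp
    then show ?thesis using Fb by simp
  qed
  have bpow: "b ^ x \<le> b ^ y" if "x \<le> y" for x y
    using that b by (intro power_increasing) auto
  have lb: "l \<le> b" using lln F F1b by linarith
  \<comment> \<open>The second level stops as soon as its product reaches \<open>b\<close>, so only
    its last prime can push it further, by a factor of at most \<open>b\<close>. This yields
    \<open>q2 b l \<le> b ^ 5\<close>, primes up to 144 * b^10, and finally the exponent 11.\<close>
  have "e2 b l \<le> b * b"
    unfolding e2_def m2_def by (rule nprod_nprimes_le) (use p1 b in \<open>auto simp: m2_def\<close>)
  then have "q2 b l \<le> b * (b * b)\<^sup>2" unfolding q2_def using lb by (intro mult_le_mono power_mono) auto
  also have "\<dots> = b ^ 5" by (simp add: power_numeral_reduce mult_ac)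
  finally have q2b: "q2 b l \<le> b ^ 5" .
  have p2: "nprime (q2 b l) j \<le> b ^ 11" if "j \<le> m3 b l" for j
  proof -
    have "j \<le> b ^ 5" using that m3(4) bpow[of 1 5] by simp
    moreover have "1 \<le> b ^ 5" using b by simp
    ultimately have "q2 b l + j + 1 \<le> 3 * b ^ 5" using q2b by linarith
    then have "(q2 b l + j + 1)\<^sup>2 \<le> (3 * b ^ 5)\<^sup>2" by (rule power_mono) simp
    then have "nprime (q2 b l) j \<le> 16 * (3 * b ^ 5)\<^sup>2" using nprime_le[of "q2 b l" j] by linarith
    also have "\<dots> = 144 * b ^ 10" by (simp add: power_mult_distrib power_mult[symmetric])
    also have "\<dots> \<le> b * b ^ 10" using b144 by (rule mult_le_mono1)
    finally show ?thesis by (simp flip: power_Suc)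
  qed
  have "e3 b l \<le> (b ^ 11) ^ m3 b l" unfolding e3_def by (rule nprod_le) (simp add: p2)
  also have "\<dots> \<le> (b ^ 11) ^ b" using m3(4) b by (intro power_increasing) auto
  also have "\<dots> \<le> ((2 ^ b) ^ 11) ^ b" using less_exp[of b] by (intro power_mono) auto
  also have "\<dots> = 2 ^ (b * 11 * b)" by (simp only: power_mult)
  finally have "(e3 b l)\<^sup>2 \<le> (2 ^ (b * 11 * b))\<^sup>2" by (rule power_mono) simp
  moreover have "l \<le> 2 ^ b" using lb less_exp[of b] by linarith
  ultimately have "l * (e3 b l)\<^sup>2 \<le> 2 ^ b * (2 ^ (b * 11 * b))\<^sup>2" by (rule mult_le_mono[rotated])
  also have "\<dots> = 2 ^ (b + b * 11 * b * 2)" by (simp only: power_add power_mult)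
  also have "\<dots> < 2 ^ (b ^ 11)"
  proof (rule power_strict_increasing)
    have "b + b * 11 * b * 2 \<le> 23 * (b * b)" using b by simp
    also have "\<dots> < b * (b * b)" using b144 by (intro mult_strict_right_mono) auto
    also have "\<dots> = b ^ 3" by (simp add: power3_eq_cube)
    also have "\<dots> \<le> b ^ 11" by (rule bpow) simp
    finally show "b + b * 11 * b * 2 < b ^ 11" .
  qed simp
  finally have e3: "l * (e3 b l)\<^sup>2 < 2 ^ (b ^ 11)" .
  have b11: "b \<le> b ^ 11" using bpow[of 1 11] by simp
  have "bwidth b l \<le> 2 ^ bwidth b l" by (simp add: less_imp_le less_exp)
  also have "\<dots> \<le> ?N" using l by simp
  finally have "m1 b l * m2 b l * m3 b l * bwidth b l \<le> b * b * b * b"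
    using m1F m2F F1b m3(4) Nb by (intro mult_le_mono) auto
  also have "\<dots> = b ^ 4" by (simp add: power_numeral_reduce mult_ac)
  also have "\<dots> \<le> b ^ 11" by (rule bpow) simp
  finally have M: "m1 b l * m2 b l * m3 b l * bwidth b l \<le> b ^ 11" .
  have "b * l \<le> b ^ 2" using lb by (simp add: power2_eq_square)
  also have "\<dots> \<le> b ^ 11" by (rule bpow) simp
  finally have "b * l \<le> b ^ 11" .
  then show "fits b l (b ^ 11)"
    unfolding fits_def using e3 M p2 le_trans[OF Nb b11] le_trans[OF e0b b11]
      le_trans[OF p0 b11] le_trans[OF p1 b11] by (intro conjI allI impI)
qed

section \<open>Consequences of admissibility and of the growth hypothesis\<close>

lemma admissible_le:
  assumes "admissible b l"
  shows "2 \<le> l" and "2 ^ (2 ^ (2 ^ l)) \<le> b"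
proof -
  show l: "2 \<le> l" using assms by (simp add: admissible_def)
  define x where "x = log 2 (real b)"
  define y where "y = log 2 x"
  have ly: "real l \<le> log 2 y" using assms by (simp add: admissible_def x_def y_def)
  have "2 \<le> b"
  proof (rule ccontr)
    assume "\<not> 2 \<le> b"
    then have "b = 0 \<or> b = 1" by auto
    then have "log 2 y = 0" by (auto simp: x_def y_def log_def)
    then show False using ly l by simp
  qed
  then have x: "1 \<le> x" unfolding x_def by (simp add: le_log_iff)
  then have "0 \<le> y" unfolding y_def by simp
  \<comment> \<open>For \<open>y = 0\<close> the value \<open>log 2 y\<close> would be 0 by
    convention, which is less than \<open>l\<close>.\<close>
  moreover have "y \<noteq> 0" using ly l by (auto simp: log_def)
  ultimately have "0 < y" by simp
  then have "2 ^ l \<le> y" using ly by (simp add: le_log_iff powr_realpow)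
  then have "real (2 ^ l) \<le> log 2 x" by (simp add: y_def)
  then have "2 powr real (2 ^ l) \<le> x" using x by (subst (asm) le_log_iff) auto
  then have "real (2 ^ (2 ^ l)) \<le> log 2 (real b)"
    using powr_realpow[of 2 "2 ^ l"] by (simp add: x_def)
  then have "2 powr real (2 ^ (2 ^ l)) \<le> real b" using \<open>2 \<le> b\<close> by (subst (asm) le_log_iff) auto
  then have "real (2 ^ (2 ^ (2 ^ l))) \<le> real b" using powr_realpow[of 2 "2 ^ (2 ^ l)"] by simp
  then show "2 ^ (2 ^ (2 ^ l)) \<le> b" by (simp only: of_nat_le_iff)
qed

text \<open>For \<open>\<kappa> = 0\<close> every entry is forced to be 0. The all-zeros and the
  all-ones vector then have the same image, although only the former is orthogonal to
  itself.\<close>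

lemma is_reduction_pos:
  assumes red: "is_reduction b l \<kappa> \<phi> V" and b: "1 \<le> b" "1 \<le> l"
  shows "1 \<le> \<kappa>"
proof (rule ccontr)
  assume "\<not> 1 \<le> \<kappa>"
  then have "\<kappa> = 0" by simp
  then have zero: "\<phi> x = replicate l 0" if "x \<in> bitvecs (b * l)" for x
    using red that unfolding is_reduction_def by (intro nth_equalityI) force+
  let ?x = "replicate (b * l) (0::int)" and ?y = "replicate (b * l) (1::int)"
  have mem: "?x \<in> bitvecs (b * l)" "?y \<in> bitvecs (b * l)" by (auto simp: bitvecs_def)
  have "\<langle>?x, ?x\<rangle> = 0" by (rule iprod0_if_coeffs0) auto
  then have "\<langle>\<phi> ?x, \<phi> ?x\<rangle> \<in> V" using red mem unfolding is_reduction_def by blast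
  then have "\<langle>\<phi> ?y, \<phi> ?y\<rangle> \<in> V" using zero mem by simp
  then have "\<langle>?y, ?y\<rangle> = 0" using red mem unfolding is_reduction_def by blast
  moreover have "\<langle>replicate m (1::int), replicate m 1\<rangle> = int m" for m by (induction m) auto
  ultimately show False using b by simp
qed

lemma log2_le_self:
  fixes x :: real
  assumes "0 < x"
  shows "log 2 x \<le> x"
proof -
  have "ln x = ln (x / 2) + ln 2" using assms by (simp add: ln_div)
  also have "\<dots> \<le> x / 2 - 1 + 1"
    using ln_le_minus_one[of "x / 2"] ln_le_minus_one[of 2] assms by simp
  also have "\<dots> \<le> x * ln 2"
  proof -
    have "(exp (1 / 2 :: real))\<^sup>2 = exp 1" by (simp add: power2_eq_square flip: exp_add)
    also have "\<dots> \<le> 2\<^sup>2" using exp_le by simp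
    finally have "exp (1 / 2 :: real) \<le> 2" by (rule power2_le_imp_le) simp
    then have "1 / 2 \<le> ln (2 :: real)" by (subst ln_ge_iff) simp_all
    from mult_left_mono[OF this, of x] show ?thesis using assms by simp
  qed
  finally show ?thesis by (simp add: log_def divide_le_eq)
qed

text \<open>The growth hypothesis enters the construction in this form, applied at the small block
  size. Monotonicity takes care of the arguments below the asymptotic threshold.\<close>

lemma linear_bound:
  fixes \<tau> :: "nat \<Rightarrow> nat"
  assumes "mono \<tau>" and "(\<lambda>n. real (\<tau> n)) \<in> O(\<lambda>n. log 2 (log 2 (log 2 (real n))))"
  shows "\<exists>A. \<forall>n. \<tau> n \<le> A * (n + 1)"
proof -
  obtain c where "0 < c" "eventually (\<lambda>n. norm (real (\<tau> n)) \<le> c * norm (log 2 (log 2 (log 2 (real n))))) at_top"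
    using landau_o.bigE[OF assms(2)] by blast
  then obtain N where N: "\<And>n. N \<le> n \<Longrightarrow> real (\<tau> n) \<le> c * \<bar>log 2 (log 2 (log 2 (real n)))\<bar>"
    by (auto simp: eventually_at_top_linorder)
  let ?N = "max N 4"
  have lll: "\<bar>log 2 (log 2 (log 2 (real n)))\<bar> \<le> real n" if n: "4 \<le> n" for n
  proof -
    have "2 \<le> log 2 (real n)" using n by (simp add: le_log_iff)
    moreover from this have "1 \<le> log 2 (log 2 (real n))" by (simp add: le_log_iff)
    moreover from this have "0 \<le> log 2 (log 2 (log 2 (real n)))" by simp
    ultimately show ?thesis
      using log2_le_self[of "real n"] log2_le_self[of "log 2 (real n)"]
        log2_le_self[of "log 2 (log 2 (real n))"] n by linarith
  qed
  have "\<tau> n \<le> (nat \<lceil>c\<rceil> + \<tau> ?N) * (n + 1)" for n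
  proof (cases "?N \<le> n")
    case True
    then have "real (\<tau> n) \<le> c * real n"
      using N[of n] lll[of n] \<open>0 < c\<close> by (meson le_trans max.bounded_iff mult_left_mono less_imp_le order_trans)
    also have "\<dots> \<le> real (nat \<lceil>c\<rceil>) * real n" by (intro mult_right_mono) linarith+
    finally have "\<tau> n \<le> nat \<lceil>c\<rceil> * n" by (simp only: of_nat_mult[symmetric] of_nat_le_iff)
    also have "\<dots> \<le> (nat \<lceil>c\<rceil> + \<tau> ?N) * (n + 1)" by (intro mult_le_mono) auto
    finally show ?thesis .
  next
    case False
    have "\<tau> n \<le> \<tau> ?N" by (intro monoD[OF assms(1)]) (use False in auto)
    also have "\<dots> \<le> (nat \<lceil>c\<rceil> + \<tau> ?N) * (n + 1)" by simp
    finally show ?thesis .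
  qed
  then show ?thesis by blast
qed

lemma self_less_two_power_tower: "l < 2 ^ (2 ^ (2 ^ l))"
  using less_exp[of l] less_exp[of "2 ^ l"] less_exp[of "2 ^ (2 ^ l)"] by linarith

lemma bsize_le: "4 \<le> b \<Longrightarrow> bsize b l \<le> b"
proof -
  assume "4 \<le> b"
  then have "2 ^ flog b \<le> b" by (intro flog(2)) simp
  then have "flog b < b" using less_exp[of "flog b"] by linarith
  moreover have "flog (flog b) \<le> flog b" by (rule flog_less)
  moreover have "bsize b l \<le> Suc (flog (flog b))" by (simp add: bsize_def)
  ultimately show ?thesis by linarith
qed

lemma admissible_ge_4: "admissible b l \<Longrightarrow> 4 \<le> b"
proof -
  assume *: "admissible b l"
  have "(2::nat) ^ 2 \<le> 2 ^ (2 ^ (2 ^ l))"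
    using admissible_le(1)[OF *] less_exp[of l] less_exp[of "2 ^ l"]
    by (intro power_increasing) linarith+
  then show ?thesis using admissible_le(2)[OF *] by simp
qed

lemma family_params:
  assumes "reduction_family \<tau> \<phi> V" "admissible b l"
  shows "params b l (\<tau> (bsize b l)) (\<phi> (bsize b l) l) (V (bsize b l) l)"
  using assms admissible_le(1)[OF assms(2)] admissible_ge_4[OF assms(2)]
  by unfold_locales (auto simp: reduction_family_def)

text \<open>The constants must be uniform in \<open>b\<close> and \<open>l\<close>. Large
  \<open>b\<close> are covered by \<open>large_b_bounds\<close>; below the threshold
  \<open>b1\<close>, admissibility forces \<open>l < b\<close>, so finitely many pairs remain and
  their values are summed into \<open>R\<close> and \<open>C\<close>. A constant bound
  \<open>R\<close> is harmless because \<open>R \<le> 2 ^ R \<le> b ^ R\<close>.\<close>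

lemma family_bounds:
  assumes "mono \<tau>" and "(\<lambda>n. real (\<tau> n)) \<in> O(\<lambda>n. log 2 (log 2 (log 2 (real n))))"
    and fam: "reduction_family \<tau> \<phi> V"
  obtains R C where "1 \<le> C"
    "\<And>b l. admissible b l \<Longrightarrow> fits b l (b ^ R)"
    "\<And>b l. admissible b l \<Longrightarrow> e3 b l \<le> l ^ (C * \<tau> b * b)"
proof -
  obtain A where A: "\<And>n. \<tau> n \<le> A * (n + 1)" using linear_bound[OF assms(1,2)] by blast
  obtain n0 where n0: "\<And>n. n0 \<le> n \<Longrightarrow> 196 * A * (n + 2) ^ 5 * 2 ^ (n div 2) \<le> 2 ^ n"
    using ex_exp_dominates[of "196 * A"] by blast
  define b1 :: nat where "b1 = 2 ^ (2 ^ (max n0 127))"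
  have pos: "1 \<le> \<tau> n" if "1 \<le> n" for n
    using fam that is_reduction_pos[of n 2 "\<tau> n" "\<phi> n 2" "V n 2"] by (simp add: reduction_family_def)
  have big: "fits b l (b ^ 11)" "e3 b l \<le> l ^ (5488 * \<tau> b * b)" if adm: "admissible b l" and b1: "b1 \<le> b" for b l
  proof -
    interpret params b l "\<tau> (bsize b l)" "\<phi> (bsize b l) l" "V (bsize b l) l"
      by (rule family_params[OF fam adm])
    let ?n = "flog (flog b)"
    have n: "max n0 127 \<le> ?n" using b1 unfolding b1_def by (intro flog_ge)
    have ln: "2 ^ l \<le> ?n" using admissible_le(2)[OF adm] by (intro flog_ge)
    have k: "1 \<le> \<tau> (bsize b l)" by (rule pos) (simp add: bsize_def)
    note L = large_b_bounds[OF k A ln _ n0]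
    show "fits b l (b ^ 11)" by (rule L(3)) (use n in auto)
    have "e3 b l \<le> l ^ (5488 * \<tau> (bsize b l) * b)"
      by (rule e3_le[OF k L(1) L(2)]) (use n in auto)
    \<comment> \<open>Monotonicity of \<open>\<tau>\<close> passes from the block size to
      \<open>b\<close>.\<close>
    also have "\<dots> \<le> l ^ (5488 * \<tau> b * b)"
      using monoD[OF assms(1) bsize_le[OF admissible_ge_4[OF adm]]]
      by (intro power_increasing one_le_l mult_le_mono) auto
    finally show "e3 b l \<le> l ^ (5488 * \<tau> b * b)" .
  qed
  define B where "B b l = (SOME B. fits b l B)" for b l
  have B: "fits b l (B b l)" for b l unfolding B_def using fits_ex by (rule someI_ex)
  define R where "R = 11 + (\<Sum>(b, l) \<in> {..<b1} \<times> {..<b1}. B b l)"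
  define C where "C = 5488 + (\<Sum>(b, l) \<in> {..<b1} \<times> {..<b1}. e3 b l)"
  have lt: "l < b" if "admissible b l" for b l
    using admissible_le(2)[OF that] self_less_two_power_tower[of l] by linarith
  have small: "B b l \<le> R" "e3 b l \<le> C" if "admissible b l" "b < b1" for b l
  proof -
    have mem: "(b, l) \<in> {..<b1} \<times> {..<b1}" using that lt[OF that(1)] by auto
    have "(\<lambda>(b, l). B b l) (b, l) \<le> (\<Sum>(b, l) \<in> {..<b1} \<times> {..<b1}. B b l)"
      using mem by (intro member_le_sum) auto
    then show "B b l \<le> R" by (simp add: R_def)
    have "(\<lambda>(b, l). e3 b l) (b, l) \<le> (\<Sum>(b, l) \<in> {..<b1} \<times> {..<b1}. e3 b l)"
      using mem by (intro member_le_sum) auto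
    then show "e3 b l \<le> C" by (simp add: C_def)
  qed
  show thesis
  proof (rule that)
    show "1 \<le> C" by (simp add: C_def)
    fix b l assume adm: "admissible b l"
    have l: "2 \<le> l" and b: "4 \<le> b" using admissible_le(1)[OF adm] admissible_ge_4[OF adm] by auto
    show "fits b l (b ^ R)"
    proof (cases "b < b1")
      case True
      have "R \<le> 2 ^ R" by (simp add: less_exp less_imp_le)
      also have "(2::nat) ^ R \<le> b ^ R" using b by (intro power_mono) auto
      finally have "B b l \<le> b ^ R" using small(1)[OF adm True] by linarith
      with B show ?thesis by (rule fits_mono)
    next
      case False
      have "b ^ 11 \<le> b ^ R" using b by (intro power_increasing) (auto simp: R_def)
      with big(1)[OF adm] False show ?thesis by (auto intro: fits_mono)
    qed
    show "e3 b l \<le> l ^ (C * \<tau> b * b)"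
    proof (cases "b < b1")
      case True
      have "C \<le> 2 ^ C" by (simp add: less_exp less_imp_le)
      also have "(2::nat) ^ C \<le> l ^ C" using l by (intro power_mono) auto
      also have "\<dots> \<le> l ^ (C * \<tau> b * b)"
        using l b pos[of b] by (intro power_increasing) auto
      finally show ?thesis using small(2)[OF adm True] by linarith
    next
      case False
      have "l ^ (5488 * \<tau> b * b) \<le> l ^ (C * \<tau> b * b)"
        using l by (intro power_increasing mult_le_mono) (auto simp: C_def)
      with big(2)[OF adm] False show ?thesis by linarith
    qed
  qed
qed

section \<open>Computing the table\<close>

lemma pdec_odd: "ptime n D B f \<Longrightarrow> pdec n D B (\<lambda>e. odd (f e))"
proof -
  assume f: "ptime n D B f"
  have "pdec n D B (\<lambda>e. f e div 2 + f e div 2 < f e)"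
    by (intro pdec_less ptime_add ptime_half f)
  moreover have "x div 2 + x div 2 < x \<longleftrightarrow> odd x" for x :: nat by presburger
  ultimately show ?thesis by simp
qed

lemma ptime_two_power:
  assumes "ptime n D B f" and "\<And>e. D e \<Longrightarrow> length e = n \<Longrightarrow> f e \<le> B e + 2"
  shows "ptime n D B (\<lambda>e. 2 ^ f e)"
  using ptime_shift[OF ptime_const[where v = 1] assms] by simp

lemma ptime_flog:
  assumes f: "ptime n D B f" and fB: "\<And>e. D e \<Longrightarrow> length e = n \<Longrightarrow> f e \<le> B e"
  shows "ptime n D B (\<lambda>e. flog (f e))"
  unfolding flog_def
proof (rule ptime_Least)
  show "pdec (Suc n) (\<lambda>e. D (tl e) \<and> length e = Suc n \<and> (\<forall>y<hd e. \<not> f (tl e) < 2 ^ (y + 1)) \<and>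
     hd e \<le> B (tl e) + 2) (\<lambda>e. B (tl e)) (\<lambda>e. f (tl e) < 2 ^ (hd e + 1))"
  proof (intro pdec_less ptime_tl[OF f] ptime_two_power ptime_add ptime_hd ptime_const)
    fix e assume *: "D (tl e) \<and> length e = Suc n \<and> (\<forall>y<hd e. \<not> f (tl e) < 2 ^ (y + 1)) \<and> hd e \<le> B (tl e) + 2"
    then have "hd e \<le> flog (f (tl e))" using flog(1)[of "f (tl e)"] by (meson not_le)
    also have "\<dots> \<le> B (tl e)" using flog_less[of "f (tl e)"] fB[of "tl e"] * by simp
    finally show "hd e + 1 \<le> B (tl e) + 2" by simp
  qed auto
  fix e assume "D e" "length e = n"
  then have "flog (f e) \<le> B e + 2" using flog_less[of "f e"] fB[of e] by linarith
  then show "\<exists>x\<le>B e + 2. f e < 2 ^ (x + 1)" using flog(1) by blast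
qed

lemma ptime_digit:
  assumes E: "ptime n D B E" and c: "ptime n D B c" and i: "ptime n D B i"
    and cond: "\<And>e. D e \<Longrightarrow> length e = n \<Longrightarrow> 0 < E e \<and> E e \<le> B e \<and> c e \<le> B e \<and> i e \<le> B e"
  shows "ptime n D B (\<lambda>e. digit (E e) (c e) (i e))"
  unfolding digit_def
proof (rule ptime_mod[OF ptime_div[OF c ptime_power[OF E i]] E])
  fix e assume e: "D e" "length e = n"
  note cond[OF e]
  then show "E e \<le> B e + 2" "i e \<le> B e + 2" "0 < E e ^ i e" "0 < E e" by auto
  have "c e div E e ^ i e \<le> c e" by (rule div_le_dividend)
  with cond[OF e] show le: "c e div E e ^ i e \<le> B e" by linarith
  then show "c e div E e ^ i e < 2 ^ B e" using less_exp[of "B e"] by linarith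
qed

lemma ptime_tdot:
  assumes l: "ptime n D B l" and E: "ptime n D B E" and c: "ptime n D B c" and u: "ptime n D B u" and v: "ptime n D B v"
    and cond: "\<And>e. D e \<Longrightarrow> length e = n \<Longrightarrow> 0 < E e \<and> E e \<le> B e \<and> c e \<le> B e \<and>
      (u e + 1) * l e \<le> B e \<and> (v e + 1) * l e \<le> B e"
  shows "ptime n D B (\<lambda>e. tdot (l e) (E e) (c e) (u e) (v e))"
  unfolding tdot_def
proof (rule ptime_sum[OF l])
  show "l e \<le> B e + 2" if "D e" "length e = n" for e using cond[OF that] by simp
  show "ptime (Suc n) (\<lambda>e. D (tl e) \<and> length e = Suc n \<and> hd e < l (tl e)) (\<lambda>e. B (tl e))
     (\<lambda>e. digit (E (tl e)) (c (tl e)) (u (tl e) * l (tl e) + hd e) * digit (E (tl e)) (c (tl e)) (v (tl e) * l (tl e) + hd e))"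
  proof (intro ptime_mult ptime_digit ptime_add ptime_hd ptime_tl[OF l] ptime_tl[OF E] ptime_tl[OF c] ptime_tl[OF u] ptime_tl[OF v])
    fix e assume *: "D (tl e) \<and> length e = Suc n \<and> hd e < l (tl e)"
    then have e: "D (tl e)" "length (tl e) = n" by auto
    note C = cond[OF e]
    show "l (tl e) \<le> B (tl e) + 2" "l (tl e) \<le> B (tl e) + 2" using C by auto
    show "0 < E (tl e) \<and> E (tl e) \<le> B (tl e) \<and> c (tl e) \<le> B (tl e) \<and> u (tl e) * l (tl e) + hd e \<le> B (tl e)"
      "0 < E (tl e) \<and> E (tl e) \<le> B (tl e) \<and> c (tl e) \<le> B (tl e) \<and> v (tl e) * l (tl e) + hd e \<le> B (tl e)"
      using C * by auto
    have "digit (E (tl e)) (c (tl e)) (v (tl e) * l (tl e) + hd e) < E (tl e)" using C by (intro digit_less) auto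
    then show "digit (E (tl e)) (c (tl e)) (v (tl e) * l (tl e) + hd e) \<le> B (tl e) + 2" using C by linarith
  qed auto
qed

lemma pdec_bitdisj:
  assumes w: "ptime n D B w" and u: "ptime n D B u" and v: "ptime n D B v"
    and wB: "\<And>e. D e \<Longrightarrow> length e = n \<Longrightarrow> w e \<le> B e + 2"
  shows "pdec n D B (\<lambda>e. bitdisj (w e) (u e) (v e))"
  unfolding bitdisj_def
proof (rule pdec_all[OF w wB])
  show "pdec (Suc n) (\<lambda>e. D (tl e) \<and> length e = Suc n \<and> hd e < w (tl e)) (\<lambda>e. B (tl e))
     (\<lambda>e. \<not> (odd (u (tl e) div 2 ^ hd e) \<and> odd (v (tl e) div 2 ^ hd e)))"
    by (intro pdec_not pdec_conj pdec_odd ptime_unshift ptime_hd ptime_tl[OF u] ptime_tl[OF v])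
      (use wB in \<open>fastforce dest: order.strict_implies_order\<close>)+
qed

text \<open>Exhaustive search over all pairs of words is affordable because
  \<open>2 ^ w e * l e \<le> B e\<close>; the same bound keeps the digit positions in range.\<close>

lemma pdec_in_V0:
  assumes l: "ptime n D B l" and w: "ptime n D B w" and E: "ptime n D B E" and c: "ptime n D B c" and z: "ptime n D B z"
    and cond: "\<And>e. D e \<Longrightarrow> length e = n \<Longrightarrow> 0 < l e \<and> 2 ^ w e * l e \<le> B e \<and> 0 < E e \<and> E e \<le> B e \<and> c e \<le> B e"
  shows "pdec n D B (\<lambda>e. in_V0 (l e) (w e) (E e) (c e) (z e))"
proof -
  have c2: "2 ^ w e \<le> B e + 2" "w e \<le> B e + 2" if "D e" "length e = n" for e
  proof -
    have "2 ^ w e * 1 \<le> 2 ^ w e * l e" using cond[OF that] by (intro mult_le_mono2) simp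
    then show "2 ^ w e \<le> B e + 2" using cond[OF that] by linarith
    then show "w e \<le> B e + 2" using less_exp[of "w e"] by linarith
  qed
  have idx: "(x + 1) * l e \<le> B e" if "D e" "length e = n" "x < 2 ^ w e" for e x
  proof -
    have "(x + 1) * l e \<le> 2 ^ w e * l e" using that(3) by (intro mult_le_mono1) simp
    then show ?thesis using cond[OF that(1,2)] by linarith
  qed
  have pw: "ptime n D B (\<lambda>e. 2 ^ w e)" by (rule ptime_two_power[OF w c2(2)])
  let ?D1 = "\<lambda>e. D (tl e) \<and> length e = Suc n \<and> hd e < 2 ^ w (tl e)"
  let ?D2 = "\<lambda>e. ?D1 (tl e) \<and> length e = Suc (Suc n) \<and> hd e < 2 ^ w (tl (tl e))"
  have "pdec (Suc (Suc n)) ?D2 (\<lambda>e. B (tl (tl e))) (\<lambda>e. bitdisj (w (tl (tl e))) (hd (tl e)) (hd e) \<and>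
      tdot (l (tl (tl e))) (E (tl (tl e))) (c (tl (tl e))) (hd (tl e)) (hd e) = z (tl (tl e)))"
  proof (intro pdec_conj pdec_bitdisj pdec_eq ptime_tdot ptime_hd ptime_hd_tl ptime_tl_tl[OF l] ptime_tl_tl[OF w] ptime_tl_tl[OF E]
      ptime_tl_tl[OF c] ptime_tl_tl[OF z])
    fix e assume "?D2 e"
    then have e: "D (tl (tl e))" "length (tl (tl e)) = n" by auto
    show "w (tl (tl e)) \<le> B (tl (tl e)) + 2" using c2(2)[OF e] .
  next
    fix e assume "?D2 e \<and> bitdisj (w (tl (tl e))) (hd (tl e)) (hd e)"
    then have e: "D (tl (tl e))" "length (tl (tl e)) = n" and lt: "hd (tl e) < 2 ^ w (tl (tl e))" "hd e < 2 ^ w (tl (tl e))"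
      by auto
    show "0 < E (tl (tl e)) \<and> E (tl (tl e)) \<le> B (tl (tl e)) \<and> c (tl (tl e)) \<le> B (tl (tl e)) \<and>
      (hd (tl e) + 1) * l (tl (tl e)) \<le> B (tl (tl e)) \<and> (hd e + 1) * l (tl (tl e)) \<le> B (tl (tl e))"
      using cond[OF e] idx[OF e lt(1)] idx[OF e lt(2)] by blast
  qed auto
  then have "pdec (Suc n) ?D1 (\<lambda>e. B (tl e)) (\<lambda>e. \<exists>v<2 ^ w (tl e). bitdisj (w (tl e)) (hd e) v \<and>
      tdot (l (tl e)) (E (tl e)) (c (tl e)) (hd e) v = z (tl e))"
    by (rule pdec_ex[OF ptime_tl[OF pw], rotated 2]) (auto simp del: add_2_eq_Suc' intro: c2)
  then show ?thesis
    unfolding in_V0_def by (rule pdec_ex[OF pw, rotated]) (rule c2(1))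
qed

lemma pdec_valid:
  assumes l: "ptime n D B l" and w: "ptime n D B w" and E: "ptime n D B E" and c: "ptime n D B c"
    and cond: "\<And>e. D e \<Longrightarrow> length e = n \<Longrightarrow> 0 < l e \<and> 2 ^ w e * l e \<le> B e \<and> 0 < E e \<and> E e \<le> B e \<and> c e \<le> B e"
  shows "pdec n D B (\<lambda>e. valid (l e) (w e) (E e) (c e))"
proof -
  have c2: "2 ^ w e \<le> B e + 2" "w e \<le> B e + 2" if "D e" "length e = n" for e
  proof -
    have "2 ^ w e * 1 \<le> 2 ^ w e * l e" using cond[OF that] by (intro mult_le_mono2) simp
    then show "2 ^ w e \<le> B e + 2" using cond[OF that] by linarith
    then show "w e \<le> B e + 2" using less_exp[of "w e"] by linarith
  qed
  have idx: "(x + 1) * l e \<le> B e" if "D e" "length e = n" "x < 2 ^ w e" for e x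
  proof -
    have "(x + 1) * l e \<le> 2 ^ w e * l e" using that(3) by (intro mult_le_mono1) simp
    then show ?thesis using cond[OF that(1,2)] by linarith
  qed
  have pw: "ptime n D B (\<lambda>e. 2 ^ w e)" by (rule ptime_two_power[OF w c2(2)])
  let ?D1 = "\<lambda>e. D (tl e) \<and> length e = Suc n \<and> hd e < 2 ^ w (tl e)"
  let ?D2 = "\<lambda>e. ?D1 (tl e) \<and> length e = Suc (Suc n) \<and> hd e < 2 ^ w (tl (tl e))"
  have "pdec (Suc (Suc n)) ?D2 (\<lambda>e. B (tl (tl e))) (\<lambda>e. \<not> bitdisj (w (tl (tl e))) (hd (tl e)) (hd e) \<longrightarrow>
      \<not> in_V0 (l (tl (tl e))) (w (tl (tl e))) (E (tl (tl e))) (c (tl (tl e)))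
          (tdot (l (tl (tl e))) (E (tl (tl e))) (c (tl (tl e))) (hd (tl e)) (hd e)))"
  proof (intro pdec_imp pdec_not pdec_bitdisj pdec_in_V0 ptime_tdot ptime_hd ptime_hd_tl ptime_tl_tl[OF l] ptime_tl_tl[OF w] ptime_tl_tl[OF E]
      ptime_tl_tl[OF c])
    fix e assume "?D2 e"
    then have e: "D (tl (tl e))" "length (tl (tl e)) = n" by auto
    show "w (tl (tl e)) \<le> B (tl (tl e)) + 2" using c2(2)[OF e] .
  next
    fix e assume "?D2 e \<and> \<not> bitdisj (w (tl (tl e))) (hd (tl e)) (hd e)"
    then have e: "D (tl (tl e))" "length (tl (tl e)) = n" and lt: "hd (tl e) < 2 ^ w (tl (tl e))" "hd e < 2 ^ w (tl (tl e))"
      by auto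
    show "0 < E (tl (tl e)) \<and> E (tl (tl e)) \<le> B (tl (tl e)) \<and> c (tl (tl e)) \<le> B (tl (tl e)) \<and>
      (hd (tl e) + 1) * l (tl (tl e)) \<le> B (tl (tl e)) \<and> (hd e + 1) * l (tl (tl e)) \<le> B (tl (tl e))"
      using cond[OF e] idx[OF e lt(1)] idx[OF e lt(2)] by blast
    show "0 < l (tl (tl e)) \<and> 2 ^ w (tl (tl e)) * l (tl (tl e)) \<le> B (tl (tl e)) \<and> 0 < E (tl (tl e)) \<and>
      E (tl (tl e)) \<le> B (tl (tl e)) \<and> c (tl (tl e)) \<le> B (tl (tl e))"
      by (rule cond[OF e])
  qed auto
  then have "pdec (Suc n) ?D1 (\<lambda>e. B (tl e)) (\<lambda>e. \<forall>v<2 ^ w (tl e). \<not> bitdisj (w (tl e)) (hd e) v \<longrightarrow>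
      \<not> in_V0 (l (tl e)) (w (tl e)) (E (tl e)) (c (tl e)) (tdot (l (tl e)) (E (tl e)) (c (tl e)) (hd e) v))"
    by (rule pdec_all[OF ptime_tl[OF pw], rotated 2]) (auto simp del: add_2_eq_Suc' intro: c2)
  then show ?thesis
    unfolding valid_def by (rule pdec_all[OF pw, rotated]) (rule c2(1))
qed

text \<open>\<open>ptime_Least\<close> only tries bases up to the minimal one, so at each trial
  there are at most as many tables as at the minimal base, hence at most \<open>B e\<close>. Both
  searches stay polynomial although the minimal base is not known in advance.\<close>

lemma ptime_min_base:
  assumes l: "ptime n D B l" and w: "ptime n D B w"
    and cond: "\<And>e. D e \<Longrightarrow> length e = n \<Longrightarrow> 0 < l e \<and> 2 ^ w e * l e \<le> B e \<and>
      min_base (l e) (w e) ^ (2 ^ w e * l e) \<le> B e \<and>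
      (\<exists>c<min_base (l e) (w e) ^ (2 ^ w e * l e). valid (l e) (w e) (min_base (l e) (w e)) c)"
  shows "ptime n D B (\<lambda>e. min_base (l e) (w e))"
  unfolding min_base_def
proof (rule ptime_Least)
  have c2: "w e \<le> B e" "l e \<le> B e" if "D e" "length e = n" for e
  proof -
    have "2 ^ w e * 1 \<le> 2 ^ w e * l e" using cond[OF that] by (intro mult_le_mono2) simp
    then have "2 ^ w e \<le> B e" using cond[OF that] by linarith
    then show "w e \<le> B e" using less_exp[of "w e"] by linarith
    have "1 * l e \<le> 2 ^ w e * l e" by (intro mult_le_mono1) simp
    then show "l e \<le> B e" using cond[OF that] by linarith
  qed
  let ?D = "\<lambda>e. D (tl e) \<and> length e = Suc n \<and>
     (\<forall>y<hd e. \<not> (\<exists>c<y ^ (2 ^ w (tl e) * l (tl e)). valid (l (tl e)) (w (tl e)) y c)) \<and> hd e \<le> B (tl e) + 2"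
  have pow: "hd e ^ (2 ^ w (tl e) * l (tl e)) \<le> B (tl e)" "hd e \<le> B (tl e)" if "?D e" for e
  proof -
    have e: "D (tl e)" "length (tl e) = n" using that by auto
    have "hd e \<le> min_base (l (tl e)) (w (tl e))" using that cond[OF e] by (meson not_le)
    then have "hd e ^ (2 ^ w (tl e) * l (tl e)) \<le> min_base (l (tl e)) (w (tl e)) ^ (2 ^ w (tl e) * l (tl e))"
      by (rule power_mono) simp
    then show le: "hd e ^ (2 ^ w (tl e) * l (tl e)) \<le> B (tl e)" using cond[OF e] by linarith
    have "hd e \<le> hd e ^ (2 ^ w (tl e) * l (tl e))" using cond[OF e] by (cases "hd e") (auto intro: self_le_power)
    then show "hd e \<le> B (tl e)" using le by linarith
  qed
  show "pdec (Suc n) ?D (\<lambda>e. B (tl e))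
     (\<lambda>e. \<exists>c<hd e ^ (2 ^ w (tl e) * l (tl e)). valid (l (tl e)) (w (tl e)) (hd e) c)"
  proof (rule pdec_ex)
    show "ptime (Suc n) ?D (\<lambda>e. B (tl e)) (\<lambda>e. hd e ^ (2 ^ w (tl e) * l (tl e)))"
    proof (intro ptime_two_power ptime_power ptime_mult ptime_hd ptime_tl[OF l] ptime_tl[OF w])
      fix e assume *: "?D e"
      then have e: "D (tl e)" "length (tl e) = n" by auto
      show "w (tl e) \<le> B (tl e) + 2" "l (tl e) \<le> B (tl e) + 2" "hd e \<le> B (tl e) + 2"
        "2 ^ w (tl e) * l (tl e) \<le> B (tl e) + 2"
        using c2[OF e] pow(2)[OF *] cond[OF e] by linarith+
    qed auto
    show "hd e ^ (2 ^ w (tl e) * l (tl e)) \<le> B (tl e) + 2" if "?D e" for e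
      using pow[OF that] by linarith
    let ?D2 = "\<lambda>e. ?D (tl e) \<and> length e = Suc (Suc n) \<and> hd e < hd (tl e) ^ (2 ^ w (tl (tl e)) * l (tl (tl e)))"
    show "pdec (Suc (Suc n)) ?D2 (\<lambda>e. B (tl (tl e))) (\<lambda>e. valid (l (tl (tl e))) (w (tl (tl e))) (hd (tl e)) (hd e))"
    proof (intro pdec_valid ptime_tl_tl[OF l] ptime_tl_tl[OF w] ptime_hd ptime_hd_tl)
      fix e assume *: "?D2 e"
      then have e: "D (tl (tl e))" "length (tl (tl e)) = n" by auto
      have "0 < hd (tl e)" using * cond[OF e] by (cases "hd (tl e) = 0") (auto simp: zero_power)
      moreover have D1: "?D (tl e)" and "hd e < hd (tl e) ^ (2 ^ w (tl (tl e)) * l (tl (tl e)))"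
        using * by blast+
      ultimately show "0 < l (tl (tl e)) \<and> 2 ^ w (tl (tl e)) * l (tl (tl e)) \<le> B (tl (tl e)) \<and> 0 < hd (tl e) \<and>
          hd (tl e) \<le> B (tl (tl e)) \<and> hd e \<le> B (tl (tl e))"
        using cond[OF e] pow[OF D1] by (intro conjI; linarith)
    qed auto
  qed
  fix e assume e: "D e" "length e = n"
  let ?E = "min_base (l e) (w e)"
  have "?E \<le> ?E ^ (2 ^ w e * l e)" using cond[OF e] by (cases ?E) (auto intro: self_le_power)
  then have "?E \<le> B e + 2" using cond[OF e] by linarith
  then show "\<exists>x\<le>B e + 2. \<exists>c<x ^ (2 ^ w e * l e). valid (l e) (w e) x c" using cond[OF e] by blast
qed

lemma ptime_min_table:
  assumes l: "ptime n D B l" and w: "ptime n D B w"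
    and cond: "\<And>e. D e \<Longrightarrow> length e = n \<Longrightarrow> 0 < l e \<and> 2 ^ w e * l e \<le> B e \<and>
      min_base (l e) (w e) ^ (2 ^ w e * l e) \<le> B e \<and>
      (\<exists>c<min_base (l e) (w e) ^ (2 ^ w e * l e). valid (l e) (w e) (min_base (l e) (w e)) c)"
  shows "ptime n D B (\<lambda>e. min_table (l e) (w e))"
  unfolding min_table_def
proof (rule ptime_Least)
  let ?D = "\<lambda>e. D (tl e) \<and> length e = Suc n \<and>
     (\<forall>y<hd e. \<not> valid (l (tl e)) (w (tl e)) (min_base (l (tl e)) (w (tl e))) y) \<and> hd e \<le> B (tl e) + 2"
  show "pdec (Suc n) ?D (\<lambda>e. B (tl e)) (\<lambda>e. valid (l (tl e)) (w (tl e)) (min_base (l (tl e)) (w (tl e))) (hd e))"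
  proof (intro pdec_valid ptime_hd ptime_tl[OF l] ptime_tl[OF w] ptime_tl[OF ptime_min_base[OF l w cond]])
    fix e assume *: "?D e"
    then have e: "D (tl e)" "length (tl e) = n" by auto
    let ?E = "min_base (l (tl e)) (w (tl e))" and ?N = "2 ^ w (tl e) * l (tl e)"
    obtain c where c: "c < ?E ^ ?N" "valid (l (tl e)) (w (tl e)) ?E c" using cond[OF e] by blast
    have "hd e \<le> c" using * c(2) by (meson not_le)
    moreover have "0 < ?E" using c(1) cond[OF e] by (cases "?E = 0") (auto simp: zero_power)
    moreover from this have "?E \<le> ?E ^ ?N" using cond[OF e] by (intro self_le_power) auto
    ultimately show "0 < l (tl e) \<and> 2 ^ w (tl e) * l (tl e) \<le> B (tl e) \<and> 0 < ?E \<and> ?E \<le> B (tl e) \<and> hd e \<le> B (tl e)"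
      using cond[OF e] c(1) by (intro conjI; linarith)
  qed auto
  fix e assume e: "D e" "length e = n"
  then obtain c where c: "c < min_base (l e) (w e) ^ (2 ^ w e * l e)" "valid (l e) (w e) (min_base (l e) (w e)) c"
    using cond[OF e] by blast
  then have "c \<le> B e + 2" using cond[OF e] by linarith
  with c(2) show "\<exists>x\<le>B e + 2. valid (l e) (w e) (min_base (l e) (w e)) x" by blast
qed

lemma prime_iff_mod: "prime p \<longleftrightarrow> 2 \<le> p \<and> (\<forall>d<p. 2 \<le> d \<longrightarrow> p mod d \<noteq> 0)" for p :: nat
  unfolding prime_nat_iff' by (auto simp: mod_eq_0_iff_dvd)

section \<open>Computing with primes\<close>

text \<open>Trial division: time polynomial in the value is enough, as all primes in play are at
  most \<open>B e\<close>.\<close>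

lemma pdec_prime:
  assumes f: "ptime n D B f" and fB: "\<And>e. D e \<Longrightarrow> length e = n \<Longrightarrow> f e \<le> B e + 2"
    and less: "\<And>e. D e \<Longrightarrow> length e = n \<Longrightarrow> f e < 2 ^ B e"
  shows "pdec n D B (\<lambda>e. prime (f e))"
  unfolding prime_iff_mod
proof (intro pdec_conj pdec_le ptime_const f)
  show "pdec n (\<lambda>e. D e \<and> 2 \<le> f e) B (\<lambda>e. \<forall>d<f e. 2 \<le> d \<longrightarrow> f e mod d \<noteq> 0)"
  proof (rule pdec_all)
    show "ptime n (\<lambda>e. D e \<and> 2 \<le> f e) B f" by (rule ptime_mono[OF f]) auto
    then have f': "ptime (Suc n) (\<lambda>e. ((D (tl e) \<and> 2 \<le> f (tl e)) \<and> length e = Suc n \<and> hd e < f (tl e)) \<and> 2 \<le> hd e)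
        (\<lambda>e. B (tl e)) (\<lambda>e. f (tl e))"
      by (rule ptime_tl) auto
    show "pdec (Suc n) (\<lambda>e. (D (tl e) \<and> 2 \<le> f (tl e)) \<and> length e = Suc n \<and> hd e < f (tl e))
        (\<lambda>e. B (tl e)) (\<lambda>e. 2 \<le> hd e \<longrightarrow> f (tl e) mod hd e \<noteq> 0)"
      by (intro pdec_imp pdec_le pdec_not pdec_eq ptime_const ptime_hd ptime_mod f') (use less in auto)
  qed (use fB in auto)
qed

lemma ptime_next_prime:
  assumes f: "ptime n D B f" and fB: "\<And>e. D e \<Longrightarrow> length e = n \<Longrightarrow> next_prime (f e) \<le> B e"
  shows "ptime n D B (\<lambda>e. next_prime (f e))"
  unfolding next_prime_def
proof (rule ptime_Least)
  let ?D = "\<lambda>e. D (tl e) \<and> length e = Suc n \<and> (\<forall>y<hd e. \<not> (prime y \<and> f (tl e) \<le> y)) \<and> hd e \<le> B (tl e) + 2"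
  show "pdec (Suc n) ?D (\<lambda>e. B (tl e)) (\<lambda>e. prime (hd e) \<and> f (tl e) \<le> hd e)"
  proof (intro pdec_conj pdec_prime pdec_le ptime_hd ptime_tl[OF f])
    fix e assume *: "?D e"
    then have "hd e \<le> next_prime (f (tl e))" using next_prime(1,2)[of "f (tl e)"] by (meson not_le)
    also have "\<dots> \<le> B (tl e)" using * by (intro fB) auto
    finally show "hd e \<le> B (tl e) + 2" "hd e < 2 ^ B (tl e)" using less_exp[of "B (tl e)"] by linarith+
  qed auto
  fix e assume "D e" "length e = n"
  from fB[OF this] show "\<exists>x\<le>B e + 2. prime x \<and> f e \<le> x" using next_prime(1,2)[of "f e"] by (meson trans_le_add1)
qed

lemma nprime_eq_itr: "nprime Q j = itr j (\<lambda>_ a. next_prime (a + 1)) (next_prime Q)"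
  by (induction j) auto

lemma nprime_mono: "i \<le> j \<Longrightarrow> nprime Q i \<le> nprime Q j"
  using nprime_strict_mono[of i j Q] by (cases "i = j") auto

lemma le_nprime: "j \<le> nprime Q j"
proof (induction j)
  case (Suc j)
  then show ?case using nprime_strict_mono[of j "Suc j" Q] by simp
qed simp

lemma ptime_nprime:
  assumes Q: "ptime n D B Q" and j: "ptime n D B j"
    and cond: "\<And>e. D e \<Longrightarrow> length e = n \<Longrightarrow> nprime (Q e) (j e) \<le> B e"
  shows "ptime n D B (\<lambda>e. nprime (Q e) (j e))"
  unfolding nprime_eq_itr
proof (rule ptime_itr[OF j])
  show "j e \<le> B e + 2" if "D e" "length e = n" for e
    using cond[OF that] le_nprime[of "j e" "Q e"] by linarith
  show "ptime n D B (\<lambda>e. next_prime (Q e))"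
  proof (rule ptime_next_prime[OF Q])
    fix e assume e: "D e" "length e = n"
    show "next_prime (Q e) \<le> B e" using cond[OF e] nprime_mono[of 0 "j e" "Q e"] by simp
  qed
  show "ptime (Suc (Suc n)) (\<lambda>e. D (tl (tl e)) \<and> length e = Suc (Suc n) \<and> hd e < j (tl (tl e)) \<and>
     hd (tl e) = itr (hd e) (\<lambda>_ a. next_prime (a + 1)) (next_prime (Q (tl (tl e))))) (\<lambda>e. B (tl (tl e))) (\<lambda>e. next_prime (hd (tl e) + 1))"
  proof (intro ptime_next_prime ptime_add ptime_hd_tl ptime_const)
    fix e assume "D (tl (tl e)) \<and> length e = Suc (Suc n) \<and> hd e < j (tl (tl e)) \<and>
      hd (tl e) = itr (hd e) (\<lambda>_ a. next_prime (a + 1)) (next_prime (Q (tl (tl e))))"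
    then have e: "D (tl (tl e))" "length (tl (tl e)) = n" "hd e < j (tl (tl e))"
      "hd (tl e) = nprime (Q (tl (tl e))) (hd e)" by (auto simp: nprime_eq_itr)
    \<comment> \<open>The accumulator is the prime with index \<open>hd e\<close>; its successor has
      index at most \<open>j (tl (tl e))\<close> and is covered by the bound on the last
      prime.\<close>
    have "next_prime (hd (tl e) + 1) = nprime (Q (tl (tl e))) (Suc (hd e))" using e(4) by simp
    also have "\<dots> \<le> nprime (Q (tl (tl e))) (j (tl (tl e)))" using e(3) by (intro nprime_mono) simp
    finally show "next_prime (hd (tl e) + 1) \<le> B (tl (tl e))" using cond[OF e(1,2)] by linarith
  qed
qed

lemma ptime_nprod:
  assumes Q: "ptime n D B Q" and m: "ptime n D B m"
    and cond: "\<And>e. D e \<Longrightarrow> length e = n \<Longrightarrow> nprime (Q e) (m e) \<le> B e"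
  shows "ptime n D B (\<lambda>e. nprod (nprime (Q e)) (m e))"
  unfolding nprod_def
proof (rule ptime_prod[OF m])
  show "m e \<le> B e + 2" if "D e" "length e = n" for e
    using cond[OF that] le_nprime[of "m e" "Q e"] by linarith
  have le: "nprime (Q e) i \<le> B e" if "D e" "length e = n" "i < m e" for e i
    using cond[OF that(1,2)] nprime_mono[of i "m e" "Q e"] that(3) by linarith
  show "nprime (Q e) i \<le> B e + 2" if "D e" "length e = n" "i < m e" for e i
    using le[OF that] by linarith
  show "ptime (Suc n) (\<lambda>e. D (tl e) \<and> length e = Suc n \<and> hd e < m (tl e)) (\<lambda>e. B (tl e)) (\<lambda>e. nprime (Q (tl e)) (hd e))"
    by (intro ptime_nprime ptime_tl[OF Q] ptime_hd) (use le in auto)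
qed

lemma ptime_nprimes:
  assumes Q: "ptime n D B Q" and T: "ptime n D B T"
    and cond: "\<And>e. D e \<Longrightarrow> length e = n \<Longrightarrow> nprime (Q e) (nprimes (Q e) (T e)) \<le> B e"
  shows "ptime n D B (\<lambda>e. nprimes (Q e) (T e))"
  unfolding nprimes_def
proof (rule ptime_Least)
  let ?D = "\<lambda>e. D (tl e) \<and> length e = Suc n \<and> (\<forall>y<hd e. \<not> T (tl e) \<le> nprod (nprime (Q (tl e))) y) \<and> hd e \<le> B (tl e) + 2"
  show "pdec (Suc n) ?D (\<lambda>e. B (tl e)) (\<lambda>e. T (tl e) \<le> nprod (nprime (Q (tl e))) (hd e))"
  proof (intro pdec_le ptime_nprod ptime_hd ptime_tl[OF Q] ptime_tl[OF T])
    fix e assume *: "?D e"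
    then have e: "D (tl e)" "length (tl e) = n" by auto
    have "hd e \<le> nprimes (Q (tl e)) (T (tl e))" using * nprimes(1)[of "T (tl e)" "Q (tl e)"] by (meson not_le)
    then have "nprime (Q (tl e)) (hd e) \<le> nprime (Q (tl e)) (nprimes (Q (tl e)) (T (tl e)))" by (rule nprime_mono)
    then show "nprime (Q (tl e)) (hd e) \<le> B (tl e)" using cond[OF e] by linarith
  qed auto
  fix e assume e: "D e" "length e = n"
  have "nprimes (Q e) (T e) \<le> B e + 2" using cond[OF e] le_nprime[of "nprimes (Q e) (T e)" "Q e"] by linarith
  then show "\<exists>x\<le>B e + 2. T e \<le> nprod (nprime (Q e)) x" using nprimes(1) by blast
qed

text \<open>The trial \<open>t\<close> stays below the prime and is a small count, while
  \<open>v\<close> and \<open>P\<close> may have up to \<open>B e\<close> bits. The argument of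
  \<open>mod\<close> stays below \<open>P e * p e\<close>, as \<open>ptime_mod\<close>
  demands.\<close>

lemma ptime_crt_step:
  assumes v: "ptime n D B v" and P: "ptime n D B P" and p: "ptime n D B p" and a: "ptime n D B a"
    and cond: "\<And>e. D e \<Longrightarrow> length e = n \<Longrightarrow> coprime (P e) (p e) \<and> a e < p e \<and> v e < P e \<and>
      p e \<le> B e \<and> P e * p e \<le> 2 ^ B e"
  shows "ptime n D B (\<lambda>e. LEAST t. (v e + P e * t) mod p e = a e)"
proof (rule ptime_Least)
  have step: "\<exists>t<p e. (v e + P e * t) mod p e = a e" if "D e" "length e = n" for e
    using cond[OF that] by (intro crt_step) auto
  let ?D = "\<lambda>e. D (tl e) \<and> length e = Suc n \<and>
    (\<forall>y<hd e. \<not> (v (tl e) + P (tl e) * y) mod p (tl e) = a (tl e)) \<and> hd e \<le> B (tl e) + 2"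
  show "pdec (Suc n) ?D (\<lambda>e. B (tl e)) (\<lambda>e. (v (tl e) + P (tl e) * hd e) mod p (tl e) = a (tl e))"
  proof (intro pdec_eq ptime_mod ptime_add ptime_mult ptime_hd ptime_tl[OF v] ptime_tl[OF P] ptime_tl[OF p] ptime_tl[OF a])
    fix e assume *: "?D e"
    then have e: "D (tl e)" "length (tl e) = n" by auto
    show "0 < p (tl e)" "hd e \<le> B (tl e) + 2" using cond[OF e] * by auto
    obtain t where "t < p (tl e)" "(v (tl e) + P (tl e) * t) mod p (tl e) = a (tl e)" using step[OF e] by blast
    then have "hd e < p (tl e)" using * by (meson not_le le_less_trans)
    then have "P (tl e) * (hd e + 1) \<le> P (tl e) * p (tl e)" by (intro mult_le_mono2) simp
    then have "v (tl e) + P (tl e) * hd e < P (tl e) * p (tl e)" using cond[OF e] by simp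
    then show "v (tl e) + P (tl e) * hd e < 2 ^ B (tl e)" using cond[OF e] by linarith
  qed auto
  fix e assume e: "D e" "length e = n"
  obtain t where t: "t < p e" "(v e + P e * t) mod p e = a e" using step[OF e] by blast
  then have "t \<le> B e + 2" using cond[OF e] by linarith
  with t(2) show "\<exists>x\<le>B e + 2. (v e + P e * x) mod p e = a e" by blast
qed

lemma nprod_mono: "i \<le> j \<Longrightarrow> nprod (nprime Q) i \<le> nprod (nprime Q) j"
proof (induction j rule: dec_induct)
  case (step j)
  have "nprod (nprime Q) j * 1 \<le> nprod (nprime Q) j * nprime Q j"
    using prime_gt_0_nat[OF prime_nprime[of Q j]] by (intro mult_le_mono2) simp
  with step.IH show ?case unfolding nprod_Suc by linarith
qed simp

lemma ptime_crt:
  assumes Q: "ptime n D B Q" and m: "ptime n D B m"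
    and a: "ptime (Suc n) (\<lambda>e. D (tl e) \<and> length e = Suc n \<and> hd e < m (tl e)) (\<lambda>e. B (tl e)) (\<lambda>e. a (hd e) (tl e))"
    and cond: "\<And>e. D e \<Longrightarrow> length e = n \<Longrightarrow> nprime (Q e) (m e) \<le> B e \<and> nprod (nprime (Q e)) (m e) \<le> 2 ^ B e \<and>
      (\<forall>i<m e. a i e < nprime (Q e) i)"
  shows "ptime n D B (\<lambda>e. crt (nprime (Q e)) (m e) (\<lambda>i. a i e))"
  unfolding crt_def
proof (rule ptime_itr[OF m _ ptime_const])
  show "m e \<le> B e + 2" if "D e" "length e = n" for e
    using cond[OF that] le_nprime[of "m e" "Q e"] by linarith
  let ?D = "\<lambda>e. D (tl (tl e)) \<and> length e = Suc (Suc n) \<and> hd e < m (tl (tl e)) \<and>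
     hd (tl e) = itr (hd e) (\<lambda>j v. v + nprod (nprime (Q (tl (tl e)))) j *
       (LEAST t. (v + nprod (nprime (Q (tl (tl e)))) j * t) mod nprime (Q (tl (tl e))) j = a j (tl (tl e)))) 0"
  have D: "D (tl (tl e))" "length (tl (tl e)) = n" "hd e < m (tl (tl e))"
      "hd (tl e) < nprod (nprime (Q (tl (tl e)))) (hd e)" "nprime (Q (tl (tl e))) (hd e) \<le> B (tl (tl e))"
      "a (hd e) (tl (tl e)) < nprime (Q (tl (tl e))) (hd e)"
      "nprod (nprime (Q (tl (tl e)))) (Suc (hd e)) \<le> 2 ^ B (tl (tl e))" if "?D e" for e
  proof -
    let ?e = "tl (tl e)"
    show e: "D ?e" "length ?e = n" "hd e < m ?e" using that by auto
    show "nprime (Q ?e) (hd e) \<le> B ?e"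
      using cond[OF e(1,2)] nprime_mono[of "hd e" "m ?e" "Q ?e"] e(3) by linarith
    show "a (hd e) ?e < nprime (Q ?e) (hd e)" using cond[OF e(1,2)] e(3) by blast
    have "nprod (nprime (Q ?e)) (Suc (hd e)) \<le> nprod (nprime (Q ?e)) (m ?e)" using e(3) by (intro nprod_mono) simp
    then show "nprod (nprime (Q ?e)) (Suc (hd e)) \<le> 2 ^ B ?e" using cond[OF e(1,2)] by linarith
    have "\<And>i. i < m ?e \<Longrightarrow> a i ?e < nprime (Q ?e) i" using cond[OF e(1,2)] by blast
    from crt_invariant[OF this, of "m ?e" "hd e"] show "hd (tl e) < nprod (nprime (Q ?e)) (hd e)"
      using that by (simp add: less_imp_le)
  qed
  have Q': "ptime (Suc (Suc n)) ?D (\<lambda>e. B (tl (tl e))) (\<lambda>e. Q (tl (tl e)))" by (rule ptime_tl_tl[OF Q]) simp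
  have p': "ptime (Suc (Suc n)) ?D (\<lambda>e. B (tl (tl e))) (\<lambda>e. nprime (Q (tl (tl e))) (hd e))"
    by (rule ptime_nprime[OF Q' ptime_hd]) (rule D(5))
  have P': "ptime (Suc (Suc n)) ?D (\<lambda>e. B (tl (tl e))) (\<lambda>e. nprod (nprime (Q (tl (tl e)))) (hd e))"
    by (rule ptime_nprod[OF Q' ptime_hd]) (rule D(5))
  have a': "ptime (Suc (Suc n)) ?D (\<lambda>e. B (tl (tl e))) (\<lambda>e. a (hd e) (tl (tl e)))"
    using ptime_drop[OF a, of ?D] by simp
  have "ptime (Suc (Suc n)) ?D (\<lambda>e. B (tl (tl e))) (\<lambda>e. LEAST t. (hd (tl e) + nprod (nprime (Q (tl (tl e)))) (hd e) * t) mod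
      nprime (Q (tl (tl e))) (hd e) = a (hd e) (tl (tl e)))"
  proof (rule ptime_crt_step[OF ptime_hd_tl P' p' a'])
    fix e assume "?D e"
    from D[OF this] show "coprime (nprod (nprime (Q (tl (tl e)))) (hd e)) (nprime (Q (tl (tl e))) (hd e)) \<and>
      a (hd e) (tl (tl e)) < nprime (Q (tl (tl e))) (hd e) \<and> hd (tl e) < nprod (nprime (Q (tl (tl e)))) (hd e) \<and>
      nprime (Q (tl (tl e))) (hd e) \<le> B (tl (tl e)) \<and>
      nprod (nprime (Q (tl (tl e)))) (hd e) * nprime (Q (tl (tl e))) (hd e) \<le> 2 ^ B (tl (tl e))"
      by (simp add: coprime_nprod_nprime nprod_Suc)
  qed
  note step = this
  show "ptime (Suc (Suc n)) ?D (\<lambda>e. B (tl (tl e)))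
     (\<lambda>e. hd (tl e) + nprod (nprime (Q (tl (tl e)))) (hd e) *
          (LEAST t. (hd (tl e) + nprod (nprime (Q (tl (tl e)))) (hd e) * t) mod nprime (Q (tl (tl e))) (hd e) = a (hd e) (tl (tl e))))"
  proof (intro ptime_add ptime_mult ptime_hd_tl P' step)
    fix e assume "?D e"
    note e = D[OF this]
    let ?e = "tl (tl e)"
    obtain t where t: "t < nprime (Q ?e) (hd e)" "(hd (tl e) + nprod (nprime (Q ?e)) (hd e) * t) mod nprime (Q ?e) (hd e) = a (hd e) ?e"
      using crt_step[OF coprime_nprod_nprime e(6)] by blast
    have "(LEAST t. (hd (tl e) + nprod (nprime (Q ?e)) (hd e) * t) mod nprime (Q ?e) (hd e) = a (hd e) ?e) \<le> t"
      by (rule Least_le) (rule t(2))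
    then show "(LEAST t. (hd (tl e) + nprod (nprime (Q ?e)) (hd e) * t) mod nprime (Q ?e) (hd e) = a (hd e) ?e) \<le> B ?e + 2"
      using t(1) e(5) by linarith
  qed
qed

lemma ptime_chunk:
  assumes w: "ptime n D B w" and X: "ptime n D B X" and c: "ptime n D B c"
    and cond: "\<And>e. D e \<Longrightarrow> length e = n \<Longrightarrow> w e \<le> B e \<and> X e < 2 ^ B e \<and> c e * w e \<le> B e"
  shows "ptime n D B (\<lambda>e. chunk (w e) (X e) (c e))"
  unfolding chunk_def
proof (intro ptime_mod ptime_unshift ptime_two_power ptime_mult w X c)
  fix e assume e: "D e" "length e = n"
  show "w e \<le> B e + 2" "w e \<le> B e + 2" "c e * w e \<le> B e + 2" "(0::nat) < 2 ^ w e"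
    using cond[OF e] by auto
  have "X e div 2 ^ (c e * w e) \<le> X e" by (rule div_le_dividend)
  then show "X e div 2 ^ (c e * w e) < 2 ^ B e" using cond[OF e] by linarith
qed

section \<open>Computing the reduction\<close>

text \<open>The reduction behind \<open>params\<close> is quantified away: programs and their time
  bounds must not refer to \<open>\<kappa>\<close>, \<open>\<phi>\<close> or
  \<open>V\<close>.\<close>

definition good :: "nat \<Rightarrow> nat \<Rightarrow> nat \<Rightarrow> bool" where
  "good b l B \<longleftrightarrow> fits b l B \<and> (\<exists>\<kappa> \<phi> V. params b l \<kappa> \<phi> V)"

lemma goodD:
  assumes "good b l B"
  shows "2 \<le> l" "4 \<le> b" "b \<le> B" "l \<le> B" "b * l \<le> B" "0 < e0 b l" "e0 b l \<le> B" "c0 b l \<le> B"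
    "2 ^ bwidth b l * l \<le> B" "bwidth b l \<le> B" "bsize b l \<le> B"
    "nprime (q0 b l) (m1 b l) \<le> B" "nprime (q1 b l) (m2 b l) \<le> B" "nprime (q2 b l) (m3 b l) \<le> B"
    "m1 b l \<le> B" "m2 b l \<le> B" "m3 b l \<le> B" "e1 b l \<le> B" "e2 b l \<le> B" "e3 b l \<le> 2 ^ B"
    "m1 b l * m2 b l * m3 b l * bwidth b l \<le> B"
    "b \<le> bsize b l * m1 b l * m2 b l * m3 b l"
    "e0 b l ^ (2 ^ bwidth b l * l) \<le> B" "\<exists>c<e0 b l ^ (2 ^ bwidth b l * l). valid l (bwidth b l) (e0 b l) c"
proof -
  obtain \<kappa> \<phi> V where "params b l \<kappa> \<phi> V" using assms unfolding good_def by blast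
  then interpret params b l \<kappa> \<phi> V .
  have fits: "fits b l B" using assms unfolding good_def by blast
  show l: "2 \<le> l" and "4 \<le> b" by (fact l b)+
  show bl: "b * l \<le> B" "2 ^ bwidth b l * l \<le> B" and pow: "e0 b l ^ (2 ^ bwidth b l * l) \<le> B"
    and p: "nprime (q0 b l) (m1 b l) \<le> B" "nprime (q1 b l) (m2 b l) \<le> B" "nprime (q2 b l) (m3 b l) \<le> B"
    and "m1 b l * m2 b l * m3 b l * bwidth b l \<le> B"
    using fits unfolding fits_def by blast+
  have "b * 1 \<le> b * l" "1 * l \<le> b * l" using l b by (intro mult_le_mono; simp)+
  then show "b \<le> B" "l \<le> B" using bl by linarith+
  show e0: "0 < e0 b l" by (rule e0_pos)
  have "e0 b l \<le> e0 b l ^ (2 ^ bwidth b l * l)" using e0 l by (intro self_le_power) auto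
  then show "e0 b l \<le> B" using pow by linarith
  have "c0 b l < e0 b l ^ (2 ^ bwidth b l * l)"
    unfolding c0_def e0_def bwidth_def by (rule min_table(1)[OF red]) (use l in simp)
  then show "c0 b l \<le> B" using pow by linarith
  show "\<exists>c<e0 b l ^ (2 ^ bwidth b l * l). valid l (bwidth b l) (e0 b l) c"
    unfolding e0_def bwidth_def by (rule min_base(2)[OF red]) (use l in simp)
  have "2 ^ bwidth b l * 1 \<le> 2 ^ bwidth b l * l" using l by (intro mult_le_mono2) simp
  then show bwidth: "bwidth b l \<le> B" using bl less_exp[of "bwidth b l"] by linarith
  have "bsize b l * 1 \<le> bwidth b l" unfolding bwidth_def using l by (intro mult_le_mono2) simp
  then show "bsize b l \<le> B" using bwidth by linarith
  show "m1 b l \<le> B" "m2 b l \<le> B" "m3 b l \<le> B"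
    using p le_nprime[of "m1 b l" "q0 b l"] le_nprime[of "m2 b l" "q1 b l"] le_nprime[of "m3 b l" "q2 b l"] by linarith+
  show "e1 b l \<le> B" using p(2) nprime_q_ge[of "e1 b l" "m2 b l"] unfolding q1_def by linarith
  show "e2 b l \<le> B" using p(3) nprime_q_ge[of "e2 b l" "m3 b l"] unfolding q2_def by linarith
  have "e3 b l \<le> (e3 b l)\<^sup>2" by (simp add: power2_eq_square)
  also have "\<dots> \<le> l * (e3 b l)\<^sup>2" using l by simp
  also have "\<dots> < 2 ^ B" using fits unfolding fits_def by blast
  finally show "e3 b l \<le> 2 ^ B" by simp
  show "b \<le> bsize b l * m1 b l * m2 b l * m3 b l" by (rule m3(1))
qed

lemma good_less:
  assumes "good b l B"
  shows "k < m1 b l \<Longrightarrow> nprime (q0 b l) k \<le> B" "k < m2 b l \<Longrightarrow> nprime (q1 b l) k \<le> B"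
    "k < m3 b l \<Longrightarrow> nprime (q2 b l) k \<le> B"
  using goodD(12-14)[OF assms] nprime_mono[of k "m1 b l" "q0 b l"] nprime_mono[of k "m2 b l" "q1 b l"]
    nprime_mono[of k "m3 b l" "q2 b l"] by linarith+

text \<open>Here \<open>b\<close> and \<open>l\<close> are functions of the argument list. Each loop
  or search lengthens that list, and with functions the locale can be interpreted anew for the
  longer list, by \<open>shift\<close>.\<close>

locale red_params =
  fixes n D B bf lf
  assumes bf: "ptime n D B bf" and lf: "ptime n D B lf"
    and good: "\<And>e. D e \<Longrightarrow> length e = n \<Longrightarrow> good (bf e) (lf e) (B e)"
begin

lemma shift:
  assumes "\<And>e. D' e \<Longrightarrow> D (tl e)"
  shows "red_params (Suc n) D' (\<lambda>e. B (tl e)) (\<lambda>e. bf (tl e)) (\<lambda>e. lf (tl e))"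
proof
  show "good (bf (tl e)) (lf (tl e)) (B (tl e))" if "D' e" "length e = Suc n" for e
    by (rule good) (use assms that in auto)
qed (use ptime_tl[OF bf, of D'] ptime_tl[OF lf, of D'] assms in auto)

lemmas gd = goodD[OF good]

lemma ptime_bsize: "ptime n D B (\<lambda>e. bsize (bf e) (lf e))"
proof -
  have "ptime n D B (\<lambda>e. flog (flog (bf e)) div (2 * lf e) + 1)"
  proof (intro ptime_add ptime_div ptime_flog ptime_mult ptime_const bf lf)
    fix e assume e: "D e" "length e = n"
    note g = gd[OF e]
    show "bf e \<le> B e" "lf e \<le> B e + 2" "0 < 2 * lf e" using g(1-4) by auto
    show "flog (bf e) \<le> B e" using flog_less[of "bf e"] g(3) by linarith
    then show "flog (flog (bf e)) div (2 * lf e) \<le> B e"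
      using flog_less[of "flog (bf e)"] div_le_dividend[of "flog (flog (bf e))" "2 * lf e"] by linarith
  qed
  then show ?thesis by (simp add: bsize_def)
qed

lemma ptime_bwidth: "ptime n D B (\<lambda>e. bwidth (bf e) (lf e))"
  unfolding bwidth_def by (rule ptime_mult[OF ptime_bsize lf]) (use gd(4) in \<open>force intro: trans_le_add1\<close>)

lemma min_base_cond:
  assumes "D e" "length e = n"
  shows "0 < lf e \<and> 2 ^ bwidth (bf e) (lf e) * lf e \<le> B e \<and>
      min_base (lf e) (bwidth (bf e) (lf e)) ^ (2 ^ bwidth (bf e) (lf e) * lf e) \<le> B e \<and>
      (\<exists>c<min_base (lf e) (bwidth (bf e) (lf e)) ^ (2 ^ bwidth (bf e) (lf e) * lf e).
         valid (lf e) (bwidth (bf e) (lf e)) (min_base (lf e) (bwidth (bf e) (lf e))) c)"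
  using gd(1,9,23,24)[OF assms] unfolding e0_def by auto

lemma ptime_e0: "ptime n D B (\<lambda>e. e0 (bf e) (lf e))"
  unfolding e0_def by (rule ptime_min_base[OF lf ptime_bwidth min_base_cond])

lemma ptime_c0: "ptime n D B (\<lambda>e. c0 (bf e) (lf e))"
  unfolding c0_def by (rule ptime_min_table[OF lf ptime_bwidth min_base_cond])

lemma ptime_mult_square:
  assumes "ptime n D B f" and "\<And>e. D e \<Longrightarrow> length e = n \<Longrightarrow> f e \<le> B e"
  shows "ptime n D B (\<lambda>e. lf e * (f e)\<^sup>2)"
proof -
  have "ptime n D B (\<lambda>e. lf e * f e * f e)"
    by (intro ptime_mult lf assms(1)) (use assms(2) in \<open>force intro: trans_le_add1\<close>)+
  then show ?thesis by (simp add: power2_eq_square mult.assoc)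
qed

lemma ptime_q0: "ptime n D B (\<lambda>e. q0 (bf e) (lf e))"
  unfolding q0_def by (rule ptime_mult_square[OF ptime_e0 gd(7)])

lemma ptime_m1: "ptime n D B (\<lambda>e. m1 (bf e) (lf e))"
  unfolding m1_def
  by (rule ptime_nprimes[OF ptime_q0 ptime_flog[OF bf gd(3)] gd(12)[unfolded m1_def]])

lemma ptime_e1: "ptime n D B (\<lambda>e. e1 (bf e) (lf e))"
  unfolding e1_def by (rule ptime_nprod[OF ptime_q0 ptime_m1 gd(12)])

lemma ptime_q1: "ptime n D B (\<lambda>e. q1 (bf e) (lf e))"
  unfolding q1_def by (rule ptime_mult_square[OF ptime_e1 gd(18)])

lemma ptime_m2: "ptime n D B (\<lambda>e. m2 (bf e) (lf e))"
  unfolding m2_def by (rule ptime_nprimes[OF ptime_q1 bf gd(13)[unfolded m2_def]])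

lemma ptime_e2: "ptime n D B (\<lambda>e. e2 (bf e) (lf e))"
  unfolding e2_def by (rule ptime_nprod[OF ptime_q1 ptime_m2 gd(13)])

lemma ptime_q2: "ptime n D B (\<lambda>e. q2 (bf e) (lf e))"
  unfolding q2_def by (rule ptime_mult_square[OF ptime_e2 gd(19)])

lemma ptime_m3: "ptime n D B (\<lambda>e. m3 (bf e) (lf e))"
  unfolding m3_def
proof (rule ptime_Least)
  let ?D = "\<lambda>e. D (tl e) \<and> length e = Suc n \<and>
    (\<forall>y<hd e. \<not> bf (tl e) \<le> bsize (bf (tl e)) (lf (tl e)) * m1 (bf (tl e)) (lf (tl e)) * m2 (bf (tl e)) (lf (tl e)) * y) \<and>
    hd e \<le> B (tl e) + 2"
  interpret s: red_params "Suc n" ?D "\<lambda>e. B (tl e)" "\<lambda>e. bf (tl e)" "\<lambda>e. lf (tl e)"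
    by (rule shift) simp
  show "pdec (Suc n) ?D (\<lambda>e. B (tl e)) (\<lambda>e. bf (tl e) \<le>
      bsize (bf (tl e)) (lf (tl e)) * m1 (bf (tl e)) (lf (tl e)) * m2 (bf (tl e)) (lf (tl e)) * hd e)"
  proof (intro pdec_le ptime_mult ptime_hd s.bf s.ptime_bsize s.ptime_m1 s.ptime_m2)
    fix e assume e: "?D e" "length e = Suc n"
    show "m1 (bf (tl e)) (lf (tl e)) \<le> B (tl e) + 2" "m2 (bf (tl e)) (lf (tl e)) \<le> B (tl e) + 2"
      "hd e \<le> B (tl e) + 2"
      using s.gd(15,16)[OF e] e(1) by linarith+
  qed
  fix e assume e: "D e" "length e = n"
  show "\<exists>x\<le>B e + 2. bf e \<le> bsize (bf e) (lf e) * m1 (bf e) (lf e) * m2 (bf e) (lf e) * x"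
    using gd(17,22)[OF e] by (meson trans_le_add1)
qed

lemma ptime_e3: "ptime n D B (\<lambda>e. e3 (bf e) (lf e))"
  unfolding e3_def by (rule ptime_nprod[OF ptime_q2 ptime_m3 gd(14)])

lemma X_less:
  fixes X :: nat
  assumes "D e" "length e = n" "X < 2 ^ (bf e * lf e)"
  shows "X < 2 ^ B e"
proof -
  have "(2::nat) ^ (bf e * lf e) \<le> 2 ^ B e" using gd(5)[OF assms(1,2)] by (intro power_increasing) auto
  with assms(3) show ?thesis by linarith
qed

lemma index_less: "(g::nat) < M \<Longrightarrow> k < m \<Longrightarrow> g * m + k < M * m"
proof -
  assume "g < M" "k < m"
  then have "g * m + k < (g + 1) * m" by simp
  also have "\<dots> \<le> M * m" using \<open>g < M\<close> by (intro mult_le_mono1) simp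
  finally show ?thesis .
qed

text \<open>The bound on \<open>g e\<close> keeps the number of every block that is read below
  \<open>m1 * m2 * m3\<close>, so the shift that extracts the block is at most
  \<open>B e\<close>.\<close>

lemma ptime_phi1:
  assumes X: "ptime n D B X" and g: "ptime n D B g" and i: "ptime n D B i"
    and cond: "\<And>e. D e \<Longrightarrow> length e = n \<Longrightarrow> X e < 2 ^ (bf e * lf e) \<and>
       g e < m3 (bf e) (lf e) * m2 (bf e) (lf e) \<and> i e < lf e"
  shows "ptime n D B (\<lambda>e. phi1 (bf e) (lf e) (X e) (g e) (i e))"
  unfolding phi1_def
proof (rule ptime_crt[OF ptime_q0 ptime_m1])
  let ?D = "\<lambda>e. D (tl e) \<and> length e = Suc n \<and> hd e < m1 (bf (tl e)) (lf (tl e))"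
  interpret s: red_params "Suc n" ?D "\<lambda>e. B (tl e)" "\<lambda>e. bf (tl e)" "\<lambda>e. lf (tl e)"
    by (rule shift) simp
  have chunk: "chunk (bwidth (bf e) (lf e)) X c * lf e + i e \<le> B e" if "D e" "length e = n" for e X c
  proof -
    have "chunk (bwidth (bf e) (lf e)) X c * lf e + i e < 2 ^ bwidth (bf e) (lf e) * lf e"
      using cond[OF that] by (intro index_less chunk_less) auto
    then show ?thesis using gd(9)[OF that] by linarith
  qed
  show "ptime (Suc n) ?D (\<lambda>e. B (tl e))
     (\<lambda>e. digit (e0 (bf (tl e)) (lf (tl e))) (c0 (bf (tl e)) (lf (tl e)))
       (chunk (bwidth (bf (tl e)) (lf (tl e))) (X (tl e)) (g (tl e) * m1 (bf (tl e)) (lf (tl e)) + hd e) * lf (tl e) + i (tl e)))"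
  proof (intro ptime_digit ptime_add ptime_mult ptime_chunk s.ptime_e0 s.ptime_c0 s.ptime_bwidth s.ptime_m1 s.lf ptime_hd ptime_tl[OF X] ptime_tl[OF g] ptime_tl[OF i])
    fix e assume e: "?D e" "length e = Suc n"
    then have e': "D (tl e)" "length (tl e) = n" by auto
    let ?b = "bf (tl e)" and ?l = "lf (tl e)"
    note G = gd[OF e'] and C = cond[OF e']
    show "m1 ?b ?l \<le> B (tl e) + 2" "?l \<le> B (tl e) + 2" using G(4,15) by linarith+
    have "g (tl e) * m1 ?b ?l + hd e < (m3 ?b ?l * m2 ?b ?l) * m1 ?b ?l"
      using C e(1) by (intro index_less) auto
    then have "(g (tl e) * m1 ?b ?l + hd e) * bwidth ?b ?l \<le> ((m3 ?b ?l * m2 ?b ?l) * m1 ?b ?l) * bwidth ?b ?l"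
      by (intro mult_le_mono1) simp
    also have "\<dots> \<le> B (tl e)" using G(21) by (simp add: mult_ac)
    finally show "bwidth ?b ?l \<le> B (tl e) \<and> X (tl e) < 2 ^ B (tl e) \<and>
        (g (tl e) * m1 ?b ?l + hd e) * bwidth ?b ?l \<le> B (tl e)"
      using G(10) X_less[OF e'] C by blast
    show "0 < e0 ?b ?l \<and> e0 ?b ?l \<le> B (tl e) \<and> c0 ?b ?l \<le> B (tl e) \<and>
        chunk (bwidth ?b ?l) (X (tl e)) (g (tl e) * m1 ?b ?l + hd e) * ?l + i (tl e) \<le> B (tl e)"
      using G(6,7,8) chunk[OF e'] by blast
  qed auto
  fix e assume e: "D e" "length e = n"
  obtain \<kappa> \<phi> V where "params (bf e) (lf e) \<kappa> \<phi> V" using good[OF e] unfolding good_def by blast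
  then interpret params "bf e" "lf e" \<kappa> \<phi> V .
  have "digit (e0 (bf e) (lf e)) (c0 (bf e) (lf e)) x < nprime (q0 (bf e) (lf e)) k" for k x
    unfolding q0_def by (rule less_le_trans[OF digit_less[OF e0_pos] nprime_q_ge])
  moreover have "nprod (nprime (q0 (bf e) (lf e))) (m1 (bf e) (lf e)) \<le> 2 ^ B e"
    using gd(18)[OF e] less_exp[of "B e"] unfolding e1_def by linarith
  ultimately show "nprime (q0 (bf e) (lf e)) (m1 (bf e) (lf e)) \<le> B e \<and>
      nprod (nprime (q0 (bf e) (lf e))) (m1 (bf e) (lf e)) \<le> 2 ^ B e \<and>
      (\<forall>k<m1 (bf e) (lf e). digit (e0 (bf e) (lf e)) (c0 (bf e) (lf e))
         (chunk (bwidth (bf e) (lf e)) (X e) (g e * m1 (bf e) (lf e) + k) * lf e + i e) < nprime (q0 (bf e) (lf e)) k)"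
    using gd(12)[OF e] by blast
qed

lemma ptime_phi2:
  assumes X: "ptime n D B X" and g: "ptime n D B g" and i: "ptime n D B i"
    and cond: "\<And>e. D e \<Longrightarrow> length e = n \<Longrightarrow> X e < 2 ^ (bf e * lf e) \<and> g e < m3 (bf e) (lf e) \<and> i e < lf e"
  shows "ptime n D B (\<lambda>e. phi2 (bf e) (lf e) (X e) (g e) (i e))"
  unfolding phi2_def
proof (rule ptime_crt[OF ptime_q1 ptime_m2])
  let ?D = "\<lambda>e. D (tl e) \<and> length e = Suc n \<and> hd e < m2 (bf (tl e)) (lf (tl e))"
  interpret s: red_params "Suc n" ?D "\<lambda>e. B (tl e)" "\<lambda>e. bf (tl e)" "\<lambda>e. lf (tl e)"
    by (rule shift) simp
  show "ptime (Suc n) ?D (\<lambda>e. B (tl e))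
     (\<lambda>e. phi1 (bf (tl e)) (lf (tl e)) (X (tl e)) (g (tl e) * m2 (bf (tl e)) (lf (tl e)) + hd e) (i (tl e)))"
  proof (intro s.ptime_phi1 ptime_add ptime_mult s.ptime_m2 ptime_hd ptime_tl[OF X] ptime_tl[OF g] ptime_tl[OF i])
    fix e assume e: "?D e" "length e = Suc n"
    then have e': "D (tl e)" "length (tl e) = n" by auto
    show "m2 (bf (tl e)) (lf (tl e)) \<le> B (tl e) + 2" using gd(16)[OF e'] by linarith
    show "X (tl e) < 2 ^ (bf (tl e) * lf (tl e)) \<and>
       g (tl e) * m2 (bf (tl e)) (lf (tl e)) + hd e < m3 (bf (tl e)) (lf (tl e)) * m2 (bf (tl e)) (lf (tl e)) \<and>
       i (tl e) < lf (tl e)"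
      using cond[OF e'] e(1) index_less by blast
  qed auto
  fix e assume e: "D e" "length e = n"
  obtain \<kappa> \<phi> V where "params (bf e) (lf e) \<kappa> \<phi> V" using good[OF e] unfolding good_def by blast
  then interpret params "bf e" "lf e" \<kappa> \<phi> V .
  have "phi1 (bf e) (lf e) (X e) x (i e) < nprime (q1 (bf e) (lf e)) k" for k x
    unfolding q1_def by (rule less_le_trans[OF phi1_less nprime_q_ge])
  moreover have "nprod (nprime (q1 (bf e) (lf e))) (m2 (bf e) (lf e)) \<le> 2 ^ B e"
    using gd(19)[OF e] less_exp[of "B e"] unfolding e2_def by linarith
  ultimately show "nprime (q1 (bf e) (lf e)) (m2 (bf e) (lf e)) \<le> B e \<and>
      nprod (nprime (q1 (bf e) (lf e))) (m2 (bf e) (lf e)) \<le> 2 ^ B e \<and>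
      (\<forall>j<m2 (bf e) (lf e). phi1 (bf e) (lf e) (X e) (g e * m2 (bf e) (lf e) + j) (i e) < nprime (q1 (bf e) (lf e)) j)"
    using gd(13)[OF e] by blast
qed

lemma ptime_phi3:
  assumes X: "ptime n D B X" and i: "ptime n D B i"
    and cond: "\<And>e. D e \<Longrightarrow> length e = n \<Longrightarrow> X e < 2 ^ (bf e * lf e) \<and> i e < lf e"
  shows "ptime n D B (\<lambda>e. phi3 (bf e) (lf e) (X e) (i e))"
  unfolding phi3_def
proof (rule ptime_crt[OF ptime_q2 ptime_m3])
  let ?D = "\<lambda>e. D (tl e) \<and> length e = Suc n \<and> hd e < m3 (bf (tl e)) (lf (tl e))"
  interpret s: red_params "Suc n" ?D "\<lambda>e. B (tl e)" "\<lambda>e. bf (tl e)" "\<lambda>e. lf (tl e)"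
    by (rule shift) simp
  show "ptime (Suc n) ?D (\<lambda>e. B (tl e)) (\<lambda>e. phi2 (bf (tl e)) (lf (tl e)) (X (tl e)) (hd e) (i (tl e)))"
    by (intro s.ptime_phi2 ptime_hd ptime_tl[OF X] ptime_tl[OF i]) (use cond in auto)
  fix e assume e: "D e" "length e = n"
  obtain \<kappa> \<phi> V where "params (bf e) (lf e) \<kappa> \<phi> V" using good[OF e] unfolding good_def by blast
  then interpret params "bf e" "lf e" \<kappa> \<phi> V .
  have "phi2 (bf e) (lf e) (X e) x (i e) < nprime (q2 (bf e) (lf e)) k" for k x
    unfolding q2_def by (rule less_le_trans[OF phi2_less nprime_q_ge])
  then show "nprime (q2 (bf e) (lf e)) (m3 (bf e) (lf e)) \<le> B e \<and>
      nprod (nprime (q2 (bf e) (lf e))) (m3 (bf e) (lf e)) \<le> 2 ^ B e \<and>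
      (\<forall>h<m3 (bf e) (lf e). phi2 (bf e) (lf e) (X e) h (i e) < nprime (q2 (bf e) (lf e)) h)"
    using gd(14,20)[OF e] unfolding e3_def by blast
qed

text \<open>The test of \<open>in_V\<close> is assembled quantifier by quantifier, since each
  bounded quantifier extends the argument list and calls for a new interpretation of the
  locale.\<close>

lemma pdec_in_V0_mod0:
  assumes z: "ptime n D B z" and cond: "\<And>e. D e \<Longrightarrow> length e = n \<Longrightarrow> z e < 2 ^ B e"
  shows "pdec n D B (\<lambda>e. \<forall>k<m1 (bf e) (lf e).
    in_V0 (lf e) (bwidth (bf e) (lf e)) (e0 (bf e) (lf e)) (c0 (bf e) (lf e)) (z e mod nprime (q0 (bf e) (lf e)) k))"
proof (rule pdec_all[OF ptime_m1])
  show "m1 (bf e) (lf e) \<le> B e + 2" if "D e" "length e = n" for e using gd(15)[OF that] by linarith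
  let ?D = "\<lambda>e. D (tl e) \<and> length e = Suc n \<and> hd e < m1 (bf (tl e)) (lf (tl e))"
  interpret s: red_params "Suc n" ?D "\<lambda>e. B (tl e)" "\<lambda>e. bf (tl e)" "\<lambda>e. lf (tl e)"
    by (rule shift) simp
  show "pdec (Suc n) ?D (\<lambda>e. B (tl e)) (\<lambda>e. in_V0 (lf (tl e)) (bwidth (bf (tl e)) (lf (tl e)))
      (e0 (bf (tl e)) (lf (tl e))) (c0 (bf (tl e)) (lf (tl e))) (z (tl e) mod nprime (q0 (bf (tl e)) (lf (tl e))) (hd e)))"
  proof (intro pdec_in_V0 ptime_mod ptime_nprime ptime_hd s.lf s.ptime_bwidth s.ptime_e0 s.ptime_c0 s.ptime_q0 ptime_tl[OF z])
    fix e assume e: "?D e" "length e = Suc n"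
    then have e': "D (tl e)" "length (tl e) = n" by auto
    show "nprime (q0 (bf (tl e)) (lf (tl e))) (hd e) \<le> B (tl e)" using good_less(1)[OF good[OF e']] e(1) by blast
    show "0 < nprime (q0 (bf (tl e)) (lf (tl e))) (hd e)" by (rule prime_gt_0_nat[OF prime_nprime])
    show "z (tl e) < 2 ^ B (tl e)" by (rule cond[OF e'])
    show "0 < lf (tl e) \<and> 2 ^ bwidth (bf (tl e)) (lf (tl e)) * lf (tl e) \<le> B (tl e) \<and> 0 < e0 (bf (tl e)) (lf (tl e)) \<and>
       e0 (bf (tl e)) (lf (tl e)) \<le> B (tl e) \<and> c0 (bf (tl e)) (lf (tl e)) \<le> B (tl e)"
      using gd(1,6-9)[OF e'] by (intro conjI; linarith)
  qed auto
qed

lemma pdec_in_V0_mod1: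
  assumes z: "ptime n D B z" and cond: "\<And>e. D e \<Longrightarrow> length e = n \<Longrightarrow> z e < 2 ^ B e"
  shows "pdec n D B (\<lambda>e. \<forall>j<m2 (bf e) (lf e). \<forall>k<m1 (bf e) (lf e).
    in_V0 (lf e) (bwidth (bf e) (lf e)) (e0 (bf e) (lf e)) (c0 (bf e) (lf e))
      (z e mod nprime (q1 (bf e) (lf e)) j mod nprime (q0 (bf e) (lf e)) k))"
proof (rule pdec_all[OF ptime_m2])
  show "m2 (bf e) (lf e) \<le> B e + 2" if "D e" "length e = n" for e using gd(16)[OF that] by linarith
  let ?D = "\<lambda>e. D (tl e) \<and> length e = Suc n \<and> hd e < m2 (bf (tl e)) (lf (tl e))"
  interpret s: red_params "Suc n" ?D "\<lambda>e. B (tl e)" "\<lambda>e. bf (tl e)" "\<lambda>e. lf (tl e)"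
    by (rule shift) simp
  show "pdec (Suc n) ?D (\<lambda>e. B (tl e)) (\<lambda>e. \<forall>k<m1 (bf (tl e)) (lf (tl e)). in_V0 (lf (tl e)) (bwidth (bf (tl e)) (lf (tl e)))
      (e0 (bf (tl e)) (lf (tl e))) (c0 (bf (tl e)) (lf (tl e)))
      (z (tl e) mod nprime (q1 (bf (tl e)) (lf (tl e))) (hd e) mod nprime (q0 (bf (tl e)) (lf (tl e))) k))"
  proof (intro s.pdec_in_V0_mod0 ptime_mod ptime_nprime ptime_hd s.ptime_q1 ptime_tl[OF z])
    fix e assume e: "?D e" "length e = Suc n"
    then have e': "D (tl e)" "length (tl e) = n" by auto
    show "nprime (q1 (bf (tl e)) (lf (tl e))) (hd e) \<le> B (tl e)" using good_less(2)[OF good[OF e']] e(1) by blast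
    show "0 < nprime (q1 (bf (tl e)) (lf (tl e))) (hd e)" by (rule prime_gt_0_nat[OF prime_nprime])
    show z: "z (tl e) < 2 ^ B (tl e)" by (rule cond[OF e'])
    show "z (tl e) mod nprime (q1 (bf (tl e)) (lf (tl e))) (hd e) < 2 ^ B (tl e)"
      by (rule le_less_trans[OF mod_less_eq_dividend z])
  qed auto
qed

text \<open>For the set, \<open>B e\<close> is at least
  \<open>lf e * (e3 (bf e) (lf e))\<^sup>2\<close>, the range over which it is going to be listed.
  The cut-off in \<open>in_V\<close> is tested first and acts as a guard: residues are taken only
  below it, so \<open>z e\<close> itself may be arbitrary.\<close>

lemma pdec_in_V:
  assumes z: "ptime n D B z" and cond: "\<And>e. D e \<Longrightarrow> length e = n \<Longrightarrow> lf e * (e3 (bf e) (lf e))\<^sup>2 \<le> B e"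
  shows "pdec n D B (\<lambda>e. in_V (bf e) (lf e) (z e))"
proof -
  have e3: "e3 (bf e) (lf e) \<le> B e" if "D e" "length e = n" for e
  proof -
    have "e3 (bf e) (lf e) \<le> (e3 (bf e) (lf e))\<^sup>2" by (simp add: power2_eq_square)
    also have "\<dots> \<le> lf e * (e3 (bf e) (lf e))\<^sup>2" using gd(1)[OF that] by simp
    finally show ?thesis using cond[OF that] by linarith
  qed
  let ?D = "\<lambda>e. D e \<and> z e < lf e * (e3 (bf e) (lf e))\<^sup>2"
  have zB: "z e < 2 ^ B e" if "?D e" "length e = n" for e
    using that cond[of e] less_exp[of "B e"] by linarith
  interpret r: red_params n ?D B bf lf
    by unfold_locales (use ptime_mono[OF bf, of ?D B] ptime_mono[OF lf, of ?D B] good in auto)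
  have zr: "ptime n ?D B z" by (rule ptime_mono[OF z]) auto
  let ?D' = "\<lambda>e. ?D (tl e) \<and> length e = Suc n \<and> hd e < m3 (bf (tl e)) (lf (tl e))"
  interpret s: red_params "Suc n" ?D' "\<lambda>e. B (tl e)" "\<lambda>e. bf (tl e)" "\<lambda>e. lf (tl e)"
    by (rule r.shift) simp
  have in3: "pdec (Suc n) ?D' (\<lambda>e. B (tl e)) (\<lambda>e. \<forall>j<m2 (bf (tl e)) (lf (tl e)). \<forall>k<m1 (bf (tl e)) (lf (tl e)).
      in_V0 (lf (tl e)) (bwidth (bf (tl e)) (lf (tl e)))
      (e0 (bf (tl e)) (lf (tl e))) (c0 (bf (tl e)) (lf (tl e)))
      (z (tl e) mod nprime (q2 (bf (tl e)) (lf (tl e))) (hd e) mod nprime (q1 (bf (tl e)) (lf (tl e))) j mod nprime (q0 (bf (tl e)) (lf (tl e))) k))"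
  proof (intro s.pdec_in_V0_mod1 ptime_mod ptime_nprime ptime_hd s.ptime_q2 ptime_tl[OF zr])
    fix e assume e: "?D' e" "length e = Suc n"
    then have e': "?D (tl e)" "length (tl e) = n" by auto
    show "nprime (q2 (bf (tl e)) (lf (tl e))) (hd e) \<le> B (tl e)" using good_less(3)[OF r.good[OF e']] e(1) by blast
    show "0 < nprime (q2 (bf (tl e)) (lf (tl e))) (hd e)" by (rule prime_gt_0_nat[OF prime_nprime])
    show z: "z (tl e) < 2 ^ B (tl e)" by (rule zB[OF e'])
    show "z (tl e) mod nprime (q2 (bf (tl e)) (lf (tl e))) (hd e) < 2 ^ B (tl e)"
      by (rule le_less_trans[OF mod_less_eq_dividend z])
  qed auto
  show ?thesis
    unfolding in_V_def
  proof (intro pdec_conj)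
    show "pdec n D B (\<lambda>e. z e < lf e * (e3 (bf e) (lf e))\<^sup>2)"
      by (rule pdec_less[OF z ptime_mult_square[OF ptime_e3 e3]])
    show "pdec n ?D B (\<lambda>e. \<forall>h<m3 (bf e) (lf e). \<forall>j<m2 (bf e) (lf e). \<forall>k<m1 (bf e) (lf e).
      in_V0 (lf e) (bwidth (bf e) (lf e)) (e0 (bf e) (lf e)) (c0 (bf e) (lf e))
        (z e mod nprime (q2 (bf e) (lf e)) h mod nprime (q1 (bf e) (lf e)) j mod nprime (q0 (bf e) (lf e)) k))"
    proof (rule pdec_all[OF r.ptime_m3 _ in3])
      show "m3 (bf e) (lf e) \<le> B e + 2" if "?D e" "length e = n" for e using r.gd(17)[OF that] by linarith
    qed
  qed
qed

end

section \<open>The uniform family\<close>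

text \<open>The output routine asks for an element by its index. \<open>el\<close> answers by
  inverting the counting function \<open>rank\<close>, which is strictly increasing on
  elements.\<close>

definition rank :: "(nat \<Rightarrow> bool) \<Rightarrow> nat \<Rightarrow> nat" where
  "rank P v = (\<Sum>u<v. of_bool (P u))"

definition el :: "(nat \<Rightarrow> bool) \<Rightarrow> nat \<Rightarrow> nat" where
  "el P i = (LEAST v. P v \<and> rank P v = i)"

lemma rank_Suc: "rank P (Suc v) = rank P v + of_bool (P v)"
  by (simp add: rank_def)

lemma rank_mono: "u \<le> v \<Longrightarrow> rank P u \<le> rank P v"
  unfolding rank_def by (rule sum_mono2) auto

lemma rank_strict: "P u \<Longrightarrow> u < v \<Longrightarrow> rank P u < rank P v"
  using rank_mono[of "Suc u" v P] by (simp add: rank_Suc)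

lemma rank_le: "rank P v \<le> v"
  by (induction v) (auto simp: rank_def le_SucI)

lemma rank_surj: "i < rank P W \<Longrightarrow> \<exists>v<W. P v \<and> rank P v = i"
proof (induction W)
  case 0
  then show ?case by (simp add: rank_def)
next
  case (Suc W)
  show ?case
  proof (cases "i < rank P W")
    case True
    then show ?thesis using Suc.IH less_SucI by blast
  next
    case False
    then have "P W \<and> rank P W = i" using Suc.prems by (cases "P W") (auto simp: rank_Suc)
    then show ?thesis by blast
  qed
qed

lemma el:
  assumes "i < rank P W"
  shows "P (el P i)" "rank P (el P i) = i"
proof -
  obtain v where "P v \<and> rank P v = i" using rank_surj[OF assms] by blast
  from LeastI[of "\<lambda>v. P v \<and> rank P v = i", OF this]
  show "P (el P i)" "rank P (el P i) = i" unfolding el_def by auto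
qed

lemma el_rank:
  assumes "P v"
  shows "el P (rank P v) = v"
proof (rule ccontr)
  assume ne: "el P (rank P v) \<noteq> v"
  have "rank P v < rank P (Suc v)" using assms by (simp add: rank_Suc)
  note e = el[OF this]
  show False
    using ne assms rank_strict[of P v "el P (rank P v)"] rank_strict[of P "el P (rank P v)" v] e
    by (cases "el P (rank P v)" v rule: linorder_cases) auto
qed

lemma enumerate:
  assumes "\<And>v. P v \<Longrightarrow> v < W"
  defines "vs \<equiv> map (el P) [0..<rank P W]"
  shows "distinct vs" "set vs = {v. P v}"
proof -
  have "inj_on (el P) {0..<rank P W}"
    by (rule inj_on_inverseI[of _ "rank P"]) (use el(2) in auto)
  then show "distinct vs" by (simp add: vs_def distinct_map)
  have "v \<in> el P ` {0..<rank P W}" if "P v" for v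
    using that el_rank[of P v] rank_strict[of P v W] assms(1)[of v] by (intro image_eqI[of _ _ "rank P v"]) auto
  then show "set vs = {v. P v}" using el(1) by (auto simp: vs_def)
qed

context red_params
begin

lemma ptime_rank:
  assumes v: "ptime n D B v" and vB: "\<And>e. D e \<Longrightarrow> length e = n \<Longrightarrow> v e \<le> B e + 2"
    and cond: "\<And>e. D e \<Longrightarrow> length e = n \<Longrightarrow> lf e * (e3 (bf e) (lf e))\<^sup>2 \<le> B e"
  shows "ptime n D B (\<lambda>e. rank (in_V (bf e) (lf e)) (v e))"
  unfolding rank_def
proof (rule ptime_sum[OF v vB])
  let ?D = "\<lambda>e. D (tl e) \<and> length e = Suc n \<and> hd e < v (tl e)"
  interpret s: red_params "Suc n" ?D "\<lambda>e. B (tl e)" "\<lambda>e. bf (tl e)" "\<lambda>e. lf (tl e)"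
    by (rule shift) simp
  show "ptime (Suc n) ?D (\<lambda>e. B (tl e)) (\<lambda>e. of_bool (in_V (bf (tl e)) (lf (tl e)) (hd e)))"
    by (rule s.pdec_in_V[unfolded pdec_def, OF ptime_hd]) (use cond in auto)
qed

lemma ptime_el:
  assumes i: "ptime n D B i"
    and cond: "\<And>e. D e \<Longrightarrow> length e = n \<Longrightarrow> lf e * (e3 (bf e) (lf e))\<^sup>2 \<le> B e \<and>
      i e < rank (in_V (bf e) (lf e)) (lf e * (e3 (bf e) (lf e))\<^sup>2)"
  shows "ptime n D B (\<lambda>e. el (in_V (bf e) (lf e)) (i e))"
  unfolding el_def
proof (rule ptime_Least)
  let ?D = "\<lambda>e. D (tl e) \<and> length e = Suc n \<and>
    (\<forall>y<hd e. \<not> (in_V (bf (tl e)) (lf (tl e)) y \<and> rank (in_V (bf (tl e)) (lf (tl e))) y = i (tl e))) \<and>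
    hd e \<le> B (tl e) + 2"
  interpret s: red_params "Suc n" ?D "\<lambda>e. B (tl e)" "\<lambda>e. bf (tl e)" "\<lambda>e. lf (tl e)"
    by (rule shift) simp
  have "pdec (Suc n) ?D (\<lambda>e. B (tl e)) (\<lambda>e. rank (in_V (bf (tl e)) (lf (tl e))) (hd e) = i (tl e))"
    by (intro pdec_eq s.ptime_rank ptime_hd ptime_tl[OF i]) (use cond in auto)
  then have 1: "pdec (Suc n) (\<lambda>e. ?D e \<and> in_V (bf (tl e)) (lf (tl e)) (hd e)) (\<lambda>e. B (tl e))
      (\<lambda>e. rank (in_V (bf (tl e)) (lf (tl e))) (hd e) = i (tl e))"
    unfolding pdec_def by (rule ptime_mono) auto
  have 2: "pdec (Suc n) ?D (\<lambda>e. B (tl e)) (\<lambda>e. in_V (bf (tl e)) (lf (tl e)) (hd e))"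
    by (rule s.pdec_in_V[OF ptime_hd]) (use cond in auto)
  show "pdec (Suc n) ?D (\<lambda>e. B (tl e)) (\<lambda>e. in_V (bf (tl e)) (lf (tl e)) (hd e) \<and>
      rank (in_V (bf (tl e)) (lf (tl e))) (hd e) = i (tl e))"
    by (rule pdec_conj[OF 2 1])
  fix e assume e: "D e" "length e = n"
  obtain v where "v < lf e * (e3 (bf e) (lf e))\<^sup>2" "in_V (bf e) (lf e) v \<and> rank (in_V (bf e) (lf e)) v = i e"
    using rank_surj cond[OF e] by blast
  moreover from this(1) have "v \<le> B e + 2" using cond[OF e] by linarith
  ultimately show "\<exists>x\<le>B e + 2. in_V (bf e) (lf e) x \<and> rank (in_V (bf e) (lf e)) x = i e" by blast
qed

end

lemma computes_phi3:
  assumes adm_good: "\<And>b l. admissible b l \<Longrightarrow> good b l (b ^ R)"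
  shows "\<exists>c p. \<forall>b l. admissible b l \<longrightarrow> (\<forall>x \<in> bitvecs (b * l).
    computes_within c ([int b, int l] @ x) (map (\<lambda>i. int (phi3 b l (pack x) i)) [0..<l]) (poly p b))"
proof -
  define D where "D = (\<lambda>e. admissible (e ! 0) (e ! 1) \<and> e ! 2 < 2 ^ (e ! 0 * e ! 1))"
  define B where "B = (\<lambda>e :: nat list. e ! 0 ^ R)"
  define D' where "D' = (\<lambda>e. D (tl e) \<and> length e = Suc 3 \<and> hd e < tl e ! 1)"
  interpret red_params 3 D B "\<lambda>e. e ! 0" "\<lambda>e. e ! 1"
    by unfold_locales (auto intro!: ptime_nth adm_good simp: D_def B_def)
  interpret s: red_params "Suc 3" D' "\<lambda>e. B (tl e)" "\<lambda>e. tl e ! 0" "\<lambda>e. tl e ! 1"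
    by (rule shift) (simp add: D'_def)
  have "ptime (Suc 3) D' (\<lambda>e. B (tl e)) (\<lambda>e. phi3 (tl e ! 0) (tl e ! 1) (tl e ! 2) (hd e))"
    by (rule s.ptime_phi3[OF ptime_tl[OF ptime_nth, of 2 3 D' D] ptime_hd]) (auto simp: D'_def D_def)
  then have g: "ptime (Suc 3) (\<lambda>e. D (tl e) \<and> length e = Suc 3 \<and> hd e < tl e ! 1) (\<lambda>e. B (tl e))
      (\<lambda>e. (\<lambda>i e. phi3 (e ! 0) (e ! 1) (e ! 2) i) (hd e) (tl e))"
    by (simp only: D'_def)
  obtain c m where c: "\<And>e s. D e \<Longrightarrow> holds [0, 1, 2] e s \<Longrightarrow>
      \<exists>t s'. exec c s t s' \<and> t \<le> (B e + 2) ^ m \<and> (\<forall>i<e ! 1. s' i = int (phi3 (e ! 0) (e ! 1) (e ! 2) i))"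
    using output_list[OF lf _ g, of "[0, 1, 2]"] gd(4) by (force simp del: add_2_eq_Suc')
  obtain d where d: "\<And>b l x. x \<in> bitvecs (b * l) \<Longrightarrow> 5 \<le> b * l \<Longrightarrow>
     \<exists>t s. exec d (init_mem ([int b, int l] @ x)) t s \<and> t \<le> 10 * (b * l + l + 5) \<and>
        holds [0, 1, 2] [b, l, pack x] s"
    using exec_pack by blast
  \<comment> \<open>Packing costs at most \<open>60 * b ^ 2\<close>, since
    \<open>b * l + l + 5 \<le> 6 * b ^ 2\<close>. The rest costs at most
    \<open>(b ^ R + 2) ^ m\<close>, and \<open>b ^ R + 2 \<le> b ^ (R + 1)\<close> because
    \<open>b\<close> is at least 4.\<close>
  define p :: "nat poly" where "p = monom 60 2 + monom 1 ((R + 1) * m)"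
  have "computes_within (Seq d c) ([int b, int l] @ x) (map (\<lambda>i. int (phi3 b l (pack x) i)) [0..<l]) (poly p b)"
    if adm: "admissible b l" and x: "x \<in> bitvecs (b * l)" for b l x
  proof -
    have b: "4 \<le> b" "2 \<le> l" using goodD(1,2)[OF adm_good[OF adm]] by auto
    then have "4 * 2 \<le> b * l" by (rule mult_le_mono)
    then obtain t1 s1 where 1: "exec d (init_mem ([int b, int l] @ x)) t1 s1" "t1 \<le> 10 * (b * l + l + 5)"
        "holds [0, 1, 2] [b, l, pack x] s1"
      using d[OF x] by auto
    have "D [b, l, pack x]" using adm pack_less[OF x] by (simp add: D_def)
    from c[OF this 1(3)] obtain t2 s2 where 2: "exec c s1 t2 s2" "t2 \<le> (b ^ R + 2) ^ m"
        "\<And>i. i < l \<Longrightarrow> s2 i = int (phi3 b l (pack x) i)"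
      by (auto simp: B_def)
    have "l < b" using admissible_le(2)[OF adm] self_less_two_power_tower[of l] by linarith
    then have "b * l \<le> b * b" by (intro mult_le_mono2) simp
    moreover have "b \<le> b * b" by (rule le_square)
    moreover have "4 * 4 \<le> b * b" by (rule mult_le_mono[OF b(1) b(1)])
    ultimately have "b * l + l + 5 \<le> 6 * (b * b)" using \<open>l < b\<close> by linarith
    with 1(2) have t1: "t1 \<le> 60 * b ^ 2" by (simp add: power2_eq_square)
    have "1 \<le> b ^ R" using b by simp
    then have "b ^ R + 2 \<le> 4 * b ^ R" by simp
    also have "\<dots> \<le> b ^ (R + 1)" using b(1) by simp
    finally have "(b ^ R + 2) ^ m \<le> (b ^ (R + 1)) ^ m" by (rule power_mono) simp
    with 2(2) have "t2 \<le> b ^ ((R + 1) * m)" by (simp only: power_mult)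
    with t1 have "t1 + t2 \<le> poly p b" by (simp add: p_def poly_monom)
    then show ?thesis
      unfolding computes_within_def using Seq[OF 1(1) 2(1)] 2(3) by fastforce
  qed
  then show ?thesis by blast
qed

text \<open>All numbers below \<open>W b l\<close> are tested, so the size parameter is
  \<open>W b l * b ^ R\<close>. Since \<open>W b l\<close> is at most
  \<open>l ^ (3 * (\<tau> b * b))\<close>, a power of this size splits into a power of
  \<open>l\<close> and a polynomial in \<open>b\<close>, the shape of the required bound.\<close>

lemma computes_in_V:
  assumes adm_good: "\<And>b l. admissible b l \<Longrightarrow> good b l (b ^ R)"
    and e3: "\<And>b l. admissible b l \<Longrightarrow> e3 b l \<le> l ^ (\<tau> b * b)"
    and \<tau>: "\<And>b. 1 \<le> b \<Longrightarrow> 1 \<le> \<tau> b"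
  shows "\<exists>c C q. \<forall>b l. admissible b l \<longrightarrow>
    (\<exists>vs. distinct vs \<and> set vs = int ` {v. in_V b l v} \<and>
       computes_within c [int b, int l] (int (length vs) # vs) (l ^ (C * (\<tau> b * b)) * poly q b))"
proof -
  define W where "W b l = l * (e3 b l)\<^sup>2" for b l
  define D where "D = (\<lambda>e. admissible (e ! 0) (e ! 1))"
  define B where "B = (\<lambda>e :: nat list. W (e ! 0) (e ! 1) * e ! 0 ^ R)"
  have pos: "0 < W b l" "0 < b" if adm: "admissible b l" for b l
  proof -
    show b: "0 < b" using goodD(2)[OF adm_good[OF adm]] by simp
    obtain \<kappa> \<phi> V where "params b l \<kappa> \<phi> V" using adm_good[OF adm] unfolding good_def by blast
    then interpret params b l \<kappa> \<phi> V .
    show "0 < W b l" using l nprod_pos by (simp add: W_def e3_def)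
  qed
  have WB: "W (e ! 0) (e ! 1) \<le> B e" if "D e" for e
    using pos[of "e ! 0" "e ! 1"] that by (simp add: B_def D_def)
  have goodB: "good (e ! 0) (e ! 1) (B e)" if "D e" for e
    using adm_good[of "e ! 0" "e ! 1"] that pos(1)[of "e ! 0" "e ! 1"] unfolding good_def B_def D_def
    by (auto elim!: fits_mono)
  interpret red_params 2 D B "\<lambda>e. e ! 0" "\<lambda>e. e ! 1"
  proof
    show "good (e ! 0) (e ! 1) (B e)" if "D e" for e by (rule goodB[OF that])
  qed (auto intro: ptime_nth)
  have W_ptime: "ptime 2 D B (\<lambda>e. W (e ! 0) (e ! 1))"
    unfolding W_def
  proof (rule ptime_mult_square[OF ptime_e3])
    fix e assume "D e" "length e = 2"
    have "e3 (e ! 0) (e ! 1) \<le> (e3 (e ! 0) (e ! 1))\<^sup>2" by (simp add: power2_eq_square)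
    also have "\<dots> \<le> W (e ! 0) (e ! 1)" using goodD(1)[OF goodB[OF \<open>D e\<close>]] by (simp add: W_def)
    also have "\<dots> \<le> B e" by (rule WB[OF \<open>D e\<close>])
    finally show "e3 (e ! 0) (e ! 1) \<le> B e" .
  qed
  define size_V where "size_V e = rank (in_V (e ! 0) (e ! 1)) (W (e ! 0) (e ! 1))" for e
  have size_V_ptime: "ptime 2 D B size_V"
    unfolding size_V_def by (rule ptime_rank[OF W_ptime]) (use WB in \<open>force simp: W_def\<close>)+
  have N: "ptime 2 D B (\<lambda>e. size_V e + 1)" by (intro ptime_add size_V_ptime ptime_const)
  define D' where "D' = (\<lambda>e. D (tl e) \<and> length e = Suc 2 \<and> hd e < size_V (tl e) + 1)"
  \<comment> \<open>Index 0 is the header of the output, the number of elements; the elements are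
    therefore shifted by one.\<close>
  define g where "g = (\<lambda>i e. if i = 0 then size_V e else el (in_V (e ! 0) (e ! 1)) (i - 1))"
  have "ptime (Suc 2) D' (\<lambda>e. B (tl e)) (\<lambda>e. g (hd e) (tl e))"
    unfolding g_def
  proof (intro ptime_if pdec_eq ptime_hd ptime_const)
    show "ptime (Suc 2) (\<lambda>e. D' e \<and> hd e = 0) (\<lambda>e. B (tl e)) (\<lambda>e. size_V (tl e))"
      by (rule ptime_tl[OF size_V_ptime]) (simp add: D'_def)
    let ?D = "\<lambda>e. D' e \<and> hd e \<noteq> 0"
    interpret s: red_params "Suc 2" ?D "\<lambda>e. B (tl e)" "\<lambda>e. tl e ! 0" "\<lambda>e. tl e ! 1"
      by (rule shift) (simp add: D'_def)
    show "ptime (Suc 2) ?D (\<lambda>e. B (tl e)) (\<lambda>e. el (in_V (tl e ! 0) (tl e ! 1)) (hd e - 1))"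
    proof (intro s.ptime_el ptime_diff ptime_hd ptime_const)
      fix e assume "?D e" "length e = Suc 2"
      then show "tl e ! 1 * (e3 (tl e ! 0) (tl e ! 1))\<^sup>2 \<le> B (tl e) \<and>
        hd e - 1 < rank (in_V (tl e ! 0) (tl e ! 1)) (tl e ! 1 * (e3 (tl e ! 0) (tl e ! 1))\<^sup>2)"
        using WB[of "tl e"] by (auto simp: D'_def W_def size_V_def)
    qed
  qed
  then have g_ptime: "ptime (Suc 2) (\<lambda>e. D (tl e) \<and> length e = Suc 2 \<and> hd e < size_V (tl e) + 1) (\<lambda>e. B (tl e))
      (\<lambda>e. g (hd e) (tl e))"
    by (simp only: D'_def)
  have cntB: "size_V e + 1 \<le> B e + 2" if "D e" for e
    using WB[OF that] rank_le[of "in_V (e ! 0) (e ! 1)" "W (e ! 0) (e ! 1)"] unfolding size_V_def by linarith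
  obtain c m where c: "\<And>e s. D e \<Longrightarrow> holds [0, 1] e s \<Longrightarrow>
      \<exists>t s'. exec c s t s' \<and> t \<le> (B e + 2) ^ m \<and> (\<forall>i<size_V e + 1. s' i = int (g i e))"
    using output_list[OF N cntB g_ptime, of "[0, 1]"] by force
  define q :: "nat poly" where "q = monom 1 ((R + 1) * m)"
  have "\<exists>vs. distinct vs \<and> set vs = int ` {v. in_V b l v} \<and>
       computes_within c [int b, int l] (int (length vs) # vs) (l ^ (3 * m * (\<tau> b * b)) * poly q b)"
    if adm: "admissible b l" for b l
  proof -
    have b: "4 \<le> b" "2 \<le> l" using goodD(1,2)[OF adm_good[OF adm]] by auto
    have De: "D [b, l]" using adm by (simp add: D_def)
    define vs where "vs = map (el (in_V b l)) [0..<rank (in_V b l) (W b l)]"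
    have vs: "distinct vs" "set vs = {v. in_V b l v}"
      unfolding vs_def by (rule enumerate; simp add: in_V_def W_def)+
    have len: "length vs = size_V [b, l]" by (simp add: vs_def size_V_def)
    have "holds [0, 1] [b, l] (init_mem [int b, int l])" by (simp add: init_mem_def)
    from c[OF De this] obtain t s where ts: "exec c (init_mem [int b, int l]) t s" "t \<le> (B [b, l] + 2) ^ m"
      "\<And>i. i < size_V [b, l] + 1 \<Longrightarrow> s i = int (g i [b, l])" by blast
    have out: "s i = (int (length (map int vs)) # map int vs) ! i" if "i < length (int (length (map int vs)) # map int vs)" for i
    proof (cases i)
      case 0
      then show ?thesis using ts(3)[of 0] len by (simp add: g_def)
    next
      case (Suc j)
      then have "j < size_V [b, l]" using that len by simp
      then show ?thesis using ts(3)[of i] Suc len by (simp add: g_def vs_def size_V_def)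
    qed
    have t1: "1 \<le> \<tau> b * b" using \<tau>[of b] b by simp
    have "(e3 b l)\<^sup>2 \<le> (l ^ (\<tau> b * b))\<^sup>2" by (rule power_mono[OF e3[OF adm]]) simp
    then have "W b l \<le> l * (l ^ (\<tau> b * b))\<^sup>2" unfolding W_def by (rule mult_le_mono2)
    also have "\<dots> = l ^ Suc (\<tau> b * b * 2)" by (simp only: power_Suc power_mult)
    also have "\<dots> \<le> l ^ (3 * (\<tau> b * b))" using t1 b by (intro power_increasing) linarith+
    finally have W: "W b l \<le> l ^ (3 * (\<tau> b * b))" .
    have B_eq: "B [b, l] = W b l * b ^ R" by (simp add: B_def)
    have "0 < W b l * b ^ R" using pos[OF adm] by simp
    then have "B [b, l] + 2 \<le> 4 * (W b l * b ^ R)" unfolding B_eq by linarith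
    also have "\<dots> \<le> b * (W b l * b ^ R)" by (rule mult_le_mono1[OF b(1)])
    also have "\<dots> = W b l * b ^ (R + 1)" by simp
    also have "\<dots> \<le> l ^ (3 * (\<tau> b * b)) * b ^ (R + 1)" by (rule mult_le_mono1[OF W])
    finally have "(B [b, l] + 2) ^ m \<le> (l ^ (3 * (\<tau> b * b)) * b ^ (R + 1)) ^ m" by (rule power_mono) simp
    also have "\<dots> = l ^ (3 * m * (\<tau> b * b)) * poly q b"
      by (simp add: power_mult_distrib q_def poly_monom power_mult[symmetric] mult_ac del: power_Suc)
    finally have "t \<le> l ^ (3 * m * (\<tau> b * b)) * poly q b" using ts(2) by linarith
    then have "computes_within c [int b, int l] (int (length (map int vs)) # map int vs) (l ^ (3 * m * (\<tau> b * b)) * poly q b)"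
      unfolding computes_within_def using ts(1) out by blast
    moreover have "distinct (map int vs)" "set (map int vs) = int ` {v. in_V b l v}"
      using vs by (simp_all add: distinct_map)
    ultimately show ?thesis by blast
  qed
  then show ?thesis by blast
qed

lemma is_reduction_mono:
  assumes "is_reduction b l \<kappa> \<phi> V" "\<kappa> \<le> \<kappa>'" "1 \<le> l"
  shows "is_reduction b l \<kappa>' \<phi> V"
proof -
  have "int l ^ (\<kappa> * b) \<le> int l ^ (\<kappa>' * b)"
    using assms(2,3) by (intro power_increasing mult_le_mono1) auto
  then show ?thesis using assms(1) unfolding is_reduction_def by (meson less_le_trans)
qed

theorem theoremB2:
  fixes \<tau> :: "nat \<Rightarrow> nat"
  assumes "mono \<tau>"
    and "(\<lambda>n. real (\<tau> n)) \<in> O(\<lambda>n. log 2 (log 2 (log 2 (real n))))"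
    and "\<exists>\<phi> V. reduction_family \<tau> \<phi> V"
  shows "\<exists>\<tau>'. (\<lambda>n. real (\<tau>' n)) \<in> O(\<lambda>n. real (\<tau> n)) \<and>
           (\<exists>\<phi> V. uniform_reduction_family \<tau>' \<phi> V)"
proof -
  obtain \<phi> V where fam: "reduction_family \<tau> \<phi> V" using assms(3) by blast
  obtain R C where C: "1 \<le> C"
    and fits: "\<And>b l. admissible b l \<Longrightarrow> fits b l (b ^ R)"
    and e3: "\<And>b l. admissible b l \<Longrightarrow> e3 b l \<le> l ^ (C * \<tau> b * b)"
    by (rule family_bounds[OF assms(1,2) fam]) (rule that)
  define \<tau>' where "\<tau>' b = C * \<tau> b" for b
  \<comment> \<open>Uniformity is demanded for admissible pairs only; elsewhere the given family is
    kept, with its bound relaxed from \<open>\<tau>\<close> to \<open>\<tau>'\<close>.\<close>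
  define \<phi>' where "\<phi>' b l = (if admissible b l then \<lambda>x. map (\<lambda>i. int (phi3 b l (pack x) i)) [0..<l] else \<phi> b l)" for b l
  define V' where "V' b l = (if admissible b l then int ` {v. in_V b l v} else V b l)" for b l
  have good: "good b l (b ^ R)" if "admissible b l" for b l
    using fits[OF that] family_params[OF fam that] unfolding good_def by blast
  have pos: "1 \<le> \<tau>' n" if "1 \<le> n" for n
    using fam that C is_reduction_pos[of n 2 "\<tau> n" "\<phi> n 2" "V n 2"] by (simp add: reduction_family_def \<tau>'_def)
  have "is_reduction b l (\<tau>' b) (\<phi>' b l) (V' b l)" if "2 \<le> l" for b l
  proof (cases "admissible b l")
    case True
    interpret params b l "\<tau> (bsize b l)" "\<phi> (bsize b l) l" "V (bsize b l) l"
      by (rule family_params[OF fam True])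
    show ?thesis
      using is_reduction_phi3[of "\<tau>' b"] e3[OF True] True by (simp add: \<phi>'_def V'_def \<tau>'_def)
  next
    case False
    have "is_reduction b l (\<tau> b) (\<phi> b l) (V b l)" using fam that by (simp add: reduction_family_def)
    then have "is_reduction b l (\<tau>' b) (\<phi> b l) (V b l)"
      by (rule is_reduction_mono) (use C that in \<open>auto simp: \<tau>'_def\<close>)
    then show ?thesis using False by (simp add: \<phi>'_def V'_def)
  qed
  moreover have "mono \<tau>'"
    using assms(1) unfolding \<tau>'_def mono_def by (auto intro: mult_le_mono2)
  ultimately have fam': "reduction_family \<tau>' \<phi>' V'" by (simp add: reduction_family_def)
  obtain c p where "\<And>b l x. admissible b l \<Longrightarrow> x \<in> bitvecs (b * l) \<Longrightarrow>
      computes_within c ([int b, int l] @ x) (map (\<lambda>i. int (phi3 b l (pack x) i)) [0..<l]) (poly p b)"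
    using computes_phi3[OF good] by blast
  then have comp: "\<forall>b l. admissible b l \<longrightarrow> (\<forall>x \<in> bitvecs (b * l).
      computes_within c ([int b, int l] @ x) (\<phi>' b l x) (poly p b))"
    by (simp add: \<phi>'_def)
  have e3': "e3 b l \<le> l ^ (\<tau>' b * b)" if "admissible b l" for b l
    using e3[OF that] by (simp add: \<tau>'_def)
  obtain c' C' q where "\<And>b l. admissible b l \<Longrightarrow> \<exists>vs. distinct vs \<and> set vs = int ` {v. in_V b l v} \<and>
       computes_within c' [int b, int l] (int (length vs) # vs) (l ^ (C' * (\<tau>' b * b)) * poly q b)"
    using computes_in_V[where \<tau> = \<tau>', OF good e3' pos] by blast
  then have "\<forall>b l. admissible b l \<longrightarrow> (\<exists>vs. distinct vs \<and> set vs = V' b l \<and>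
       computes_within c' [int b, int l] (int (length vs) # vs) (l ^ (C' * (\<tau>' b * b)) * poly q b))"
    by (simp add: V'_def)
  then have "uniform_reduction_family \<tau>' \<phi>' V'"
    unfolding uniform_reduction_family_def using fam' comp by blast
  moreover have "(\<lambda>n. real (\<tau>' n)) \<in> O(\<lambda>n. real (\<tau> n))"
    by (rule bigoI[of _ "real C"]) (simp add: \<tau>'_def)
  ultimately show ?thesis by blast
qed

end
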